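(* Let $\Omega\subset\mathbb{R}^d$ be a bounded domain with piecewise smooth boundary $\Sigma$, let $\Sigma_1\subseteq\Sigma$ be a part of the boundary of positive surface measure (possibly $\Sigma_1=\Sigma$) and $\Sigma_2=\Sigma\setminus\Sigma_1$. Let $c$ be a twice differentiable function with $0<c_{\min}\le c(x)\le c_{\max}$ on $\overline\Omega$, let $\alpha$ be a cut-off function as in the context, and let $f\in H^1(\Omega)$ be compactly supported within $\Omega$. Let $\lambda_n^2$ ($n=1,2,\dots$, $\lambda_n\ge 0$) be the Neumann eigenvalues and $\nu_k^2$ ($k=1,2,\dots$, $\nu_k>0$) the mixed eigenvalues defined in the context, and assume $$\lambda_n\neq\nu_k\qquad\text{for all } n,k .$$ For $\varepsilon>0$ let $v_\varepsilon$ be the solution of the gradual time reversal problem on $[0,T]$, $T=1/\varepsilon$, defined in the context. Then $v_\varepsilon(0,\cdot)$ converges to $f$ weakly in $H^1(\Omega)$ as $\varepsilon\to0$ (equivalently, as $T\to\infty$).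
   Context: Cut-off function: $\alpha:[0,1]\to\mathbb{R}$ is infinitely smooth, identically equal to $1$ in some neighborhood of $0$, and vanishes together with all its derivatives at $1$. Inner products: $\langle g,h\rangle_{c^{-2}}=\int_\Omega c^{-2}g\overline h\,dx$, with norm $\|\cdot\|_{c^{-2}}$; $[g,h]_{H^1}=\int_\Omega\{c^{-2}g\overline h+\nabla g\cdot\nabla\overline h\}\,dx$, with norm $\|\cdot\|_{H^1}$ on $H^1(\Omega)$. Eigenfunctions (in the weak sense, in $H^1(\Omega)$). Neumann: $-\Delta\varphi_n=c^{-2}\lambda_n^2\varphi_n$ in $\Omega$, $\partial\varphi_n/\partial\mathbf n=0$ on $\Sigma$, eigenvalues in non-decreasing order, $0=\lambda_1<\lambda_2\le\dots$. Mixed: $-\Delta\psi_k=c^{-2}\nu_k^2\psi_k$ in $\Omega$, $\psi_k=0$ on $\Sigma_1$, $\partial\psi_k/\partial\mathbf n=0$ on $\Sigma_2$, eigenvalues in non-decreasing order, $0<\nu_1\le\nu_2\le\dots$. Both spectra are discrete, and $(\varphi_n)$ and $(\psi_k)$ are taken as orthonormal bases with respect to $\langle\cdot,\cdot\rangle_{c^{-2}}$. Forward problem: $u(t,x)$ is the weak solution of $c^{-2}u_{tt}=\Delta u$ in $\Omega$, $t\ge0$, with $u(0,\cdot)=f$, $u_t(0,\cdot)=0$, $\partial u/\partial\mathbf n=0$ on $\Sigma$; that is, $u(t,x)=\sum_{n\ge1}u_n\varphi_n(x)\cos(\lambda_nt)$ with $u_n=\langle f,\varphi_n\rangle_{c^{-2}}$.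 The data are $U(t,z)=u(t,z)$, $z\in\Sigma_1$. Gradual time reversal problem ($T=1/\varepsilon$): $v_\varepsilon$ solves, on $[0,T]\times\Omega$, $$c^{-2}\partial_t^2v_\varepsilon=\Delta v_\varepsilon,\quad v_\varepsilon(T,\cdot)=0,\ \partial_tv_\varepsilon(T,\cdot)=0,\quad v_\varepsilon(t,z)=U(t,z)\alpha(\varepsilon t)\ (z\in\Sigma_1),\quad \partial v_\varepsilon/\partial\mathbf n=0\ (z\in\Sigma_2).$$ This is understood in the weak sense: $v_\varepsilon(t,x)=u(t,x)\alpha(\varepsilon t)+w_\varepsilon(t,x)$, where $w_\varepsilon$ is the weak solution of $c^{-2}\partial_t^2w_\varepsilon-\Delta w_\varepsilon=c^{-2}F_\varepsilon$, $F_\varepsilon(t,x)=-\varepsilon\big(2\alpha'(\varepsilon t)u_t(t,x)+\varepsilon\alpha''(\varepsilon t)u(t,x)\big)$, with $w_\varepsilon(T,\cdot)=\partial_tw_\varepsilon(T,\cdot)=0$, $w_\varepsilon=0$ on $\Sigma_1$, $\partial w_\varepsilon/\partial\mathbf n=0$ on $\Sigma_2$. Equivalently, $w_\varepsilon(t,x)=\sum_{k\ge1}w_k(t)\psi_k(x)$ with $w_k''+\nu_k^2w_k=\langle F_\varepsilon(t,\cdot),\psi_k\rangle_{c^{-2}}$, $w_k(T)=w_k'(T)=0$. *)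

theory Defs
  imports "HOL-Analysis.Analysis"
begin

section \<open>Smooth functions\<close>

text \<open>Meant for open \<open>S\<close>. In finite dimension this is the usual \<open>C\<^sup>k\<close> regularity, as all directional
  derivatives are required to be \<open>C\<^sup>k\<^sup>-\<^sup>1\<close>.\<close>

fun Ck_on :: "nat \<Rightarrow> 'a::real_normed_vector set \<Rightarrow> ('a \<Rightarrow> 'b::real_normed_vector) \<Rightarrow> bool" where
  "Ck_on 0 S f \<longleftrightarrow> continuous_on S f"
| "Ck_on (Suc k) S f \<longleftrightarrow>
     f differentiable_on S \<and> (\<forall>v. Ck_on k S (\<lambda>x. frechet_derivative f (at x) v))"

definition smooth_on :: "'a::real_normed_vector set \<Rightarrow> ('a \<Rightarrow> 'b::real_normed_vector) \<Rightarrow> bool" where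
  "smooth_on S f \<longleftrightarrow> (\<forall>k. Ck_on k S f)"

definition twice_differentiable_on ::
    "('a::real_normed_vector \<Rightarrow> 'b::real_normed_vector) \<Rightarrow> 'a set \<Rightarrow> bool" where
  "twice_differentiable_on f S \<longleftrightarrow>
     f differentiable_on S \<and> (\<forall>v. (\<lambda>x. frechet_derivative f (at x) v) differentiable_on S)"

text \<open>Derivatives on \<open>[0,1]\<close>, one-sided at the two end points.\<close>

definition unit_deriv :: "nat \<Rightarrow> (real \<Rightarrow> real) \<Rightarrow> real \<Rightarrow> real" where
  "unit_deriv n = (\<lambda>g t. vector_derivative g (at t within {0..1})) ^^ n"

definition cutoff :: "(real \<Rightarrow> real) \<Rightarrow> bool" where
  "cutoff \<alpha> \<longleftrightarrow>
     (\<forall>n. \<forall>t\<in>{0..1}. unit_deriv n \<alpha> differentiable (at t within {0..1})) \<and>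
     (\<exists>\<delta>>0. \<forall>t\<in>{0..1}. t < \<delta> \<longrightarrow> \<alpha> t = 1) \<and>
     (\<forall>n. unit_deriv n \<alpha> 1 = 0)"


section \<open>Surface measure\<close>

text \<open>The surface measure on the boundary of a domain in \<open>\<real>\<^sup>d\<close> is the \<open>(d-1)\<close>-dimensional Hausdorff measure,
  with the normalisation which makes it agree with the Euclidean area of smooth hypersurfaces.\<close>

definition hausdorff_gauge :: "nat \<Rightarrow> 'a::metric_space set \<Rightarrow> ennreal" where
  "hausdorff_gauge m U =
     (if U = {} then 0 else ennreal (unit_ball_vol (real m) * (diameter U / 2) ^ m))"

definition hausdorff_pre :: "nat \<Rightarrow> real \<Rightarrow> 'a::metric_space set \<Rightarrow> ennreal" where
  "hausdorff_pre m \<delta> E =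
     (INF U \<in> {U :: nat \<Rightarrow> 'a set. E \<subseteq> (\<Union>i. U i) \<and> (\<forall>i. bounded (U i) \<and> diameter (U i) \<le> \<delta>)}.
        \<Sum>i. hausdorff_gauge m (U i))"

definition hausdorff_outer :: "nat \<Rightarrow> 'a::metric_space set \<Rightarrow> ennreal" where
  "hausdorff_outer m E = (SUP \<delta>\<in>{0<..}. hausdorff_pre m \<delta> E)"

definition hausdorff_measure :: "nat \<Rightarrow> 'a::metric_space measure" where
  "hausdorff_measure m = measure_of UNIV (sets borel) (hausdorff_outer m)"

text \<open>As \<open>measure_of\<close> returns the null measure for set functions that are not countably additive, we check that
  it does not do so here: \<open>hausdorff_outer\<close> is a metric outer measure.\<close>

lemma hausdorff_pre_mono: "E \<subseteq> F \<Longrightarrow> hausdorff_pre m \<delta> E \<le> hausdorff_pre m \<delta> F"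
  unfolding hausdorff_pre_def by (rule INF_superset_mono) auto

lemma hausdorff_pre_antimono: "\<delta> \<le> \<delta>' \<Longrightarrow> hausdorff_pre m \<delta>' E \<le> hausdorff_pre m \<delta> E"
  unfolding hausdorff_pre_def by (rule INF_superset_mono) (auto intro: order_trans)

lemma hausdorff_outer_mono: "E \<subseteq> F \<Longrightarrow> hausdorff_outer m E \<le> hausdorff_outer m F"
  unfolding hausdorff_outer_def by (intro SUP_mono) (auto intro: hausdorff_pre_mono)

lemma hausdorff_pre_le_outer: "0 < \<delta> \<Longrightarrow> hausdorff_pre m \<delta> E \<le> hausdorff_outer m E"
  unfolding hausdorff_outer_def by (rule SUP_upper) auto

lemma hausdorff_outer_empty [simp]: "hausdorff_outer m ({} :: 'a::metric_space set) = 0"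
proof -
  have "hausdorff_pre m \<delta> ({} :: 'a set) = 0" if "0 < \<delta>" for \<delta>
  proof -
    have "hausdorff_pre m \<delta> ({} :: 'a set) \<le> (\<Sum>i::nat. hausdorff_gauge m ({} :: 'a set))"
      unfolding hausdorff_pre_def using that by (intro INF_lower2[of "\<lambda>_. {}"]) auto
    then show ?thesis by (simp add: hausdorff_gauge_def)
  qed
  then show ?thesis by (simp add: hausdorff_outer_def)
qed

lemma hausdorff_pre_subadditive:
  fixes E :: "nat \<Rightarrow> 'a::metric_space set"
  shows "hausdorff_pre m \<delta> (\<Union>i. E i) \<le> (\<Sum>i. hausdorff_pre m \<delta> (E i))"
proof (rule ennreal_le_epsilon)
  fix e :: real assume e: "0 < e" and fin: "(\<Sum>i. hausdorff_pre m \<delta> (E i)) < top"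
  have fin1: "hausdorff_pre m \<delta> (E i) \<noteq> \<infinity>" for i
    using fin by (metis ennreal_suminf_lessD infinity_ennreal_def less_irrefl)
  have "\<exists>U. (E i \<subseteq> (\<Union>j. U j) \<and> (\<forall>j. bounded (U j) \<and> diameter (U j) \<le> \<delta>)) \<and>
      (\<Sum>j. hausdorff_gauge m (U j)) \<le> hausdorff_pre m \<delta> (E i) + ennreal (e * (1/2) ^ Suc i)" for i
  proof -
    have "hausdorff_pre m \<delta> (E i) < hausdorff_pre m \<delta> (E i) + ennreal (e * (1/2) ^ Suc i)"
      using fin1[of i] e
      by (metis add.right_neutral ennreal_add_left_cancel_less ennreal_less_zero_iff infinity_ennreal_def 
          mult_pos_pos order_less_le top.not_eq_extremum zero_less_divide_1_iff zero_less_numeral zero_less_power)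
    then show ?thesis
      unfolding hausdorff_pre_def INF_less_iff by (force dest: less_imp_le)
  qed
  then obtain U where U: "\<And>i. E i \<subseteq> (\<Union>j. U i j)"
      "\<And>i j. bounded (U i j)" "\<And>i j. diameter (U i j) \<le> \<delta>"
      "\<And>i. (\<Sum>j. hausdorff_gauge m (U i j)) \<le> hausdorff_pre m \<delta> (E i) + ennreal (e * (1/2) ^ Suc i)"
    by metis
  have "hausdorff_pre m \<delta> (\<Union>i. E i) \<le> (\<Sum>k. hausdorff_gauge m (case_prod U (prod_decode k)))"
    unfolding hausdorff_pre_def
  proof (rule INF_lower, safe)
    fix x i assume "x \<in> E i"
    then obtain j where "x \<in> U i j" using U(1) by blast
    then show "x \<in> (\<Union>k. case_prod U (prod_decode k))"
      by (intro UN_I[of "prod_encode (i, j)"]) auto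
  qed (use U(2,3) in \<open>auto split: prod.split\<close>)
  also have "\<dots> = (\<Sum>i. \<Sum>j. hausdorff_gauge m (U i j))"
    using suminf_ennreal_2dimen[of "\<lambda>i. \<Sum>j. hausdorff_gauge m (U i j)" "\<lambda>p. hausdorff_gauge m (case_prod U p)"]
    by (simp add: comp_def)
  also have "\<dots> \<le> (\<Sum>i. hausdorff_pre m \<delta> (E i) + ennreal (e * (1/2) ^ Suc i))"
    by (intro suminf_le U(4) summableI)
  also have "\<dots> = (\<Sum>i. hausdorff_pre m \<delta> (E i)) + (\<Sum>i. ennreal (e * (1/2) ^ Suc i))"
    by (intro suminf_add[symmetric] summableI)
  also have "(\<Sum>i. ennreal (e * (1/2) ^ Suc i)) = ennreal e"
    using e sums_mult[OF power_half_series, of e] by (intro suminf_ennreal_eq) auto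
  finally show "hausdorff_pre m \<delta> (\<Union>i. E i) \<le> (\<Sum>i. hausdorff_pre m \<delta> (E i)) + ennreal e" .
qed

lemma hausdorff_outer_subadditive:
  fixes E :: "nat \<Rightarrow> 'a::metric_space set"
  shows "hausdorff_outer m (\<Union>i. E i) \<le> (\<Sum>i. hausdorff_outer m (E i))"
  unfolding hausdorff_outer_def[of m "\<Union>i. E i"]
proof (rule SUP_least)
  fix \<delta> :: real assume "\<delta> \<in> {0<..}"
  then show "hausdorff_pre m \<delta> (\<Union>i. E i) \<le> (\<Sum>i. hausdorff_outer m (E i))"
    by (intro order_trans[OF hausdorff_pre_subadditive] suminf_le summableI hausdorff_pre_le_outer) auto
qed

lemma outer_measure_space_hausdorff:
  "outer_measure_space UNIV (hausdorff_outer m :: 'a::metric_space set \<Rightarrow> ennreal)"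
  by (auto simp: outer_measure_space_def positive_def increasing_def countably_subadditive_def
      intro: hausdorff_outer_mono hausdorff_outer_subadditive)

lemma hausdorff_outer_Un: "hausdorff_outer m (A \<union> B) \<le> hausdorff_outer m A + hausdorff_outer m B"
proof -
  define E where "E = (\<lambda>i::nat. if i = 0 then A else if i = 1 then B else {})"
  have "A \<union> B = (\<Union>i. E i)"
    by (auto simp: E_def split: if_splits)
  moreover have "(\<Sum>i. hausdorff_outer m (E i)) = (\<Sum>i\<in>{0,1}. hausdorff_outer m (E i))"
    by (rule suminf_finite) (auto simp: E_def)
  ultimately show ?thesis
    using hausdorff_outer_subadditive[of m E] by (simp add: E_def)
qed

lemma hausdorff_outer_metric:
  assumes "0 < r" and sep: "\<And>x y. x \<in> A \<Longrightarrow> y \<in> B \<Longrightarrow> r \<le> dist x y"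
  shows "hausdorff_outer m A + hausdorff_outer m B \<le> hausdorff_outer m (A \<union> B)"
proof -
  have pre: "hausdorff_pre m \<delta> A + hausdorff_pre m \<delta> B \<le> hausdorff_pre m \<delta> (A \<union> B)" if "0 < \<delta>" "\<delta> < r" for \<delta>
    unfolding hausdorff_pre_def[of _ _ "A \<union> B"]
  proof (rule INF_greatest)
    fix U :: "nat \<Rightarrow> 'a set"
    assume "U \<in> {U. A \<union> B \<subseteq> (\<Union>i. U i) \<and> (\<forall>i. bounded (U i) \<and> diameter (U i) \<le> \<delta>)}"
    then have U: "A \<union> B \<subseteq> (\<Union>i. U i)" "\<And>i. bounded (U i)" "\<And>i. diameter (U i) \<le> \<delta>"
      by auto
    define V where "V S i = (if U i \<inter> S = {} then {} else U i)" for S i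
    have V: "hausdorff_pre m \<delta> S \<le> (\<Sum>i. hausdorff_gauge m (V S i))" if S: "S \<subseteq> A \<union> B" for S
      unfolding hausdorff_pre_def
    proof (rule INF_lower, safe)
      fix x assume "x \<in> S"
      then obtain i where "x \<in> U i" using U(1) S by blast
      then show "x \<in> (\<Union>i. V S i)"
        using \<open>x \<in> S\<close> by (auto simp: V_def intro!: exI[of _ i])
    qed (use U(2,3) \<open>0 < \<delta>\<close> in \<open>auto simp: V_def\<close>)
    have disj: "U i \<inter> A = {} \<or> U i \<inter> B = {}" for i
    proof (rule ccontr)
      assume "\<not> ?thesis"
      then obtain x y where xy: "x \<in> U i" "x \<in> A" "y \<in> U i" "y \<in> B" by blast
      then have "dist x y \<le> \<delta>"
        using diameter_bounded_bound[OF U(2)] U(3)[of i] by force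
      with sep[OF xy(2,4)] \<open>\<delta> < r\<close> show False by simp
    qed
    have "hausdorff_pre m \<delta> A + hausdorff_pre m \<delta> B
        \<le> (\<Sum>i. hausdorff_gauge m (V A i)) + (\<Sum>i. hausdorff_gauge m (V B i))"
      by (intro add_mono V) auto
    also have "\<dots> = (\<Sum>i. hausdorff_gauge m (V A i) + hausdorff_gauge m (V B i))"
      by (intro suminf_add summableI)
    also have "\<dots> \<le> (\<Sum>i. hausdorff_gauge m (U i))"
    proof (intro suminf_le summableI)
      show "hausdorff_gauge m (V A i) + hausdorff_gauge m (V B i) \<le> hausdorff_gauge m (U i)" for i
        using disj[of i] by (auto simp: V_def hausdorff_gauge_def)
    qed
    finally show "hausdorff_pre m \<delta> A + hausdorff_pre m \<delta> B \<le> (\<Sum>i. hausdorff_gauge m (U i))" .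
  qed
  have "hausdorff_outer m A + hausdorff_outer m B
      = (SUP \<delta>\<in>{0<..}. hausdorff_pre m \<delta> A + hausdorff_outer m B)"
    unfolding hausdorff_outer_def[of m A] by (rule ennreal_SUP_add_left[symmetric]) auto
  also have "\<dots> \<le> hausdorff_outer m (A \<union> B)"
  proof (rule SUP_least)
    fix \<delta> :: real assume "\<delta> \<in> {0<..}"
    have "hausdorff_pre m \<delta> A + hausdorff_outer m B
        = (SUP \<delta>'\<in>{0<..}. hausdorff_pre m \<delta> A + hausdorff_pre m \<delta>' B)"
      unfolding hausdorff_outer_def by (rule ennreal_SUP_add_right) auto
    also have "\<dots> \<le> hausdorff_outer m (A \<union> B)"
    proof (rule SUP_least)
      fix \<delta>' :: real assume "\<delta>' \<in> {0<..}"
      define d where "d = min (min \<delta> \<delta>') (r / 2)"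
      have d: "0 < d" "d < r" "d \<le> \<delta>" "d \<le> \<delta>'"
        using \<open>0 < r\<close> \<open>\<delta> \<in> _\<close> \<open>\<delta>' \<in> _\<close> by (auto simp: d_def)
      have "hausdorff_pre m \<delta> A + hausdorff_pre m \<delta>' B \<le> hausdorff_pre m d A + hausdorff_pre m d B"
        by (intro add_mono hausdorff_pre_antimono d)
      also have "\<dots> \<le> hausdorff_outer m (A \<union> B)"
        using pre[OF d(1,2)] hausdorff_pre_le_outer[OF d(1)] order_trans by blast
      finally show "hausdorff_pre m \<delta> A + hausdorff_pre m \<delta>' B \<le> hausdorff_outer m (A \<union> B)" .
    qed
    finally show "hausdorff_pre m \<delta> A + hausdorff_outer m B \<le> hausdorff_outer m (A \<union> B)" .
  qed
  finally show ?thesis .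
qed

lemma hausdorff_outer_disjoint_sum:
  fixes R :: "nat \<Rightarrow> 'a::metric_space set"
  assumes sep: "\<And>i j. i < j \<Longrightarrow> \<exists>r>0. \<forall>x\<in>R i. \<forall>y\<in>R j. r \<le> dist x y"
    and sub: "\<And>i. R i \<subseteq> X"
  shows "(\<Sum>i. hausdorff_outer m (R i)) \<le> hausdorff_outer m X"
proof (rule suminf_le_const[OF summableI])
  fix n
  have "(\<Sum>i<n. hausdorff_outer m (R i)) \<le> hausdorff_outer m (\<Union>i<n. R i)"
  proof (induction n)
    case (Suc n)
    have "\<exists>r>0. \<forall>x\<in>(\<Union>i<k. R i). \<forall>y\<in>R n. r \<le> dist x y" if "k \<le> n" for k
      using that
    proof (induction k)
      case 0
      show ?case by (auto intro: exI[of _ 1])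
    next
      case (Suc k)
      then obtain r s where "r > 0" "\<forall>x\<in>(\<Union>i<k. R i). \<forall>y\<in>R n. r \<le> dist x y"
          "s > 0" "\<forall>x\<in>R k. \<forall>y\<in>R n. s \<le> dist x y"
        using sep[of k n] by auto
      then show ?case
        by (intro exI[of _ "min r s"]) (auto simp: lessThan_Suc intro: min.coboundedI1 min.coboundedI2)
    qed
    then obtain r where r: "r > 0" "\<And>x y. x \<in> (\<Union>i<n. R i) \<Longrightarrow> y \<in> R n \<Longrightarrow> r \<le> dist x y"
      by (metis order_refl)
    have "(\<Sum>i<Suc n. hausdorff_outer m (R i)) \<le> hausdorff_outer m (\<Union>i<n. R i) + hausdorff_outer m (R n)"
      using Suc.IH by (simp add: add_right_mono)
    also have "\<dots> \<le> hausdorff_outer m ((\<Union>i<n. R i) \<union> R n)"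
      using r by (rule hausdorff_outer_metric)
    finally show ?case by (simp add: lessThan_Suc Un_commute)
  qed simp
  also have "\<dots> \<le> hausdorff_outer m X"
    using sub by (intro hausdorff_outer_mono) auto
  finally show "(\<Sum>i<n. hausdorff_outer m (R i)) \<le> hausdorff_outer m X" .
qed

lemma hausdorff_outer_closed:
  assumes "closed C"
  shows "hausdorff_outer m (X \<inter> C) + hausdorff_outer m (X - C) \<le> hausdorff_outer m X"
proof (cases "C = {} \<or> hausdorff_outer m X = top")
  case False
  define d where "d x = setdist {x} C" for x
  define P where "P n = {x \<in> X. 1 / real (Suc n) \<le> d x}" for n
  define R where "R n = {x \<in> X. 1 / real (Suc (Suc n)) \<le> d x \<and> d x < 1 / real (Suc n)}" for n
  have lip: "d x \<le> d y + dist x y" for x y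
    using setdist_Lipschitz[of x C y] by (simp add: d_def)
  have R_sep: "\<exists>r>0. \<forall>x\<in>R i. \<forall>y\<in>R j. r \<le> dist x y" if "Suc i < j" for i j
  proof (intro exI conjI ballI)
    show "0 < 1 / real (Suc (Suc i)) - 1 / real (Suc j)"
      using that divide_strict_left_mono[of "real (Suc (Suc i))" "real (Suc j)" 1]
      by (simp del: of_nat_Suc)
    fix x y assume "x \<in> R i" "y \<in> R j"
    then show "1 / real (Suc (Suc i)) - 1 / real (Suc j) \<le> dist x y"
      using lip[of x y] by (simp add: R_def del: of_nat_Suc)
  qed
  have fin: "(\<Sum>i. hausdorff_outer m (R (2 * i + k))) \<noteq> top" for k
  proof -
    have "(\<Sum>i. hausdorff_outer m (R (2 * i + k))) \<le> hausdorff_outer m X"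
    proof (rule hausdorff_outer_disjoint_sum[of "\<lambda>i. R (2 * i + k)"])
      show "R (2 * i + k) \<subseteq> X" for i by (auto simp: R_def)
      show "\<exists>r>0. \<forall>x\<in>R (2 * i + k). \<forall>y\<in>R (2 * j + k). r \<le> dist x y" if "i < j" for i j
        by (rule R_sep) (use that in linarith)
    qed
    with False show ?thesis by (auto simp: top_unique)
  qed
  have "(\<Sum>i. hausdorff_outer m (R i)) = (\<Sum>i. hausdorff_outer m (R (2 * i)) + hausdorff_outer m (R (2 * i + 1)))"
  proof -
    have "(\<lambda>n. sum (\<lambda>i. hausdorff_outer m (R i)) {n * 2..<n * 2 + 2}) sums (\<Sum>i. hausdorff_outer m (R i))"
      by (rule sums_group[OF summable_sums[OF summableI]]) simp
    moreover have "sum (\<lambda>i. hausdorff_outer m (R i)) {n * 2..<n * 2 + 2}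
        = hausdorff_outer m (R (2 * n)) + hausdorff_outer m (R (2 * n + 1))" for n
    proof -
      have "{n * 2..<n * 2 + 2} = {2 * n, 2 * n + 1}"
        by auto
      then show ?thesis by simp
    qed
    ultimately show ?thesis
      by (simp only: sums_iff)
  qed
  also have "\<dots> = (\<Sum>i. hausdorff_outer m (R (2 * i + 0))) + (\<Sum>i. hausdorff_outer m (R (2 * i + 1)))"
    unfolding add_0_right by (intro suminf_add[symmetric] summableI)
  also have "\<dots> \<noteq> top"
    using fin[of 0] fin[of 1] unfolding ennreal_add_eq_top by blast
  finally have sum_fin: "(\<Sum>i. hausdorff_outer m (R i)) \<noteq> top" .
  have tail: "(\<lambda>n. \<Sum>i. hausdorff_outer m (R (i + n))) \<longlonglongrightarrow> 0"
  proof -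
    define s where "s i = enn2real (hausdorff_outer m (R i))" for i
    have "hausdorff_outer m (R i) \<noteq> top" for i
      using ennreal_suminf_lessD[of "\<lambda>i. hausdorff_outer m (R i)" top i] sum_fin
      by (simp add: top.not_eq_extremum)
    then have s: "hausdorff_outer m (R i) = ennreal (s i)" "0 \<le> s i" for i
      by (auto simp: s_def top.not_eq_extremum)
    have "summable s"
      using sum_fin by (intro summable_suminf_not_top) (auto simp: s)
    moreover have "(\<Sum>i. hausdorff_outer m (R (i + n))) = ennreal (\<Sum>i. s (i + n))" for n
      using s(2) \<open>summable s\<close> by (simp add: s(1) suminf_ennreal2)
    moreover have "(\<lambda>n. \<Sum>i. s (i + n)) \<longlonglongrightarrow> 0"
      using \<open>summable s\<close> by (rule suminf_exist_split2)
    then have "(\<lambda>n. ennreal (\<Sum>i. s (i + n))) \<longlonglongrightarrow> ennreal 0"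
      by (rule tendsto_ennrealI)
    ultimately show ?thesis by simp
  qed
  have le: "hausdorff_outer m (X \<inter> C) + hausdorff_outer m (X - C)
      \<le> hausdorff_outer m X + (\<Sum>i. hausdorff_outer m (R (i + n)))" for n
  proof -
    have "X - C \<subseteq> P n \<union> (\<Union>i. R (i + n))"
    proof (safe, rule ccontr)
      fix x assume x: "x \<in> X" "x \<notin> C" "x \<notin> (\<Union>i. R (i + n))" "x \<notin> P n"
      have "d x < 1 / real (Suc (n + k))" for k
      proof (induction k)
        case 0
        then show ?case using x by (auto simp: P_def)
      next
        case (Suc k)
        have "x \<notin> R (k + n)" using x by blast
        with Suc x(1) show ?case by (auto simp: R_def add_ac)
      qed
      moreover have "0 < d x"
        using \<open>closed C\<close> False x(2) setdist_pos_le[of "{x}" C]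
        by (auto simp: d_def order_less_le setdist_eq_0_sing_1)
      then obtain k where "1 / real (Suc k) < d x"
        using nat_approx_posE by blast
      moreover have "1 / real (Suc (n + k)) \<le> 1 / real (Suc k)"
        by (simp add: field_simps)
      ultimately show False by (meson less_le_trans not_less order_less_asym)
    qed
    then have "hausdorff_outer m (X - C) \<le> hausdorff_outer m (P n \<union> (\<Union>i. R (i + n)))"
      by (rule hausdorff_outer_mono)
    also have "\<dots> \<le> hausdorff_outer m (P n) + hausdorff_outer m (\<Union>i. R (i + n))"
      by (rule hausdorff_outer_Un)
    also have "\<dots> \<le> hausdorff_outer m (P n) + (\<Sum>i. hausdorff_outer m (R (i + n)))"
      by (intro add_left_mono hausdorff_outer_subadditive)
    finally have "hausdorff_outer m (X - C) \<le> hausdorff_outer m (P n) + (\<Sum>i. hausdorff_outer m (R (i + n)))" .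
    then have "hausdorff_outer m (X \<inter> C) + hausdorff_outer m (X - C)
        \<le> (hausdorff_outer m (X \<inter> C) + hausdorff_outer m (P n)) + (\<Sum>i. hausdorff_outer m (R (i + n)))"
      by (simp add: add.assoc add_left_mono)
    also have "hausdorff_outer m (X \<inter> C) + hausdorff_outer m (P n) \<le> hausdorff_outer m ((X \<inter> C) \<union> P n)"
    proof (rule hausdorff_outer_metric[of "1 / real (Suc n)"])
      fix x y assume xy: "x \<in> X \<inter> C" "y \<in> P n"
      then show "1 / real (Suc n) \<le> dist x y"
        using setdist_le_dist[of y "{y}" x C] by (auto simp: P_def d_def dist_commute)
    qed simp
    also have "\<dots> \<le> hausdorff_outer m X"
      by (intro hausdorff_outer_mono) (auto simp: P_def)
    finally show ?thesis by (simp add: add_right_mono)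
  qed
  have "(\<lambda>n. hausdorff_outer m X + (\<Sum>i. hausdorff_outer m (R (i + n)))) \<longlonglongrightarrow> hausdorff_outer m X + 0"
    by (intro tendsto_add tendsto_const tail)
  then show ?thesis
    using le by (intro LIMSEQ_le_const[of _ "hausdorff_outer m X"]) auto
qed auto

lemma sets_hausdorff_measure [simp, measurable_cong]: "sets (hausdorff_measure m) = sets borel"
  by (simp add: hausdorff_measure_def sets_measure_of sets.sigma_sets_eq[of borel, simplified])

lemma emeasure_hausdorff_measure:
  fixes A :: "'a::metric_space set"
  assumes "A \<in> sets borel"
  shows "emeasure (hausdorff_measure m) A = hausdorff_outer m A"
proof -
  interpret Pow: sigma_algebra UNIV "UNIV :: 'a set set"
    using sigma_algebra_Pow[of UNIV] by simp
  let ?L = "lambda_system UNIV UNIV (hausdorff_outer m :: 'a set \<Rightarrow> ennreal)"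
  have L: "measure_space UNIV ?L (hausdorff_outer m)"
    by (intro Pow.caratheodory_lemma outer_measure_space_hausdorff)
  then interpret L: sigma_algebra UNIV ?L
    by (simp add: measure_space_def)
  have "C \<in> ?L" if "closed C" for C
  proof -
    have "hausdorff_outer m X \<le> hausdorff_outer m (X \<inter> C) + hausdorff_outer m (X - C)" for X
      using hausdorff_outer_Un[of m "X \<inter> C" "X - C"] by (simp add: Int_Diff_Un)
    with hausdorff_outer_closed[OF that] show ?thesis
      by (auto simp: Pow.lambda_system_eq intro: antisym)
  qed
  then have "sigma_sets UNIV (Collect closed) \<subseteq> ?L"
    by (intro L.sigma_sets_subset) auto
  then have sub: "sets borel \<subseteq> ?L"
    unfolding borel_eq_closed by simp
  have "countably_additive (sets borel) (hausdorff_outer m :: 'a set \<Rightarrow> ennreal)"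
    using L sub by (auto simp: measure_space_def countably_additive_def)
  moreover have "positive (sets borel) (hausdorff_outer m :: 'a set \<Rightarrow> ennreal)"
    by (simp add: positive_def)
  moreover have "sigma_algebra UNIV (sets (borel :: 'a measure))"
    using sets.sigma_algebra_axioms[of "borel :: 'a measure"] by simp
  ultimately show ?thesis
    unfolding hausdorff_measure_def using assms by (intro emeasure_measure_of_sigma)
qed


text \<open>In what follows a domain lives in \<open>real^'d\<close>, and its surface measure is \<open>surface_measure\<close>.\<close>

definition surface_measure :: "(real^'d) measure" where
  "surface_measure = hausdorff_measure (CARD('d) - 1)"


section \<open>Domains with piecewise smooth boundary\<close>

definition smooth_boundary_point :: "(real^'d) set \<Rightarrow> real^'d \<Rightarrow> bool" where
  "smooth_boundary_point \<Omega> z \<longleftrightarrow>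
     z \<in> frontier \<Omega> \<and>
     (\<exists>U (\<rho> :: real^'d \<Rightarrow> real). open U \<and> z \<in> U \<and> smooth_on U \<rho> \<and>
        (\<forall>x\<in>U. frechet_derivative \<rho> (at x) \<noteq> (\<lambda>_. 0)) \<and> \<Omega> \<inter> U = {x\<in>U. \<rho> x < 0})"

text \<open>Finitely many smooth faces, which make up the boundary up to a set (edges, corners, conical points)
  of surface measure zero. No Lipschitz condition is imposed.\<close>

definition piecewise_smooth_boundary :: "(real^'d) set \<Rightarrow> bool" where
  "piecewise_smooth_boundary \<Omega> \<longleftrightarrow>
     emeasure surface_measure (frontier \<Omega>) < \<infinity> \<and>
     finite (components {z. smooth_boundary_point \<Omega> z}) \<and>
     frontier \<Omega> \<subseteq> closure {z. smooth_boundary_point \<Omega> z} \<and>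
     emeasure surface_measure {z \<in> frontier \<Omega>. \<not> smooth_boundary_point \<Omega> z} = 0"

definition bounded_pws_domain :: "(real^'d) set \<Rightarrow> bool" where
  "bounded_pws_domain \<Omega> \<longleftrightarrow>
     open \<Omega> \<and> connected \<Omega> \<and> \<Omega> \<noteq> {} \<and> bounded \<Omega> \<and> piecewise_smooth_boundary \<Omega>"


section \<open>The spaces \<open>L\<^sup>2\<close> and \<open>H\<^sup>1\<close>\<close>

text \<open>Elements of these spaces are represented by functions, and two functions represent the same element
  if they agree almost everywhere in \<open>\<Omega>\<close>.\<close>

definition L2 :: "(real^'d) set \<Rightarrow> (real^'d \<Rightarrow> complex) set" where
  "L2 \<Omega> = {g \<in> borel_measurable (lebesgue_on \<Omega>). integrable (lebesgue_on \<Omega>) (\<lambda>x. (cmod (g x))\<^sup>2)}"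

definition winner ::
    "(real^'d) set \<Rightarrow> (real^'d \<Rightarrow> real) \<Rightarrow> (real^'d \<Rightarrow> complex) \<Rightarrow> (real^'d \<Rightarrow> complex) \<Rightarrow> complex" where
  "winner \<Omega> c g h = (LINT x|lebesgue_on \<Omega>. complex_of_real (1 / (c x)\<^sup>2) * g x * cnj (h x))"

definition wnorm :: "(real^'d) set \<Rightarrow> (real^'d \<Rightarrow> real) \<Rightarrow> (real^'d \<Rightarrow> complex) \<Rightarrow> real" where
  "wnorm \<Omega> c g = sqrt (Re (winner \<Omega> c g g))"

definition test_function :: "(real^'d) set \<Rightarrow> (real^'d \<Rightarrow> real) \<Rightarrow> bool" where
  "test_function \<Omega> \<eta> \<longleftrightarrow>
     smooth_on UNIV \<eta> \<and> (\<exists>K. compact K \<and> K \<subseteq> \<Omega> \<and> (\<forall>x. x \<notin> K \<longrightarrow> \<eta> x = 0))"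

definition L2_weak_gradient ::
    "(real^'d) set \<Rightarrow> (real^'d \<Rightarrow> complex) \<Rightarrow> (real^'d \<Rightarrow> complex^'d) \<Rightarrow> bool" where
  "L2_weak_gradient \<Omega> g G \<longleftrightarrow>
     (\<forall>i. (\<lambda>x. G x $ i) \<in> L2 \<Omega>) \<and>
     (\<forall>\<eta> i. test_function \<Omega> \<eta> \<longrightarrow>
        (LINT x|lebesgue_on \<Omega>. g x * complex_of_real (frechet_derivative \<eta> (at x) (axis i 1))) =
        - (LINT x|lebesgue_on \<Omega>. G x $ i * complex_of_real (\<eta> x)))"

definition H1 :: "(real^'d) set \<Rightarrow> (real^'d \<Rightarrow> complex) set" where
  "H1 \<Omega> = {g \<in> L2 \<Omega>. \<exists>G. L2_weak_gradient \<Omega> g G}"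

definition grad :: "(real^'d) set \<Rightarrow> (real^'d \<Rightarrow> complex) \<Rightarrow> real^'d \<Rightarrow> complex^'d" where
  "grad \<Omega> g = (SOME G. L2_weak_gradient \<Omega> g G)"

definition grad_inner ::
    "(real^'d) set \<Rightarrow> (real^'d \<Rightarrow> complex) \<Rightarrow> (real^'d \<Rightarrow> complex) \<Rightarrow> complex" where
  "grad_inner \<Omega> g h = (LINT x|lebesgue_on \<Omega>. (\<Sum>i\<in>UNIV. grad \<Omega> g x $ i * cnj (grad \<Omega> h x $ i)))"

definition H1_inner ::
    "(real^'d) set \<Rightarrow> (real^'d \<Rightarrow> real) \<Rightarrow> (real^'d \<Rightarrow> complex) \<Rightarrow> (real^'d \<Rightarrow> complex) \<Rightarrow> complex" where
  "H1_inner \<Omega> c g h = winner \<Omega> c g h + grad_inner \<Omega> g h"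

definition H1_norm :: "(real^'d) set \<Rightarrow> (real^'d \<Rightarrow> real) \<Rightarrow> (real^'d \<Rightarrow> complex) \<Rightarrow> real" where
  "H1_norm \<Omega> c g = sqrt (Re (H1_inner \<Omega> c g g))"

text \<open>The bounded linear functionals on the Hilbert space \<open>H\<^sup>1\<close> are the maps \<open>\<lambda>g. H1_inner \<Omega> c g h\<close>.\<close>

definition weakly_converges_H1 ::
    "(real^'d) set \<Rightarrow> (real^'d \<Rightarrow> real) \<Rightarrow> ('i \<Rightarrow> real^'d \<Rightarrow> complex) \<Rightarrow> (real^'d \<Rightarrow> complex) \<Rightarrow> 'i filter \<Rightarrow> bool"
  where
  "weakly_converges_H1 \<Omega> c g h F \<longleftrightarrow>
     (\<forall>\<^sub>F i in F. g i \<in> H1 \<Omega>) \<and> h \<in> H1 \<Omega> \<and>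
     (\<forall>\<zeta>\<in>H1 \<Omega>. ((\<lambda>i. H1_inner \<Omega> c (g i) \<zeta>) \<longlongrightarrow> H1_inner \<Omega> c h \<zeta>) F)"

definition compactly_supported_in :: "(real^'d) set \<Rightarrow> (real^'d \<Rightarrow> complex) \<Rightarrow> bool" where
  "compactly_supported_in \<Omega> g \<longleftrightarrow>
     (\<exists>K. compact K \<and> K \<subseteq> \<Omega> \<and> (AE x in lebesgue_on \<Omega>. x \<notin> K \<longrightarrow> g x = 0))"

text \<open>The trace on the boundary extends the restriction of smooth functions by continuity from
  \<open>H\<^sup>1(\<Omega>)\<close> to \<open>L\<^sup>2(\<partial>\<Omega>)\<close>.\<close>

definition has_trace :: "(real^'d) set \<Rightarrow> (real^'d \<Rightarrow> complex) \<Rightarrow> (real^'d \<Rightarrow> complex) \<Rightarrow> bool" where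
  "has_trace \<Omega> g \<gamma> \<longleftrightarrow>
     \<gamma> \<in> borel_measurable borel \<and>
     (\<exists>p :: nat \<Rightarrow> real^'d \<Rightarrow> complex.
        (\<forall>n. smooth_on UNIV (p n)) \<and>
        (\<lambda>n. H1_norm \<Omega> (\<lambda>_. 1) (\<lambda>x. p n x - g x)) \<longlonglongrightarrow> 0 \<and>
        (\<lambda>n. \<integral>\<^sup>+z\<in>frontier \<Omega>. ennreal ((cmod (p n z - \<gamma> z))\<^sup>2) \<partial>surface_measure) \<longlonglongrightarrow> 0)"

definition H1_vanishing_on :: "(real^'d) set \<Rightarrow> (real^'d) set \<Rightarrow> (real^'d \<Rightarrow> complex) set" where
  "H1_vanishing_on \<Omega> S =
     {g \<in> H1 \<Omega>. \<exists>\<gamma>. has_trace \<Omega> g \<gamma> \<and> (AE z in surface_measure. z \<in> S \<longrightarrow> \<gamma> z = 0)}"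


section \<open>Eigenfunctions\<close>

text \<open>Below, \<open>V\<close> is the form domain: \<open>V = H1 \<Omega>\<close> gives the Neumann condition on the whole boundary, and
  \<open>V = H1_vanishing_on \<Omega> \<Sigma>\<^sub>1\<close> the Dirichlet condition on \<open>\<Sigma>\<^sub>1\<close> with the (natural) Neumann condition on the rest.
  Sequences start at index \<open>0\<close>. The eigenvalues are the \<open>(\<mu> n)\<^sup>2\<close>, counted with multiplicity.\<close>

definition weak_eigenfunction ::
    "(real^'d) set \<Rightarrow> (real^'d \<Rightarrow> real) \<Rightarrow> (real^'d \<Rightarrow> complex) set \<Rightarrow> real \<Rightarrow> (real^'d \<Rightarrow> complex) \<Rightarrow> bool" where
  "weak_eigenfunction \<Omega> c V \<mu> e \<longleftrightarrow>
     e \<in> V \<and> (\<forall>\<zeta>\<in>V. grad_inner \<Omega> e \<zeta> = complex_of_real (\<mu>\<^sup>2) * winner \<Omega> c e \<zeta>)"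

definition orthonormal_basis_L2 ::
    "(real^'d) set \<Rightarrow> (real^'d \<Rightarrow> real) \<Rightarrow> (nat \<Rightarrow> real^'d \<Rightarrow> complex) \<Rightarrow> bool" where
  "orthonormal_basis_L2 \<Omega> c e \<longleftrightarrow>
     (\<forall>n. e n \<in> L2 \<Omega>) \<and>
     (\<forall>m n. winner \<Omega> c (e m) (e n) = (if m = n then 1 else 0)) \<and>
     (\<forall>g\<in>L2 \<Omega>. (\<lambda>N. wnorm \<Omega> c (\<lambda>x. g x - (\<Sum>n<N. winner \<Omega> c g (e n) * e n x))) \<longlonglongrightarrow> 0)"

definition eigenbasis ::
    "(real^'d) set \<Rightarrow> (real^'d \<Rightarrow> real) \<Rightarrow> (real^'d \<Rightarrow> complex) set \<Rightarrow>
     (nat \<Rightarrow> real) \<Rightarrow> (nat \<Rightarrow> real^'d \<Rightarrow> complex) \<Rightarrow> bool" where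
  "eigenbasis \<Omega> c V \<mu> e \<longleftrightarrow>
     mono \<mu> \<and> (\<forall>n. weak_eigenfunction \<Omega> c V (\<mu> n) (e n)) \<and> orthonormal_basis_L2 \<Omega> c e"

definition neumann_eigenbasis where
  "neumann_eigenbasis \<Omega> c lam \<phi> \<longleftrightarrow> (\<forall>n. 0 \<le> lam n) \<and> eigenbasis \<Omega> c (H1 \<Omega>) lam \<phi>"

definition mixed_eigenbasis where
  "mixed_eigenbasis \<Omega> \<Sigma>\<^sub>1 c \<nu> \<psi> \<longleftrightarrow> (\<forall>k. 0 < \<nu> k) \<and> eigenbasis \<Omega> c (H1_vanishing_on \<Omega> \<Sigma>\<^sub>1) \<nu> \<psi>"


section \<open>Wave equations\<close>

text \<open>Weak (finite energy) solutions of \<open>c\<^sup>-\<^sup>2 w\<^sub>t\<^sub>t - \<Delta>w = c\<^sup>-\<^sup>2 F\<close> on the time interval \<open>I\<close>: \<open>w\<close> is continuous into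
  \<open>H\<^sup>1\<close>, continuously differentiable into \<open>L\<^sup>2\<close> with time derivative \<open>wt\<close>, takes values in the form domain \<open>V\<close>,
  and satisfies the equation tested against all of \<open>V\<close>. Taking \<open>\<zeta>\<close> to be an eigenfunction \<open>\<psi>\<^sub>k\<close> gives
  \<open>w\<^sub>k'' + \<nu>\<^sub>k\<^sup>2 w\<^sub>k = \<langle>F, \<psi>\<^sub>k\<rangle>\<close> for the coefficient \<open>w\<^sub>k = \<langle>w, \<psi>\<^sub>k\<rangle>\<close>.\<close>

definition weak_wave_solution ::
    "(real^'d) set \<Rightarrow> (real^'d \<Rightarrow> real) \<Rightarrow> (real^'d \<Rightarrow> complex) set \<Rightarrow> real set \<Rightarrow>
     (real \<Rightarrow> real^'d \<Rightarrow> complex) \<Rightarrow> (real \<Rightarrow> real^'d \<Rightarrow> complex) \<Rightarrow> (real \<Rightarrow> real^'d \<Rightarrow> complex) \<Rightarrow> bool" where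
  "weak_wave_solution \<Omega> c V I F w wt \<longleftrightarrow>
     (\<forall>t\<in>I. w t \<in> V \<and> wt t \<in> L2 \<Omega> \<and>
        ((\<lambda>s. H1_norm \<Omega> c (\<lambda>x. w s x - w t x)) \<longlongrightarrow> 0) (at t within I) \<and>
        ((\<lambda>s. wnorm \<Omega> c (\<lambda>x. wt s x - wt t x)) \<longlongrightarrow> 0) (at t within I) \<and>
        ((\<lambda>s. wnorm \<Omega> c (\<lambda>x. (w s x - w t x) / complex_of_real (s - t) - wt t x)) \<longlongrightarrow> 0) (at t within I) \<and>
        (\<forall>\<zeta>\<in>V. ((\<lambda>s. winner \<Omega> c (wt s) \<zeta>) has_vector_derivative
                   winner \<Omega> c (F t) \<zeta> - grad_inner \<Omega> (w t) \<zeta>) (at t within I)))"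

definition forward_solution ::
    "(real^'d) set \<Rightarrow> (real^'d \<Rightarrow> real) \<Rightarrow> (real^'d \<Rightarrow> complex) \<Rightarrow>
     (real \<Rightarrow> real^'d \<Rightarrow> complex) \<Rightarrow> (real \<Rightarrow> real^'d \<Rightarrow> complex) \<Rightarrow> bool" where
  "forward_solution \<Omega> c f u ut \<longleftrightarrow>
     weak_wave_solution \<Omega> c (H1 \<Omega>) {0..} (\<lambda>_ _. 0) u ut \<and>
     (AE x in lebesgue_on \<Omega>. u 0 x = f x) \<and> (AE x in lebesgue_on \<Omega>. ut 0 x = 0)"

definition reversal_source ::
    "(real \<Rightarrow> real) \<Rightarrow> (real \<Rightarrow> real^'d \<Rightarrow> complex) \<Rightarrow> (real \<Rightarrow> real^'d \<Rightarrow> complex) \<Rightarrow>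
     real \<Rightarrow> real \<Rightarrow> real^'d \<Rightarrow> complex" where
  "reversal_source \<alpha> u ut \<epsilon> t x =
     - complex_of_real \<epsilon> * (2 * complex_of_real (unit_deriv 1 \<alpha> (\<epsilon> * t)) * ut t x
         + complex_of_real \<epsilon> * complex_of_real (unit_deriv 2 \<alpha> (\<epsilon> * t)) * u t x)"

text \<open>The boundary data \<open>v = U \<alpha>(\<epsilon>t)\<close> on \<open>\<Sigma>\<^sub>1\<close>, where \<open>U\<close> is the trace of \<open>u\<close>, are imposed by requiring
  \<open>w = v - u \<alpha>(\<epsilon>t)\<close> to vanish on \<open>\<Sigma>\<^sub>1\<close>. The terminal conditions for \<open>v\<close> and \<open>w\<close> at \<open>t = 1/\<epsilon>\<close> agree since \<open>\<alpha>\<close> and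
  \<open>\<alpha>'\<close> vanish at \<open>1\<close>.\<close>

definition gradual_time_reversal ::
    "(real^'d) set \<Rightarrow> (real^'d) set \<Rightarrow> (real^'d \<Rightarrow> real) \<Rightarrow> (real \<Rightarrow> real) \<Rightarrow>
     (real \<Rightarrow> real^'d \<Rightarrow> complex) \<Rightarrow> (real \<Rightarrow> real^'d \<Rightarrow> complex) \<Rightarrow> real \<Rightarrow> (real \<Rightarrow> real^'d \<Rightarrow> complex) \<Rightarrow> bool"
  where
  "gradual_time_reversal \<Omega> \<Sigma>\<^sub>1 c \<alpha> u ut \<epsilon> v \<longleftrightarrow>
     (\<exists>w wt.
        weak_wave_solution \<Omega> c (H1_vanishing_on \<Omega> \<Sigma>\<^sub>1) {0..1/\<epsilon>} (reversal_source \<alpha> u ut \<epsilon>) w wt \<and>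
        (AE x in lebesgue_on \<Omega>. w (1/\<epsilon>) x = 0) \<and> (AE x in lebesgue_on \<Omega>. wt (1/\<epsilon>) x = 0) \<and>
        (\<forall>t\<in>{0..1/\<epsilon>}. AE x in lebesgue_on \<Omega>. v t x = u t x * complex_of_real (\<alpha> (\<epsilon> * t)) + w t x))"

end

theory Submission
  imports Defs
begin

text \<open>
  Since \<open>\<alpha> 0 = 1\<close>, the reconstruction differs from \<open>f\<close> by the initial value of the correction \<open>w\<^sub>\<epsilon>\<close>, and one has to show that
  \<open>w\<^sub>\<epsilon>(0)\<close> converges weakly to \<open>0\<close> in \<open>H\<^sup>1\<close>. The correction vanishes at time \<open>1/\<epsilon>\<close> together with its velocity, and it is driven by
  the source \<open>F\<^sub>\<epsilon> = -2\<epsilon> \<alpha>'(\<epsilon>t) u\<^sub>t - \<epsilon>\<^sup>2 \<alpha>''(\<epsilon>t) u\<close>. In the mixed eigenbasis its coefficients satisfy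
  \<open>w\<^sub>k'' + \<nu>\<^sub>k\<^sup>2 w\<^sub>k = \<langle>F\<^sub>\<epsilon>, \<psi>\<^sub>k\<rangle>\<close>, so that \<open>\<nu>\<^sub>k w\<^sub>k(0)\<close> is the integral of \<open>\<langle>F\<^sub>\<epsilon>(t), \<psi>\<^sub>k\<rangle> sin(\<nu>\<^sub>kt)\<close> over \<open>[0, 1/\<epsilon>]\<close>. Two facts about this
  integral are used.

  Boundedness: the norms of \<open>u\<close> and \<open>u\<^sub>t\<close> are bounded uniformly in time (\<open>forward_energy\<close>), so the source is of order \<open>\<epsilon>\<close>
  while it acts for a time \<open>1/\<epsilon>\<close>. The energy estimate \<open>initial_energy_le\<close> therefore bounds \<open>\<Sum>\<^sub>k \<nu>\<^sub>k\<^sup>2 \<bar>w\<^sub>k(0)\<bar>\<^sup>2\<close>, and with it the norm of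
  the gradient of \<open>w\<^sub>\<epsilon>(0)\<close>, uniformly in \<open>\<epsilon>\<close>.

  Oscillation: for fixed \<open>k\<close>, the coefficient \<open>w\<^sub>k(0)\<close> tends to \<open>0\<close>. Up to a small error \<open>\<langle>u\<^sub>t, \<psi>\<^sub>k\<rangle>\<close> is a finite sum of multiples of
  \<open>sin(\<lambda>\<^sub>nt)\<close>, and as \<open>\<lambda>\<^sub>n \<noteq> \<nu>\<^sub>k\<close> the products \<open>sin(\<lambda>\<^sub>nt) sin(\<nu>\<^sub>kt)\<close> have bounded primitives (\<open>nonresonant_primitive\<close>). Integration by parts
  against the slow factor \<open>\<alpha>'(\<epsilon>t)\<close> then gains a power of \<open>\<epsilon>\<close> (\<open>adiabatic_bound\<close>).

  Boundedness and convergence of the coefficients give weak convergence in \<open>L\<^sup>2\<close>, and \<open>grad_weak_null\<close> passes from there to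
  the gradients. The latter step rests on the density of the test functions in \<open>L\<^sup>2\<close> (\<open>L2_test_induct\<close>). It replaces
  completeness of \<open>H\<^sup>1\<close> and expansions of arbitrary elements of \<open>H\<^sup>1\<close>, and it also shows that the gradient of an element of the
  form domain is controlled by its coefficients (\<open>eigenbasis_grad_le_of_coefficients\<close>).
\<close>

section \<open>Positive semidefinite Hermitian forms\<close>

text \<open>Two forms are treated alike: the weighted product on \<open>L\<^sup>2\<close>, and the Dirichlet form on \<open>H\<^sup>1\<close>, which
  vanishes on constants. Elements are functions rather than classes modulo null sets, so neither form is definite.\<close>

locale hermitian_form =
  fixes V :: "('x \<Rightarrow> complex) set" and B :: "('x \<Rightarrow> complex) \<Rightarrow> ('x \<Rightarrow> complex) \<Rightarrow> complex"
  assumes zero_mem: "(\<lambda>_. 0) \<in> V"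
    and lin_mem: "\<And>g h a. g \<in> V \<Longrightarrow> h \<in> V \<Longrightarrow> (\<lambda>x. g x + a * h x) \<in> V"
    and lin: "\<And>g h k a. g \<in> V \<Longrightarrow> h \<in> V \<Longrightarrow> k \<in> V \<Longrightarrow> B (\<lambda>x. g x + a * h x) k = B g k + a * B h k"
    and herm: "\<And>g h. g \<in> V \<Longrightarrow> h \<in> V \<Longrightarrow> B h g = cnj (B g h)"
    and nonneg: "\<And>g. g \<in> V \<Longrightarrow> 0 \<le> Re (B g g)"
begin

definition nrm :: "('x \<Rightarrow> complex) \<Rightarrow> real" where
  "nrm g = sqrt (Re (B g g))"

lemma nrm_nonneg: "g \<in> V \<Longrightarrow> 0 \<le> nrm g"
  by (simp add: nrm_def nonneg)

lemma form_self: "g \<in> V \<Longrightarrow> B g g = complex_of_real ((nrm g)\<^sup>2)"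
  using herm[of g g] nonneg[of g] by (simp add: nrm_def complex_eq_iff)

lemma zero_left: "k \<in> V \<Longrightarrow> B (\<lambda>_. 0) k = 0"
  using lin[OF zero_mem zero_mem, of k "-1"] by simp

lemma add_mem: "g \<in> V \<Longrightarrow> h \<in> V \<Longrightarrow> (\<lambda>x. g x + h x) \<in> V"
  using lin_mem[of g h 1] by simp

lemma diff_mem: "g \<in> V \<Longrightarrow> h \<in> V \<Longrightarrow> (\<lambda>x. g x - h x) \<in> V"
  using lin_mem[of g h "-1"] by simp

lemma scale_mem: "h \<in> V \<Longrightarrow> (\<lambda>x. a * h x) \<in> V"
  using lin_mem[OF zero_mem, of h a] by simp

lemma scale_left: "h \<in> V \<Longrightarrow> k \<in> V \<Longrightarrow> B (\<lambda>x. a * h x) k = a * B h k"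
  using lin[OF zero_mem, of h k a] by (simp add: zero_left)

lemma add_left: "g \<in> V \<Longrightarrow> h \<in> V \<Longrightarrow> k \<in> V \<Longrightarrow> B (\<lambda>x. g x + h x) k = B g k + B h k"
  using lin[of g h k 1] by simp

lemma diff_left: "g \<in> V \<Longrightarrow> h \<in> V \<Longrightarrow> k \<in> V \<Longrightarrow> B (\<lambda>x. g x - h x) k = B g k - B h k"
  using lin[of g h k "-1"] by simp

lemma lin_right:
  "g \<in> V \<Longrightarrow> h \<in> V \<Longrightarrow> k \<in> V \<Longrightarrow> B k (\<lambda>x. g x + a * h x) = B k g + cnj a * B k h"
  using lin[of g h k a] by (simp add: herm[of _ k] lin_mem)

lemma diff_right: "g \<in> V \<Longrightarrow> h \<in> V \<Longrightarrow> k \<in> V \<Longrightarrow> B k (\<lambda>x. g x - h x) = B k g - B k h"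
  using lin_right[of g h k "-1"] by simp

lemma sum_mem: "(\<And>n. e n \<in> V) \<Longrightarrow> (\<lambda>x. \<Sum>n<(N::nat). a n * e n x) \<in> V"
  by (induction N) (auto simp: zero_mem intro: lin_mem)

lemma sum_left:
  assumes "\<And>n. e n \<in> V" "k \<in> V"
  shows "B (\<lambda>x. \<Sum>n<(N::nat). a n * e n x) k = (\<Sum>n<N. a n * B (e n) k)"
  by (induction N) (use assms in \<open>simp_all add: zero_left lin sum_mem\<close>)

lemma sum_right:
  assumes "\<And>n. e n \<in> V" "k \<in> V"
  shows "B k (\<lambda>x. \<Sum>n<(N::nat). a n * e n x) = (\<Sum>n<N. cnj (a n) * B k (e n))"
  using sum_left[OF assms, where a = a and N = N] assms by (simp add: herm[of _ k] sum_mem)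

lemma nrm_lin:
  assumes "g \<in> V" "h \<in> V"
  shows "(nrm (\<lambda>x. g x + a * h x))\<^sup>2 = (nrm g)\<^sup>2 + 2 * Re (cnj a * B g h) + (cmod a)\<^sup>2 * (nrm h)\<^sup>2"
proof -
  have "complex_of_real ((nrm (\<lambda>x. g x + a * h x))\<^sup>2)
      = B g g + (cnj a * B g h + cnj (cnj a * B g h)) + (a * cnj a) * B h h"
    unfolding form_self[OF lin_mem[OF assms], symmetric]
    using assms by (simp add: lin_mem lin lin_right herm[of g h] algebra_simps)
  also have "\<dots> = complex_of_real ((nrm g)\<^sup>2 + 2 * Re (cnj a * B g h) + (cmod a)\<^sup>2 * (nrm h)\<^sup>2)"
    using assms by (simp only: complex_add_cnj form_self complex_norm_square[symmetric] of_real_add of_real_mult)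
  finally show ?thesis
    using of_real_eq_iff by blast
qed

lemma cauchy_schwarz:
  assumes "g \<in> V" "h \<in> V"
  shows "cmod (B g h) \<le> nrm g * nrm h"
proof -
  let ?b = "cmod (B g h)"
  \<comment> \<open>The squared norm of \<open>g - s \<langle>g, h\<rangle> h\<close>, a polynomial in the real number \<open>s\<close>.\<close>
  have quad: "0 \<le> (nrm g)\<^sup>2 - 2 * s * ?b\<^sup>2 + s\<^sup>2 * ?b\<^sup>2 * (nrm h)\<^sup>2" for s :: real
  proof -
    have "Re (cnj (complex_of_real (- s) * B g h) * B g h) = - s * ?b\<^sup>2"
      by (simp add: cmod_power2) (simp add: power2_eq_square algebra_simps)
    then show ?thesis
      using nrm_lin[OF assms, of "complex_of_real (- s) * B g h"]
        zero_le_power2[of "nrm (\<lambda>x. g x + complex_of_real (- s) * B g h * h x)"]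
      by (simp add: norm_mult power_mult_distrib)
  qed
  have "?b\<^sup>2 \<le> (nrm g)\<^sup>2 * (nrm h)\<^sup>2"
  proof (cases "nrm h = 0")
    case True
    have "?b = 0"
    proof (rule ccontr)
      assume "?b \<noteq> 0"
      then show False
        using quad[of "((nrm g)\<^sup>2 + 1) / ?b\<^sup>2"] True zero_le_power2[of "nrm g"]
        by (simp del: zero_le_power2)
    qed
    then show ?thesis by simp
  next
    case False
    then have h: "0 < (nrm h)\<^sup>2" by simp
    have "(1 / (nrm h)\<^sup>2)\<^sup>2 * ?b\<^sup>2 * (nrm h)\<^sup>2 = ?b\<^sup>2 / (nrm h)\<^sup>2"
      using False by (simp add: power2_eq_square)
    then have "?b\<^sup>2 / (nrm h)\<^sup>2 \<le> (nrm g)\<^sup>2"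
      using quad[of "1 / (nrm h)\<^sup>2"] by simp
    then show ?thesis using h by (simp only: pos_divide_le_eq)
  qed
  then have "?b\<^sup>2 \<le> (nrm g * nrm h)\<^sup>2"
    by (simp add: power_mult_distrib)
  then show ?thesis
    by (rule power2_le_imp_le) (simp add: assms nrm_nonneg)
qed

lemma nrm_scale: "h \<in> V \<Longrightarrow> nrm (\<lambda>x. a * h x) = cmod a * nrm h"
  using nrm_lin[OF zero_mem, of h a] nrm_nonneg[of h] nrm_nonneg[OF scale_mem[of h a]]
  by (simp add: zero_left nrm_def[of "\<lambda>_. 0"] zero_mem power_mult_distrib[symmetric])

lemma nrm_triangle_scaled:
  assumes "g \<in> V" "h \<in> V"
  shows "nrm (\<lambda>x. g x + a * h x) \<le> nrm g + cmod a * nrm h"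
proof (rule power2_le_imp_le)
  have "Re (cnj a * B g h) \<le> cmod (cnj a * B g h)"
    by (rule complex_Re_le_cmod)
  also have "\<dots> \<le> cmod a * (nrm g * nrm h)"
    by (simp add: norm_mult mult_left_mono cauchy_schwarz assms)
  finally show "(nrm (\<lambda>x. g x + a * h x))\<^sup>2 \<le> (nrm g + cmod a * nrm h)\<^sup>2"
    using nrm_lin[OF assms, of a] by (simp add: power2_sum power_mult_distrib algebra_simps)
qed (simp add: assms nrm_nonneg)

text \<open>The squared norms \<open>d n\<close> of the orthogonal system may vanish, and the numbers \<open>a n\<close> are only required to satisfy
  \<open>\<langle>g, e n\<rangle> = d n * a n\<close>. This fits the Dirichlet form and eigenfunctions that are orthonormal in \<open>L\<^sup>2\<close>: there \<open>d n\<close> is the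
  eigenvalue, which is \<open>0\<close> for the constant Neumann eigenfunction, and \<open>a n\<close> is the \<open>L\<^sup>2\<close> coefficient. The first
  formula for the remainder, \<open>\<langle>R, R\<rangle> = \<langle>R, g\<rangle>\<close>, allows one to find its norm by testing it against the fixed vector \<open>g\<close>.\<close>

lemma remainder:
  fixes d :: "nat \<Rightarrow> real" and N :: nat
  assumes e: "\<And>n. e n \<in> V" and orth: "\<And>m n. B (e m) (e n) = (if m = n then complex_of_real (d n) else 0)"
    and g: "g \<in> V" and coeff: "\<And>n. B g (e n) = complex_of_real (d n) * a n"
  defines "R \<equiv> (\<lambda>x. g x - (\<Sum>n<N. a n * e n x))"
  shows "R \<in> V"
    and "B R g = complex_of_real ((nrm g)\<^sup>2 - (\<Sum>n<N. d n * (cmod (a n))\<^sup>2))"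
    and "(nrm R)\<^sup>2 = (nrm g)\<^sup>2 - (\<Sum>n<N. d n * (cmod (a n))\<^sup>2)"
proof -
  let ?S = "\<lambda>x. \<Sum>n<N. a n * e n x"
  have S: "?S \<in> V" by (intro sum_mem e)
  then show R: "R \<in> V" unfolding R_def by (intro diff_mem g)
  have "B R (e k) = 0" if "k < N" for k
  proof -
    have "B R (e k) = complex_of_real (d k) * a k - (\<Sum>n<N. if n = k then a n * complex_of_real (d k) else 0)"
      using e g S by (simp add: R_def diff_left coeff sum_left orth if_distrib cong: if_cong)
    then show ?thesis using that by (simp add: sum.delta)
  qed
  then have RS: "B R ?S = 0" using e R by (simp add: sum_right)
  have "B R g = B g g - (\<Sum>n<N. a n * cnj (B g (e n)))"
    using e g S herm[OF g e] by (simp add: R_def diff_left sum_left)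
  also have "(\<Sum>n<N. a n * cnj (B g (e n))) = complex_of_real (\<Sum>n<N. d n * (cmod (a n))\<^sup>2)"
    unfolding of_real_sum
  proof (intro sum.cong refl)
    fix n
    have "a n * cnj (B g (e n)) = complex_of_real (d n) * (a n * cnj (a n))"
      by (simp add: coeff)
    then show "a n * cnj (B g (e n)) = complex_of_real (d n * (cmod (a n))\<^sup>2)"
      by (simp only: complex_norm_square[symmetric] of_real_mult)
  qed
  finally show Rg: "B R g = complex_of_real ((nrm g)\<^sup>2 - (\<Sum>n<N. d n * (cmod (a n))\<^sup>2))"
    by (simp add: form_self g)
  have "complex_of_real ((nrm R)\<^sup>2) = B R g - B R ?S"
    unfolding form_self[OF R, symmetric] using diff_right[OF g S R] by (simp add: R_def)
  then show "(nrm R)\<^sup>2 = (nrm g)\<^sup>2 - (\<Sum>n<N. d n * (cmod (a n))\<^sup>2)"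
    unfolding RS Rg diff_zero of_real_eq_iff .
qed

lemma nrm_orthonormal_sum:
  assumes e: "\<And>n. e n \<in> V" "\<And>m n. B (e m) (e n) = (if m = n then 1 else 0)"
  shows "(nrm (\<lambda>x. \<Sum>n<(N::nat). a n * e n x))\<^sup>2 = (\<Sum>n<N. (cmod (a n))\<^sup>2)"
proof -
  let ?S = "\<lambda>x. \<Sum>n<N. a n * e n x"
  have S: "?S \<in> V" by (intro sum_mem e)
  have "B ?S (e n) = a n" if "n < N" for n
    using that e(1) by (simp add: sum_left e(2) if_distrib cong: if_cong)
  then have "B ?S ?S = (\<Sum>n<N. cnj (a n) * a n)"
    unfolding sum_right[OF e(1) S] by (intro sum.cong refl) simp
  also have "\<dots> = complex_of_real (\<Sum>n<N. (cmod (a n))\<^sup>2)"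
    unfolding of_real_sum by (intro sum.cong refl) (simp only: complex_norm_square mult.commute)
  finally show ?thesis
    unfolding form_self[OF S] of_real_eq_iff .
qed

lemma bessel:
  fixes d :: "nat \<Rightarrow> real" and N :: nat
  assumes "\<And>n. e n \<in> V" "\<And>m n. B (e m) (e n) = (if m = n then complex_of_real (d n) else 0)"
    and "g \<in> V" "\<And>n. B g (e n) = complex_of_real (d n) * a n"
  shows "(\<Sum>n<N. d n * (cmod (a n))\<^sup>2) \<le> (nrm g)\<^sup>2"
  using remainder(3)[where e = e and d = d and a = a and N = N, OF assms(1,2,3,4)]
    zero_le_power2[of "nrm (\<lambda>x. g x - (\<Sum>n<N. a n * e n x))"]
  by linarith

lemma nrm_le_of_coefficients:
  assumes e: "\<And>n. e n \<in> V" "\<And>m n. B (e m) (e n) = (if m = n then 1 else 0)" and g: "g \<in> V"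
    and lim: "(\<lambda>N. nrm (\<lambda>x. g x - (\<Sum>n<N. B g (e n) * e n x))) \<longlonglongrightarrow> 0"
    and le: "\<And>N. (\<Sum>n<N. (cmod (B g (e n)))\<^sup>2) \<le> C\<^sup>2" and "0 \<le> C"
  shows "nrm g \<le> C"
proof -
  have low: "(nrm g)\<^sup>2 - C\<^sup>2 \<le> (nrm (\<lambda>x. g x - (\<Sum>n<N. B g (e n) * e n x)))\<^sup>2" for N
  proof -
    have orth: "B (e m) (e n) = (if m = n then complex_of_real 1 else 0)" for m n
      by (simp add: e(2))
    have coeff: "B g (e n) = complex_of_real 1 * B g (e n)" for n
      by simp
    have "(nrm (\<lambda>x. g x - (\<Sum>n<N. B g (e n) * e n x)))\<^sup>2 = (nrm g)\<^sup>2 - (\<Sum>n<N. 1 * (cmod (B g (e n)))\<^sup>2)"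
      by (rule remainder(3)[OF e(1) orth g coeff])
    with le[of N] show ?thesis
      by simp
  qed
  have lim_sq: "(\<lambda>N. (nrm (\<lambda>x. g x - (\<Sum>n<N. B g (e n) * e n x)))\<^sup>2) \<longlonglongrightarrow> 0\<^sup>2"
    using tendsto_power[OF lim, of 2] .
  have "(nrm g)\<^sup>2 - C\<^sup>2 \<le> 0\<^sup>2"
    using low by (intro tendsto_lowerbound[OF lim_sq] always_eventually allI) simp_all
  then have "(nrm g)\<^sup>2 \<le> C\<^sup>2"
    by simp
  then show ?thesis
    using \<open>0 \<le> C\<close> by (rule power2_le_imp_le)
qed

text \<open>For a bounded family \<open>G\<close>, the vectors \<open>h\<close> with \<open>\<langle>G i, h\<rangle> \<longlongrightarrow> 0\<close> form a closed set: Cauchy-Schwarz bounds the error made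
  by replacing \<open>h\<close> uniformly in \<open>i\<close>. Each weak convergence below is reduced in this way to a set of vectors whose
  closure is everything, test functions in one case and eigenfunctions in the other.\<close>

lemma weak_limit_closed:
  assumes G: "\<forall>\<^sub>F i in F. G i \<in> V" and bd: "\<forall>\<^sub>F i in F. nrm (G i) \<le> C"
    and h: "h \<in> V" "\<And>n. hs n \<in> V" "(\<lambda>n. nrm (\<lambda>x. h x - hs n x)) \<longlonglongrightarrow> 0"
    and lim: "\<And>n. ((\<lambda>i. B (G i) (hs n)) \<longlongrightarrow> 0) F"
  shows "((\<lambda>i. B (G i) h) \<longlongrightarrow> 0) F"
proof (rule tendstoI)
  fix r :: real assume "0 < r"
  define K where "K = max C 0 + 1"
  have K: "0 < K" "C \<le> K" by (simp_all add: K_def)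
  have "\<forall>\<^sub>F n in sequentially. nrm (\<lambda>x. h x - hs n x) < r / 2 / K"
    using \<open>0 < r\<close> by (intro order_tendstoD[OF h(3)]) (use K in auto)
  then obtain n where n: "nrm (\<lambda>x. h x - hs n x) < r / 2 / K"
    by (auto simp: eventually_sequentially)
  have "\<forall>\<^sub>F i in F. cmod (B (G i) (hs n)) < r / 2"
    using tendstoD[OF lim[of n], of "r / 2"] \<open>0 < r\<close> by simp
  with G bd show "\<forall>\<^sub>F i in F. dist (B (G i) h) 0 < r"
  proof eventually_elim
    case (elim i)
    have "B (G i) h = B (G i) (\<lambda>x. h x - hs n x) + B (G i) (hs n)"
      using diff_right[OF h(1) h(2)[of n] elim(1)] by simp
    moreover have "cmod (B (G i) (\<lambda>x. h x - hs n x)) \<le> nrm (G i) * nrm (\<lambda>x. h x - hs n x)"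
      using elim h by (intro cauchy_schwarz diff_mem)
    moreover have "K * (r / 2 / K) = r / 2"
      using K by simp
    moreover have "nrm (G i) * nrm (\<lambda>x. h x - hs n x) \<le> K * (r / 2 / K)"
      using elim n h K nrm_nonneg[OF diff_mem[of h "hs n"]] by (intro mult_mono) auto
    ultimately show ?case
      using elim(3) norm_triangle_ineq[of "B (G i) (\<lambda>x. h x - hs n x)" "B (G i) (hs n)"]
      by (simp only: dist_norm diff_zero)
  qed
qed

end

section \<open>Smooth bump functions\<close>

text \<open>The derivatives in the definition of \<open>Ck_on\<close> are chosen by \<open>frechet_derivative\<close>; this allows one to exhibit them instead.\<close>

lemma Ck_on_SucI:
  assumes "\<And>x. (f has_derivative D x) (at x)" and "\<And>v. Ck_on k UNIV (\<lambda>x. D x v)"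
  shows "Ck_on (Suc k) UNIV f"
proof -
  have "frechet_derivative f (at x) = D x" for x
    using frechet_derivative_at[OF assms(1)] by simp
  then show ?thesis
    using assms by (auto simp: differentiable_on_def differentiable_def)
qed

lemma Ck_on_SucD:
  assumes "Ck_on (Suc k) UNIV f"
  shows "(f has_derivative frechet_derivative f (at x)) (at x)"
    and "Ck_on k UNIV (\<lambda>x. frechet_derivative f (at x) v)"
  using assms by (auto simp: differentiable_on_def frechet_derivative_works)

lemma Ck_on_Suc_imp: "Ck_on (Suc k) UNIV f \<Longrightarrow> Ck_on k UNIV f"
proof (induction k arbitrary: f)
  case 0
  then show ?case by (auto intro: differentiable_imp_continuous_on)
next
  case (Suc k)
  show ?case
    by (rule Ck_on_SucI[OF Ck_on_SucD(1)[OF Suc.prems] Suc.IH[OF Ck_on_SucD(2)[OF Suc.prems]]])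
qed

lemma Ck_on_const: "Ck_on k UNIV (\<lambda>_. a)"
proof (induction k arbitrary: a)
  case (Suc k)
  then show ?case by (intro Ck_on_SucI[where D = "\<lambda>_ _. 0"]) auto
qed simp

lemma Ck_on_add: "Ck_on k UNIV f \<Longrightarrow> Ck_on k UNIV g \<Longrightarrow> Ck_on k UNIV (\<lambda>x. f x + g x)"
proof (induction k arbitrary: f g)
  case 0
  then show ?case by (auto intro: continuous_intros)
next
  case (Suc k)
  show ?case
    by (rule Ck_on_SucI[OF has_derivative_add[OF Ck_on_SucD(1)[OF Suc.prems(1)] Ck_on_SucD(1)[OF Suc.prems(2)]]])
      (intro Suc.IH Ck_on_SucD(2)[OF Suc.prems(1)] Ck_on_SucD(2)[OF Suc.prems(2)])
qed

lemma Ck_on_mult: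
  fixes f g :: "'a::real_normed_vector \<Rightarrow> real"
  shows "Ck_on k UNIV f \<Longrightarrow> Ck_on k UNIV g \<Longrightarrow> Ck_on k UNIV (\<lambda>x. f x * g x)"
proof (induction k arbitrary: f g)
  case 0
  then show ?case by (auto intro: continuous_intros)
next
  case (Suc k)
  show ?case
    by (rule Ck_on_SucI[OF has_derivative_mult[OF Ck_on_SucD(1)[OF Suc.prems(1)] Ck_on_SucD(1)[OF Suc.prems(2)]]])
      (intro Ck_on_add Suc.IH Ck_on_SucD(2)[OF Suc.prems(1)] Ck_on_SucD(2)[OF Suc.prems(2)]
        Ck_on_Suc_imp[OF Suc.prems(1)] Ck_on_Suc_imp[OF Suc.prems(2)])
qed

lemma Ck_on_bounded_linear:
  assumes "bounded_linear f"
  shows "Ck_on k UNIV f"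
proof (cases k)
  case 0
  then show ?thesis
    by (simp add: linear_continuous_on assms)
next
  case (Suc n)
  then show ?thesis
    using bounded_linear_imp_has_derivative[OF assms] Ck_on_const
    by (simp only:) (rule Ck_on_SucI)
qed

lemma smooth_on_const: "smooth_on UNIV (\<lambda>_. a)"
  by (simp add: smooth_on_def Ck_on_const)

lemma smooth_on_add: "smooth_on UNIV f \<Longrightarrow> smooth_on UNIV g \<Longrightarrow> smooth_on UNIV (\<lambda>x. f x + g x)"
  by (simp add: smooth_on_def Ck_on_add)

lemma smooth_on_mult:
  fixes f g :: "'a::real_normed_vector \<Rightarrow> real"
  shows "smooth_on UNIV f \<Longrightarrow> smooth_on UNIV g \<Longrightarrow> smooth_on UNIV (\<lambda>x. f x * g x)"
  by (simp add: smooth_on_def Ck_on_mult)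

lemma smooth_on_diff:
  fixes f g :: "'a::real_normed_vector \<Rightarrow> real"
  shows "smooth_on UNIV f \<Longrightarrow> smooth_on UNIV g \<Longrightarrow> smooth_on UNIV (\<lambda>x. f x - g x)"
  using smooth_on_add[of f "\<lambda>x. (-1) * g x"] smooth_on_mult[OF smooth_on_const, of g "-1"] by simp

lemma smooth_on_power:
  fixes f :: "'a::real_normed_vector \<Rightarrow> real"
  shows "smooth_on UNIV f \<Longrightarrow> smooth_on UNIV (\<lambda>x. f x ^ n)"
  by (induction n) (auto intro: smooth_on_const smooth_on_mult)

text \<open>The function \<open>x\<^sup>-\<^sup>n exp (-1/x)\<close>, continued by \<open>0\<close> to the left of \<open>0\<close>. The exponent is carried along because the derivative of
  a member of this family is a combination of members of the family, so that smoothness follows by induction without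
  computing higher derivatives.\<close>

definition flat :: "nat \<Rightarrow> real \<Rightarrow> real" where
  "flat n x = (if x \<le> 0 then 0 else inverse x ^ n / exp (inverse x))"

lemma flat_tendsto_0: "(flat n \<longlongrightarrow> 0) (at_right 0)"
proof -
  have "((\<lambda>x::real. inverse x ^ n / exp (inverse x)) \<longlongrightarrow> 0) (at_right 0)"
    by (rule filterlim_compose[OF tendsto_power_div_exp_0 filterlim_inverse_at_top_right])
  moreover have "\<forall>\<^sub>F x in at_right 0. inverse x ^ n / exp (inverse x) = flat n x"
    by (auto simp: flat_def eventually_at_filter)
  ultimately show ?thesis
    by (rule Lim_transform_eventually)
qed

lemma flat_has_derivative:
  "(flat n has_real_derivative (flat (n + 2) x - real n * flat (n + 1) x)) (at x)"
proof -
  consider "x < 0" | "x = 0" | "0 < x" by linarith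
  then show ?thesis
  proof cases
    case 1
    have "((\<lambda>_. 0) has_real_derivative 0) (at x)" by simp
    moreover have "\<forall>\<^sub>F y in nhds x. 0 = flat n y"
      using eventually_nhds_in_open[of "{..<0}" x] 1 by (auto simp: flat_def elim!: eventually_mono)
    ultimately have "(flat n has_real_derivative 0) (at x)"
      using DERIV_cong_ev by force
    then show ?thesis using 1 by (simp add: flat_def)
  next
    case 2
    have "((\<lambda>h. flat n h / h) \<longlongrightarrow> 0) (at 0)"
      unfolding filterlim_at_split
    proof
      have "\<forall>\<^sub>F h in at_left 0. 0 = flat n h / h"
        by (auto simp: flat_def eventually_at_filter)
      then show "((\<lambda>h. flat n h / h) \<longlongrightarrow> 0) (at_left 0)"
        by (rule Lim_transform_eventually[OF tendsto_const])
      have "\<forall>\<^sub>F h in at_right 0. flat (n + 1) h = flat n h / h"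
        by (auto simp: flat_def eventually_at_filter field_simps)
      then show "((\<lambda>h. flat n h / h) \<longlongrightarrow> 0) (at_right 0)"
        by (rule Lim_transform_eventually[OF flat_tendsto_0])
    qed
    then show ?thesis
      using 2 by (simp add: flat_def DERIV_def)
  next
    case 3
    let ?z = "inverse x"
    have "((\<lambda>z. z ^ n / exp z) has_real_derivative (real n * z ^ (n - 1) - z ^ n) / exp z) (at z)" for z :: real
      by (auto intro!: derivative_eq_intros simp: field_simps power2_eq_square)
    from DERIV_chain2[OF this DERIV_inverse[of x UNIV]] 3
    have "((\<lambda>y. inverse y ^ n / exp (inverse y)) has_real_derivative
        (real n * ?z ^ (n - 1) - ?z ^ n) / exp ?z * - (?z ^ Suc (Suc 0))) (at x)"
      by simp
    also have "(real n * ?z ^ (n - 1) - ?z ^ n) / exp ?z * - (?z ^ Suc (Suc 0)) = flat (n + 2) x - real n * flat (n + 1) x"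
      using 3 by (cases n) (simp_all add: flat_def algebra_simps diff_divide_distrib add_divide_distrib)
    finally have "((\<lambda>y. inverse y ^ n / exp (inverse y)) has_real_derivative (flat (n + 2) x - real n * flat (n + 1) x)) (at x)" .
    moreover have "\<forall>\<^sub>F y in nhds x. inverse y ^ n / exp (inverse y) = flat n y"
      using eventually_nhds_in_open[of "{0<..}" x] 3 by (auto simp: flat_def elim!: eventually_mono)
    ultimately show ?thesis
      using DERIV_cong_ev by force
  qed
qed

lemma Ck_on_flat_compose:
  fixes f :: "'a::real_normed_vector \<Rightarrow> real"
  shows "Ck_on k UNIV f \<Longrightarrow> Ck_on k UNIV (\<lambda>x. flat n (f x))"
proof (induction k arbitrary: n)
  case 0
  have "continuous_on UNIV (flat n)"
    by (intro continuous_at_imp_continuous_on ballI DERIV_isCont[OF flat_has_derivative])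
  then have "continuous_on UNIV (\<lambda>x. flat n (f x))"
    using 0 by (auto intro: continuous_on_compose2[of UNIV "flat n"])
  then show ?case by simp
next
  case (Suc k)
  let ?D = "\<lambda>x v. (flat (n + 2) (f x) + (- real n) * flat (n + 1) (f x)) * frechet_derivative f (at x) v"
  have "((\<lambda>x. flat n (f x)) has_derivative ?D x) (at x)" for x
    using has_derivative_compose[OF Ck_on_SucD(1)[OF Suc.prems]
        flat_has_derivative[unfolded has_field_derivative_def]] by simp
  moreover have "Ck_on k UNIV (\<lambda>x. ?D x v)" for v
    by (intro Ck_on_add Ck_on_mult Ck_on_const Suc.IH Ck_on_SucD(2)[OF Suc.prems]
      Ck_on_Suc_imp[OF Suc.prems])
  ultimately show ?case
    by (rule Ck_on_SucI)
qed

lemma smooth_on_ball_bump: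
  fixes a :: "'a::euclidean_space"
  shows "smooth_on UNIV (\<lambda>x. flat 0 (r\<^sup>2 - (x - a) \<bullet> (x - a)))"
  unfolding smooth_on_def
proof
  fix k
  have "Ck_on k UNIV (\<lambda>x. x \<bullet> b)" for b :: 'a and k
    by (intro Ck_on_bounded_linear bounded_linear_inner_left)
  then have "Ck_on k UNIV (\<lambda>x. (x - a) \<bullet> b)" for b :: 'a and k
    using Ck_on_add[OF _ Ck_on_const, of k "\<lambda>x. x \<bullet> b" "- (a \<bullet> b)"] by (simp add: inner_diff_left)
  moreover have "((\<lambda>x. r\<^sup>2 - (x - a) \<bullet> (x - a)) has_derivative (\<lambda>v. (-2) * ((x - a) \<bullet> v))) (at x)" for x
    by (auto intro!: derivative_eq_intros simp: inner_commute)
  ultimately have "Ck_on (Suc k) UNIV (\<lambda>x. r\<^sup>2 - (x - a) \<bullet> (x - a))"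
    by (intro Ck_on_SucI[where D = "\<lambda>x v. (-2) * ((x - a) \<bullet> v)"] Ck_on_mult Ck_on_const)
  then show "Ck_on k UNIV (\<lambda>x. flat 0 (r\<^sup>2 - (x - a) \<bullet> (x - a)))"
    by (intro Ck_on_flat_compose) (rule Ck_on_Suc_imp)
qed

lemma ball_bump_pos_iff:
  fixes a :: "'a::euclidean_space"
  assumes "0 < r"
  shows "0 < flat 0 (r\<^sup>2 - (x - a) \<bullet> (x - a)) \<longleftrightarrow> x \<in> ball a r"
proof -
  have "(x - a) \<bullet> (x - a) < r\<^sup>2 \<longleftrightarrow> norm (x - a) < r"
    using assms abs_le_square_iff[of r "norm (x - a)"] by (simp add: dot_square_norm linorder_not_le[symmetric])
  then show ?thesis
    by (auto simp: flat_def dist_norm norm_minus_commute)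
qed

lemma flat_0_bounds: "0 \<le> flat 0 x" "flat 0 x \<le> 1"
  by (auto simp: flat_def field_simps)

text \<open>If \<open>\<beta>\<close> and \<open>b\<close> take values in \<open>[0,1]\<close>, then \<open>1 - (1 - \<beta>)(1 - b)\<close> does too, and it is positive exactly where one of them
  is. Thus finite unions of balls are positivity sets of test functions.\<close>

lemma test_function_union_bump:
  fixes \<Omega> :: "(real^'d) set"
  assumes "finite J" "\<And>a r. (a, r) \<in> J \<Longrightarrow> 0 < r \<and> cball a r \<subseteq> \<Omega>"
  shows "\<exists>\<beta>. test_function \<Omega> \<beta> \<and> (\<forall>x. 0 \<le> \<beta> x \<and> \<beta> x \<le> 1) \<and> (\<forall>x. 0 < \<beta> x \<longleftrightarrow> x \<in> (\<Union>(a, r)\<in>J. ball a r))"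
  using assms
proof (induction J rule: finite_induct)
  case empty
  have "test_function \<Omega> (\<lambda>_. 0)"
    by (auto simp: test_function_def smooth_on_const intro: exI[of _ "{}"])
  then show ?case
    by (intro exI[of _ "\<lambda>_. 0"]) auto
next
  case (insert p J)
  obtain a r where p: "p = (a, r)" by force
  have r: "0 < r" "cball a r \<subseteq> \<Omega>" using insert.prems[of a r] p by auto
  obtain \<beta> where \<beta>: "test_function \<Omega> \<beta>" "\<And>x. 0 \<le> \<beta> x \<and> \<beta> x \<le> 1"
      "\<And>x. 0 < \<beta> x \<longleftrightarrow> x \<in> (\<Union>(a, r)\<in>J. ball a r)"
    using insert.IH insert.prems by blast
  obtain K where K: "compact K" "K \<subseteq> \<Omega>" "\<And>x. x \<notin> K \<Longrightarrow> \<beta> x = 0" and sm: "smooth_on UNIV \<beta>"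
    using \<beta>(1) unfolding test_function_def by blast
  define b where "b x = flat 0 (r\<^sup>2 - (x - a) \<bullet> (x - a))" for x
  have b: "0 \<le> b x" "b x \<le> 1" "0 < b x \<longleftrightarrow> x \<in> ball a r" for x
    using flat_0_bounds ball_bump_pos_iff[OF r(1), of x a] by (auto simp: b_def)
  have "smooth_on UNIV b"
    unfolding b_def by (rule smooth_on_ball_bump)
  then have "smooth_on UNIV (\<lambda>x. 1 - (1 - \<beta> x) * (1 - b x))"
    by (intro smooth_on_diff smooth_on_mult smooth_on_const sm)
  moreover have "1 - (1 - \<beta> x) * (1 - b x) = 0" if "x \<notin> K \<union> cball a r" for x
  proof -
    have "x \<notin> ball a r" using that by auto
    with b(1,3)[of x] have "b x = 0" by (metis order_le_imp_less_or_eq)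
    then show ?thesis using K(3)[of x] that by simp
  qed
  ultimately have "test_function \<Omega> (\<lambda>x. 1 - (1 - \<beta> x) * (1 - b x))"
    using K(1,2) r(2) unfolding test_function_def by (intro conjI exI[of _ "K \<union> cball a r"]) (auto intro: compact_Un)
  moreover have "0 \<le> 1 - (1 - \<beta> x) * (1 - b x)" "1 - (1 - \<beta> x) * (1 - b x) \<le> 1" for x
    using \<beta>(2)[of x] b(1,2)[of x] mult_le_one[of "1 - \<beta> x" "1 - b x"] by auto
  moreover have "0 < 1 - (1 - \<beta> x) * (1 - b x) \<longleftrightarrow> x \<in> (\<Union>(a, r)\<in>insert p J. ball a r)" for x
  proof -
    have "0 < 1 - (1 - \<beta> x) * (1 - b x) \<longleftrightarrow> 0 < \<beta> x \<or> 0 < b x"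
    proof
      assume "0 < \<beta> x \<or> 0 < b x"
      then show "0 < 1 - (1 - \<beta> x) * (1 - b x)"
      proof
        assume "0 < \<beta> x"
        moreover have "(1 - \<beta> x) * (1 - b x) \<le> (1 - \<beta> x) * 1"
          using \<beta>(2)[of x] b(1,2)[of x] by (intro mult_left_mono) auto
        ultimately show ?thesis by simp
      next
        assume "0 < b x"
        moreover have "(1 - \<beta> x) * (1 - b x) \<le> 1 * (1 - b x)"
          using \<beta>(2)[of x] b(1,2)[of x] by (intro mult_right_mono) auto
        ultimately show ?thesis by simp
      qed
    next
      assume "0 < 1 - (1 - \<beta> x) * (1 - b x)"
      then show "0 < \<beta> x \<or> 0 < b x"
        using \<beta>(2)[of x] b(1)[of x] by (cases "\<beta> x = 0"; cases "b x = 0") auto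
    qed
    then show ?thesis
      using \<beta>(3)[of x] b(3)[of x] by (simp add: p) blast
  qed
  ultimately show ?case
    by (intro exI[of _ "\<lambda>x. 1 - (1 - \<beta> x) * (1 - b x)"]) blast
qed

text \<open>In combination with the regularity of Lebesgue measure, this approximates every measurable set by positivity sets of test functions.\<close>

lemma test_function_between:
  fixes \<Omega> :: "(real^'d) set"
  assumes "compact K" "K \<subseteq> U" "open U" "U \<subseteq> \<Omega>"
  obtains \<beta> where "test_function \<Omega> \<beta>" "\<And>x. 0 \<le> \<beta> x \<and> \<beta> x \<le> 1"
    "\<And>x. x \<in> K \<Longrightarrow> 0 < \<beta> x" "\<And>x. 0 < \<beta> x \<Longrightarrow> x \<in> U"
proof -
  have "\<forall>a\<in>K. \<exists>r>0. cball a r \<subseteq> U"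
    using assms open_contains_cball by blast
  then obtain r where r: "\<And>a. a \<in> K \<Longrightarrow> 0 < r a \<and> cball a (r a) \<subseteq> U"
    by metis
  obtain A where A: "A \<subseteq> K" "finite A" "K \<subseteq> (\<Union>a\<in>A. ball a (r a))"
  proof (rule compactE_image[OF \<open>compact K\<close>, of K "\<lambda>a. ball a (r a)"])
    show "K \<subseteq> (\<Union>a\<in>K. ball a (r a))" using r by force
  qed auto
  let ?J = "(\<lambda>a. (a, r a)) ` A"
  have "\<And>a s. (a, s) \<in> ?J \<Longrightarrow> 0 < s \<and> cball a s \<subseteq> \<Omega>"
    using r A(1) assms(4) by blast
  then obtain \<beta> where \<beta>: "test_function \<Omega> \<beta>" "\<forall>x. 0 \<le> \<beta> x \<and> \<beta> x \<le> 1"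
      "\<forall>x. 0 < \<beta> x \<longleftrightarrow> x \<in> (\<Union>(a, s)\<in>?J. ball a s)"
    using test_function_union_bump[of ?J \<Omega>] A(2) by blast
  have "(\<Union>(a, s)\<in>?J. ball a s) = (\<Union>a\<in>A. ball a (r a))" by auto
  then have pos: "0 < \<beta> x \<longleftrightarrow> x \<in> (\<Union>a\<in>A. ball a (r a))" for x
    using \<beta>(3) by simp
  have sub: "(\<Union>a\<in>A. ball a (r a)) \<subseteq> U"
    using r A(1) ball_subset_cball by blast
  show thesis
  proof
    show "test_function \<Omega> \<beta>" by fact
    show "0 \<le> \<beta> x \<and> \<beta> x \<le> 1" for x using \<beta>(2) by simp
    show "0 < \<beta> x" if "x \<in> K" for x using that A(3) unfolding pos by (rule rev_subsetD)
    show "x \<in> U" if "0 < \<beta> x" for x using that sub unfolding pos by (rule rev_subsetD)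
  qed
qed

text \<open>For \<open>0 \<le> \<beta> \<le> 1\<close> these functions increase with \<open>n\<close> to the indicator of \<open>{x. 0 < \<beta> x}\<close>.\<close>

lemma test_function_one_minus_power:
  assumes "test_function \<Omega> \<beta>"
  shows "test_function \<Omega> (\<lambda>x. 1 - (1 - \<beta> x) ^ n)"
proof -
  obtain K where "compact K" "K \<subseteq> \<Omega>" "\<forall>x. x \<notin> K \<longrightarrow> \<beta> x = 0" and sm: "smooth_on UNIV \<beta>"
    using assms unfolding test_function_def by blast
  moreover have "smooth_on UNIV (\<lambda>x. 1 - (1 - \<beta> x) ^ n)"
    by (intro smooth_on_diff smooth_on_power smooth_on_const sm)
  ultimately show ?thesis
    unfolding test_function_def by (intro conjI exI[of _ K]) auto
qed

lemma test_function_continuous: "test_function \<Omega> \<eta> \<Longrightarrow> continuous_on UNIV \<eta>"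
  unfolding test_function_def smooth_on_def using Ck_on.simps(1) by blast

lemma test_function_derivative:
  fixes \<Omega> :: "(real^'d) set"
  assumes "test_function \<Omega> \<eta>"
  shows "continuous_on UNIV (\<lambda>x. frechet_derivative \<eta> (at x) v)"
    and "\<exists>C. \<forall>x. \<bar>frechet_derivative \<eta> (at x) v\<bar> \<le> C"
proof -
  obtain K where K: "compact K" "\<And>x. x \<notin> K \<Longrightarrow> \<eta> x = 0" and Ck: "\<And>k. Ck_on k UNIV \<eta>"
    using assms unfolding test_function_def smooth_on_def by blast
  show cont: "continuous_on UNIV (\<lambda>x. frechet_derivative \<eta> (at x) v)"
    using Ck_on_SucD(2)[OF Ck[of "Suc 0"]] by simp
  have zero: "frechet_derivative \<eta> (at x) v = 0" if "x \<notin> K" for x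
  proof -
    have "open (- K)" using K(1) by (simp add: compact_imp_closed open_Compl)
    then have "(\<eta> has_derivative (\<lambda>_. 0)) (at x)"
      by (rule has_derivative_transform_within_open[OF has_derivative_const]) (use that K(2) in auto)
    then show ?thesis
      using frechet_derivative_at by metis
  qed
  have "bounded ((\<lambda>x. frechet_derivative \<eta> (at x) v) ` K)"
    by (intro compact_imp_bounded compact_continuous_image K continuous_on_subset[OF cont]) auto
  then obtain C where "\<And>x. x \<in> K \<Longrightarrow> \<bar>frechet_derivative \<eta> (at x) v\<bar> \<le> C"
    by (auto simp: bounded_iff)
  then have "\<bar>frechet_derivative \<eta> (at x) v\<bar> \<le> max C 0" for x
    using zero[of x] by (cases "x \<in> K") (auto simp: max.coboundedI1)
  then show "\<exists>C. \<forall>x. \<bar>frechet_derivative \<eta> (at x) v\<bar> \<le> C" by blast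
qed

section \<open>Square integrable functions\<close>

locale bounded_open_domain =
  fixes \<Omega> :: "(real^'d) set"
  assumes open_domain: "open \<Omega>" and bounded_domain: "bounded \<Omega>"
begin

abbreviation M where "M \<equiv> lebesgue_on \<Omega>"

lemma domain_sets: "\<Omega> \<in> sets lebesgue"
  using open_domain by simp

lemma space_M: "space M = \<Omega>"
  by (simp add: space_restrict_space)

lemma finite_measure_M: "finite_measure M"
  using bounded_domain open_domain by (intro finite_measure_lebesgue_on lmeasurable_open)

lemma L2_measurable: "g \<in> L2 \<Omega> \<Longrightarrow> g \<in> borel_measurable M"
  by (simp add: L2_def)

lemma L2_integrable: "g \<in> L2 \<Omega> \<Longrightarrow> integrable M (\<lambda>x. (cmod (g x))\<^sup>2)"
  by (simp add: L2_def)

lemma L2_I_dominated: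
  assumes "g \<in> borel_measurable M" "integrable M H" "\<And>x. x \<in> \<Omega> \<Longrightarrow> (cmod (g x))\<^sup>2 \<le> H x"
  shows "g \<in> L2 \<Omega>"
  using assms unfolding L2_def
  by (auto intro!: Bochner_Integration.integrable_bound[OF assms(2)] AE_I2 order_trans[OF _ abs_ge_self] simp: space_M)

lemma L2_I_bounded:
  assumes "g \<in> borel_measurable M" "\<And>x. x \<in> \<Omega> \<Longrightarrow> cmod (g x) \<le> C"
  shows "g \<in> L2 \<Omega>"
proof (rule L2_I_dominated[OF assms(1)])
  show "integrable M (\<lambda>_. C\<^sup>2)"
    using finite_measure_M by (simp add: finite_measure.integrable_const)
  show "(cmod (g x))\<^sup>2 \<le> C\<^sup>2" if "x \<in> \<Omega>" for x
    using assms(2)[OF that] by (intro power_mono) auto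
qed

lemma L2_continuous_bounded:
  fixes \<eta> :: "real^'d \<Rightarrow> real"
  assumes "continuous_on UNIV \<eta>" "\<And>x. \<bar>\<eta> x\<bar> \<le> C"
  shows "(\<lambda>x. complex_of_real (\<eta> x)) \<in> L2 \<Omega>"
proof (rule L2_I_bounded)
  have "(\<lambda>x. complex_of_real (\<eta> x)) \<in> borel_measurable borel"
    using assms(1) by (intro borel_measurable_continuous_onI continuous_intros)
  then show "(\<lambda>x. complex_of_real (\<eta> x)) \<in> borel_measurable M"
    by (simp add: measurable_completion measurable_restrict_space1)
qed (use assms(2) in auto)

lemma L2_zero: "(\<lambda>_. 0) \<in> L2 \<Omega>"
  by (rule L2_I_bounded[where C = 0]) auto

lemma L2_scale_bounded:
  assumes "g \<in> L2 \<Omega>" "b \<in> borel_measurable M" "\<And>x. x \<in> \<Omega> \<Longrightarrow> cmod (b x) \<le> C"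
  shows "(\<lambda>x. b x * g x) \<in> L2 \<Omega>"
proof (rule L2_I_dominated)
  show "(\<lambda>x. b x * g x) \<in> borel_measurable M"
    using assms L2_measurable by (intro borel_measurable_times)
  show "integrable M (\<lambda>x. C\<^sup>2 * (cmod (g x))\<^sup>2)"
    using L2_integrable[OF assms(1)] by simp
  show "(cmod (b x * g x))\<^sup>2 \<le> C\<^sup>2 * (cmod (g x))\<^sup>2" if "x \<in> \<Omega>" for x
    using assms(3)[OF that] by (simp add: norm_mult power_mult_distrib mult_right_mono power_mono)
qed

lemma L2_add:
  assumes "g \<in> L2 \<Omega>" "h \<in> L2 \<Omega>"
  shows "(\<lambda>x. g x + h x) \<in> L2 \<Omega>"
proof (rule L2_I_dominated)
  show "(\<lambda>x. g x + h x) \<in> borel_measurable M"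
    using assms L2_measurable by (intro borel_measurable_add)
  show "integrable M (\<lambda>x. 2 * (cmod (g x))\<^sup>2 + 2 * (cmod (h x))\<^sup>2)"
    using L2_integrable assms by simp
  show "(cmod (g x + h x))\<^sup>2 \<le> 2 * (cmod (g x))\<^sup>2 + 2 * (cmod (h x))\<^sup>2" for x
  proof -
    have "(cmod (g x + h x))\<^sup>2 \<le> (cmod (g x) + cmod (h x))\<^sup>2"
      by (intro power_mono norm_triangle_ineq) simp
    also have "\<dots> \<le> 2 * (cmod (g x))\<^sup>2 + 2 * (cmod (h x))\<^sup>2"
      using sum_squares_bound[of "cmod (g x)" "cmod (h x)"] by (simp add: power2_sum)
    finally show ?thesis .
  qed
qed

lemma L2_lin:
  assumes "g \<in> L2 \<Omega>" "h \<in> L2 \<Omega>"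
  shows "(\<lambda>x. g x + a * h x) \<in> L2 \<Omega>"
  using L2_add[OF assms(1) L2_scale_bounded[OF assms(2), of "\<lambda>_. a" "cmod a"]] by simp

lemma L2_product_integrable:
  assumes "g \<in> L2 \<Omega>" "h \<in> L2 \<Omega>"
  shows "integrable M (\<lambda>x. g x * cnj (h x))"
proof (rule Bochner_Integration.integrable_bound)
  show "integrable M (\<lambda>x. (cmod (g x))\<^sup>2 + (cmod (h x))\<^sup>2)"
    using L2_integrable assms by simp
  have "(\<lambda>x. cnj (h x)) \<in> borel_measurable M"
    by (rule borel_measurable_continuous_on[OF _ L2_measurable[OF assms(2)]]) (intro continuous_intros)
  then show "(\<lambda>x. g x * cnj (h x)) \<in> borel_measurable M"
    using L2_measurable[OF assms(1)] by (intro borel_measurable_times)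
  have "cmod (g x * cnj (h x)) \<le> (cmod (g x))\<^sup>2 + (cmod (h x))\<^sup>2" for x
    using sum_squares_bound[of "cmod (g x)" "cmod (h x)"] mult_nonneg_nonneg[of "cmod (g x)" "cmod (h x)"]
    by (simp add: norm_mult del: mult_nonneg_nonneg)
  then show "AE x in M. norm (g x * cnj (h x)) \<le> norm ((cmod (g x))\<^sup>2 + (cmod (h x))\<^sup>2)"
    by simp
qed

end

text \<open>The two-sided bounds on \<open>c\<close> make the weighted norm continuous with respect to the plain one and keep
  \<open>c\<^sup>2 \<cdot> h\<close> square integrable, which is what converts plain integrals into weighted products.\<close>

locale weighted_domain = bounded_open_domain \<Omega> for \<Omega> :: "(real^'d) set" +
  fixes c :: "real^'d \<Rightarrow> real" and lo hi :: real
  assumes weight_measurable: "c \<in> borel_measurable (lebesgue_on \<Omega>)" and lo_pos: "0 < lo"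
    and weight_bounds: "\<And>x. x \<in> \<Omega> \<Longrightarrow> lo \<le> c x \<and> c x \<le> hi"
begin

lemma inverse_weight_bounds: "x \<in> \<Omega> \<Longrightarrow> 0 \<le> 1 / (c x)\<^sup>2" "x \<in> \<Omega> \<Longrightarrow> 1 / (c x)\<^sup>2 \<le> 1 / lo\<^sup>2"
  using weight_bounds[of x] lo_pos by (auto intro!: divide_left_mono power_mono mult_pos_pos)

lemma winner_integrable:
  assumes "g \<in> L2 \<Omega>" "h \<in> L2 \<Omega>"
  shows "integrable M (\<lambda>x. complex_of_real (1 / (c x)\<^sup>2) * g x * cnj (h x))"
proof (rule L2_product_integrable)
  show "(\<lambda>x. complex_of_real (1 / (c x)\<^sup>2) * g x) \<in> L2 \<Omega>"
  proof (rule L2_scale_bounded[OF assms(1)])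
    show "(\<lambda>x. complex_of_real (1 / (c x)\<^sup>2)) \<in> borel_measurable M"
      using weight_measurable by measurable
    show "cmod (complex_of_real (1 / (c x)\<^sup>2)) \<le> 1 / lo\<^sup>2" if "x \<in> \<Omega>" for x
      using inverse_weight_bounds[OF that] by (simp only: norm_of_real abs_of_nonneg)
  qed
qed fact

lemma winner_self: "winner \<Omega> c g g = complex_of_real (LINT x|M. 1 / (c x)\<^sup>2 * (cmod (g x))\<^sup>2)"
proof -
  have "complex_of_real (1 / (c x)\<^sup>2) * g x * cnj (g x) = complex_of_real (1 / (c x)\<^sup>2 * (cmod (g x))\<^sup>2)" for x
    by (simp only: mult.assoc complex_norm_square[symmetric] of_real_mult)
  then show ?thesis
    by (simp only: winner_def integral_complex_of_real)
qed

end

sublocale weighted_domain \<subseteq> L2: hermitian_form "L2 \<Omega>" "winner \<Omega> c"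
proof
  show "(\<lambda>_. 0) \<in> L2 \<Omega>" by (rule L2_zero)
next
  fix g h :: "real^'d \<Rightarrow> complex" and a assume g: "g \<in> L2 \<Omega>" and h: "h \<in> L2 \<Omega>"
  then show "(\<lambda>x. g x + a * h x) \<in> L2 \<Omega>" by (rule L2_lin)
  show "winner \<Omega> c h g = cnj (winner \<Omega> c g h)"
    unfolding winner_def Bochner_Integration.integral_cnj[symmetric] by (rule Bochner_Integration.integral_cong) auto
  show "0 \<le> Re (winner \<Omega> c g g)"
    unfolding winner_self Re_complex_of_real
    by (rule Bochner_Integration.integral_nonneg) simp
  fix k assume k: "k \<in> L2 \<Omega>"
  let ?w = "\<lambda>x. complex_of_real (1 / (c x)\<^sup>2)"
  have "winner \<Omega> c (\<lambda>x. g x + a * h x) k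
      = (LINT x|M. ?w x * g x * cnj (k x) + a * (?w x * h x * cnj (k x)))"
    unfolding winner_def by (rule Bochner_Integration.integral_cong) (auto simp: algebra_simps add_divide_distrib)
  also have "\<dots> = winner \<Omega> c g k + a * winner \<Omega> c h k"
    unfolding winner_def integral_mult_right_zero[symmetric]
    by (rule Bochner_Integration.integral_add[OF winner_integrable[OF g k] integrable_mult_right[OF winner_integrable[OF h k]]])
  finally show "winner \<Omega> c (\<lambda>x. g x + a * h x) k = winner \<Omega> c g k + a * winner \<Omega> c h k" .
qed

context weighted_domain
begin

lemma nrm_eq_wnorm: "L2.nrm g = wnorm \<Omega> c g"
  by (simp add: L2.nrm_def wnorm_def)

lemma wnorm_power2_le:
  assumes "g \<in> L2 \<Omega>"
  shows "(wnorm \<Omega> c g)\<^sup>2 \<le> 1 / lo\<^sup>2 * (LINT x|M. (cmod (g x))\<^sup>2)"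
proof -
  have "integrable M (\<lambda>x. 1 / (c x)\<^sup>2 * (cmod (g x))\<^sup>2)"
  proof (rule Bochner_Integration.integrable_bound)
    show "integrable M (\<lambda>x. 1 / lo\<^sup>2 * (cmod (g x))\<^sup>2)"
      using L2_integrable[OF assms] by simp
    show "(\<lambda>x. 1 / (c x)\<^sup>2 * (cmod (g x))\<^sup>2) \<in> borel_measurable M"
      using weight_measurable L2_measurable[OF assms] by measurable
    show "AE x in M. norm (1 / (c x)\<^sup>2 * (cmod (g x))\<^sup>2) \<le> norm (1 / lo\<^sup>2 * (cmod (g x))\<^sup>2)"
      using inverse_weight_bounds by (intro AE_I2) (simp add: space_M abs_mult mult_right_mono del: times_divide_eq_left)
  qed
  then have "(LINT x|M. 1 / (c x)\<^sup>2 * (cmod (g x))\<^sup>2) \<le> (LINT x|M. 1 / lo\<^sup>2 * (cmod (g x))\<^sup>2)"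
    using L2_integrable[OF assms] inverse_weight_bounds
    by (intro integral_mono mult_right_mono) (simp_all add: space_M)
  moreover have "0 \<le> (LINT x|M. 1 / (c x)\<^sup>2 * (cmod (g x))\<^sup>2)"
    by (rule Bochner_Integration.integral_nonneg) simp
  ultimately show ?thesis
    by (simp add: wnorm_def winner_self)
qed

lemma wnorm_dominated_convergence:
  assumes g: "g \<in> L2 \<Omega>" and gs: "\<And>n::nat. gs n \<in> L2 \<Omega>" and H: "integrable M (\<lambda>x. (H x)\<^sup>2)"
    and le: "\<And>n x. x \<in> \<Omega> \<Longrightarrow> cmod (g x - gs n x) \<le> H x"
    and lim: "\<And>x. x \<in> \<Omega> \<Longrightarrow> (\<lambda>n. gs n x) \<longlonglongrightarrow> g x"
  shows "(\<lambda>n. wnorm \<Omega> c (\<lambda>x. g x - gs n x)) \<longlonglongrightarrow> 0"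
proof -
  have mem: "(\<lambda>x. g x - gs n x) \<in> L2 \<Omega>" for n
    using g gs by (rule L2.diff_mem)
  have "(\<lambda>n. LINT x|M. (cmod (g x - gs n x))\<^sup>2) \<longlonglongrightarrow> (LINT x|M. 0)"
  proof (rule integral_dominated_convergence[OF _ _ H])
    show "(\<lambda>x. (cmod (g x - gs n x))\<^sup>2) \<in> borel_measurable M" for n
      using L2_measurable[OF mem] by measurable
    show "AE x in M. (\<lambda>n. (cmod (g x - gs n x))\<^sup>2) \<longlonglongrightarrow> 0"
    proof (rule AE_I2)
      fix x assume "x \<in> space M"
      then have "(\<lambda>n. (cmod (g x - gs n x))\<^sup>2) \<longlonglongrightarrow> (cmod (g x - g x))\<^sup>2"
        by (intro tendsto_intros lim) (simp add: space_M)
      then show "(\<lambda>n. (cmod (g x - gs n x))\<^sup>2) \<longlonglongrightarrow> 0" by simp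
    qed
    show "AE x in M. norm ((cmod (g x - gs n x))\<^sup>2) \<le> (H x)\<^sup>2" for n
      using le by (intro AE_I2) (auto simp: space_M intro!: power_mono)
  qed simp
  then have "(\<lambda>n. 1 / lo\<^sup>2 * (LINT x|M. (cmod (g x - gs n x))\<^sup>2)) \<longlonglongrightarrow> 1 / lo\<^sup>2 * 0"
    unfolding Bochner_Integration.integral_zero by (rule tendsto_mult_left)
  then have "(\<lambda>n. 1 / lo\<^sup>2 * (LINT x|M. (cmod (g x - gs n x))\<^sup>2)) \<longlonglongrightarrow> 0"
    by (simp only: mult_zero_right)
  then have "(\<lambda>n. (wnorm \<Omega> c (\<lambda>x. g x - gs n x))\<^sup>2) \<longlonglongrightarrow> 0"
  proof (rule Lim_null_comparison[rotated])
    show "\<forall>\<^sub>F n in sequentially. norm ((wnorm \<Omega> c (\<lambda>x. g x - gs n x))\<^sup>2) \<le> 1 / lo\<^sup>2 * (LINT x|M. (cmod (g x - gs n x))\<^sup>2)"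
      using wnorm_power2_le[OF mem] by (intro always_eventually allI) simp
  qed
  then show ?thesis
    by simp
qed

section \<open>Density of the test functions\<close>

lemma L2_test_function: "test_function \<Omega> \<eta> \<Longrightarrow> (\<lambda>x. complex_of_real (\<eta> x)) \<in> L2 \<Omega>"
proof -
  assume \<eta>: "test_function \<Omega> \<eta>"
  obtain K where K: "compact K" "\<And>x. x \<notin> K \<Longrightarrow> \<eta> x = 0"
    using \<eta> unfolding test_function_def by blast
  have "bounded (\<eta> ` K)"
    by (intro compact_imp_bounded compact_continuous_image K continuous_on_subset[OF test_function_continuous[OF \<eta>]]) auto
  then obtain C where "\<And>x. x \<in> K \<Longrightarrow> \<bar>\<eta> x\<bar> \<le> C"
    by (auto simp: bounded_iff)
  then have "\<bar>\<eta> x\<bar> \<le> max C 0" for x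
    using K(2)[of x] by (cases "x \<in> K") (auto simp: max.coboundedI1)
  then show ?thesis
    by (rule L2_continuous_bounded[OF test_function_continuous[OF \<eta>]])
qed

lemma L2_indicator:
  assumes "A \<in> sets lebesgue"
  shows "indicator A \<in> L2 \<Omega>"
proof (rule L2_I_bounded[where C = 1])
  show "(indicator A :: real^'d \<Rightarrow> complex) \<in> borel_measurable M"
    using assms by (intro measurable_restrict_space1 borel_measurable_indicator)
qed (simp add: indicator_def)

lemma wnorm_indicator_diff_le:
  assumes A: "A \<in> sets lebesgue" and B: "B \<in> sets lebesgue" and D: "D \<in> lmeasurable"
    and sub: "(A - B) \<union> (B - A) \<subseteq> D"
  shows "(wnorm \<Omega> c (\<lambda>x. indicator A x - indicator B x))\<^sup>2 \<le> 1 / lo\<^sup>2 * measure lebesgue D"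
proof -
  let ?g = "\<lambda>x. indicator A x - indicator B x :: complex"
  have g: "?g \<in> L2 \<Omega>"
    by (intro L2.diff_mem L2_indicator A B)
  have DM: "D \<inter> \<Omega> \<in> sets lebesgue"
    using D domain_sets by (intro sets.Int) auto
  have fin: "D \<inter> space M \<in> sets M" "emeasure M (D \<inter> space M) < \<infinity>"
    using finite_measure.emeasure_finite[OF finite_measure_M, of "D \<inter> \<Omega>"] DM domain_sets
    by (auto simp: space_M sets_restrict_space_iff top.not_eq_extremum)
  have "(LINT x|M. (cmod (?g x))\<^sup>2) \<le> (LINT x|M. indicator D x)"
  proof (rule integral_mono)
    show "integrable M (\<lambda>x. (cmod (?g x))\<^sup>2)"
      using g by (rule L2_integrable)
    show "integrable M (indicator D :: _ \<Rightarrow> real)"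
      using fin by (simp add: integrable_indicator_iff)
    show "(cmod (?g x))\<^sup>2 \<le> indicator D x" for x
      using sub by (auto simp: indicator_def)
  qed
  also have "\<dots> = measure lebesgue (D \<inter> \<Omega>)"
    using domain_sets by (simp add: space_M measure_restrict_space)
  also have "\<dots> \<le> measure lebesgue D"
    using D DM by (intro measure_mono_fmeasurable) auto
  finally have "1 / lo\<^sup>2 * (LINT x|M. (cmod (?g x))\<^sup>2) \<le> 1 / lo\<^sup>2 * measure lebesgue D"
    by (rule mult_left_mono) simp
  with wnorm_power2_le[OF g] show ?thesis
    by (rule order_trans)
qed

text \<open>The test functions are dense, in the form of an induction rule: a closed linear condition which holds for the test
  functions holds on all of \<open>L\<^sup>2\<close>. Limits of test functions give indicators of finite unions of balls, these give
  indicators of measurable sets by regularity, and simple functions give the rest by dominated convergence.\<close>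

lemma L2_test_induct [consumes 1, case_names test lin lim]:
  assumes "g \<in> L2 \<Omega>"
    and test: "\<And>\<eta>. test_function \<Omega> \<eta> \<Longrightarrow> P (\<lambda>x. complex_of_real (\<eta> x))"
    and lin: "\<And>g h a. g \<in> L2 \<Omega> \<Longrightarrow> h \<in> L2 \<Omega> \<Longrightarrow> P g \<Longrightarrow> P h \<Longrightarrow> P (\<lambda>x. g x + a * h x)"
    and lim: "\<And>g gs. g \<in> L2 \<Omega> \<Longrightarrow> (\<And>n::nat. gs n \<in> L2 \<Omega>) \<Longrightarrow> (\<And>n. P (gs n)) \<Longrightarrow>
        (\<lambda>n. wnorm \<Omega> c (\<lambda>x. g x - gs n x)) \<longlonglongrightarrow> 0 \<Longrightarrow> P g"
  shows "P g"
proof -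
  have const_integrable: "integrable M (\<lambda>_. (1::real)\<^sup>2)"
    using finite_measure_M by (simp add: finite_measure.integrable_const)
  have positive_set: "{x. 0 < \<beta> x} \<in> sets lebesgue \<and> P (indicator {x. 0 < \<beta> x})"
    if \<beta>: "test_function \<Omega> \<beta>" "\<And>x. 0 \<le> \<beta> x \<and> \<beta> x \<le> 1" for \<beta>
  proof
    have "open {x. 0 < \<beta> x}"
      by (intro open_Collect_less continuous_on_const test_function_continuous[OF \<beta>(1)])
    then show meas: "{x. 0 < \<beta> x} \<in> sets lebesgue" by simp
    have \<eta>: "test_function \<Omega> (\<lambda>x. 1 - (1 - \<beta> x) ^ n)" for n
      by (rule test_function_one_minus_power[OF \<beta>(1)])
    show "P (indicator {x. 0 < \<beta> x})"
    proof (rule lim)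
      show "indicator {x. 0 < \<beta> x} \<in> L2 \<Omega>"
        by (rule L2_indicator[OF meas])
      show "(\<lambda>x. complex_of_real (1 - (1 - \<beta> x) ^ n)) \<in> L2 \<Omega>" for n
        by (rule L2_test_function[OF \<eta>])
      show "P (\<lambda>x. complex_of_real (1 - (1 - \<beta> x) ^ n))" for n
        by (rule test[OF \<eta>])
      have ind: "indicator {x. 0 < \<beta> x} x = complex_of_real (if 0 < \<beta> x then 1 else 0)" for x
        by (simp add: indicator_def)
      show "(\<lambda>n. wnorm \<Omega> c (\<lambda>x. indicator {x. 0 < \<beta> x} x - complex_of_real (1 - (1 - \<beta> x) ^ n))) \<longlonglongrightarrow> 0"
      proof (rule wnorm_dominated_convergence[OF L2_indicator[OF meas] L2_test_function[OF \<eta>] const_integrable])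
        fix x
        have zero: "\<beta> x = 0" if "\<not> 0 < \<beta> x" using \<beta>(2)[of x] that by linarith
        show "cmod (indicator {x. 0 < \<beta> x} x - complex_of_real (1 - (1 - \<beta> x) ^ n)) \<le> 1" for n
          unfolding ind of_real_diff[symmetric] norm_of_real
          using \<beta>(2)[of x] zero power_le_one[of "1 - \<beta> x" n] by auto
        have "(\<lambda>n. 1 - (1 - \<beta> x) ^ n) \<longlonglongrightarrow> (if 0 < \<beta> x then 1 else 0)"
        proof (cases "0 < \<beta> x")
          case True
          then have "(\<lambda>n. 1 - (1 - \<beta> x) ^ n) \<longlonglongrightarrow> 1 - 0"
            using \<beta>(2)[of x] by (intro tendsto_diff tendsto_const LIMSEQ_power_zero) auto
          with True show ?thesis by simp
        qed (simp add: zero)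
        then show "(\<lambda>n. complex_of_real (1 - (1 - \<beta> x) ^ n)) \<longlonglongrightarrow> indicator {x. 0 < \<beta> x} x"
          unfolding ind by (rule tendsto_of_real)
      qed
    qed
  qed
  \<comment> \<open>Choose a positivity set between a compact subset and an open superset of \<open>A\<close> of almost the same measure.\<close>
  have indicator: "P (indicator A)" if A: "A \<in> sets lebesgue" "A \<subseteq> \<Omega>" for A
  proof -
    have "\<exists>B. B \<in> sets lebesgue \<and> P (indicator B) \<and>
        (wnorm \<Omega> c (\<lambda>x. indicator A x - indicator B x))\<^sup>2 \<le> 1 / lo\<^sup>2 * (2 / real (Suc n))" for n
    proof -
      have e: "0 < 1 / real (Suc n)" by simp
      obtain T where T: "open T" "A \<subseteq> T" "T - A \<in> lmeasurable" "emeasure lebesgue (T - A) < ennreal (1 / real (Suc n))"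
        using sets_lebesgue_outer_open[OF A(1) e] .
      obtain K where K: "closed K" "K \<subseteq> A" "A - K \<in> lmeasurable" "emeasure lebesgue (A - K) < ennreal (1 / real (Suc n))"
        using sets_lebesgue_inner_closed[OF A(1) e] .
      have "compact K"
        using K(1,2) A(2) bounded_subset[OF bounded_domain, of K] by (auto simp: compact_eq_bounded_closed)
      moreover have "K \<subseteq> T \<inter> \<Omega>" "open (T \<inter> \<Omega>)" "T \<inter> \<Omega> \<subseteq> \<Omega>"
        using K(2) T(1,2) A(2) open_domain by auto
      ultimately obtain \<beta> where \<beta>: "test_function \<Omega> \<beta>" "\<And>x. 0 \<le> \<beta> x \<and> \<beta> x \<le> 1"
          "\<And>x. x \<in> K \<Longrightarrow> 0 < \<beta> x" "\<And>x. 0 < \<beta> x \<Longrightarrow> x \<in> T \<inter> \<Omega>"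
        using test_function_between by metis
      let ?B = "{x. 0 < \<beta> x}" and ?D = "(T - A) \<union> (A - K)"
      have B: "?B \<in> sets lebesgue" "P (indicator ?B)"
        using positive_set[OF \<beta>(1,2)] by blast+
      have "measure lebesgue (T - A) < 1 / real (Suc n)" "measure lebesgue (A - K) < 1 / real (Suc n)"
        using T(3,4) K(3,4) by (auto simp: emeasure_eq_measure2 fmeasurableD2 emeasure_eq_ennreal_measure ennreal_less_iff)
      then have "measure lebesgue ?D \<le> 2 / real (Suc n)"
        using measure_Un_le[of "T - A" lebesgue "A - K"] T(3) K(3) by (simp add: fmeasurableD)
      then have "1 / lo\<^sup>2 * measure lebesgue ?D \<le> 1 / lo\<^sup>2 * (2 / real (Suc n))"
        by (rule mult_left_mono) simp
      moreover have "(wnorm \<Omega> c (\<lambda>x. indicator A x - indicator ?B x))\<^sup>2 \<le> 1 / lo\<^sup>2 * measure lebesgue ?D"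
      proof (rule wnorm_indicator_diff_le[OF A(1) B(1)])
        show "?D \<in> lmeasurable" using T(3) K(3) by (rule fmeasurable.Un)
        show "(A - ?B) \<union> (?B - A) \<subseteq> ?D" using \<beta>(3,4) by blast
      qed
      ultimately show ?thesis
        using B by (intro exI[of _ ?B]) linarith
    qed
    then obtain B where B: "\<And>n. B n \<in> sets lebesgue" "\<And>n. P (indicator (B n))"
        "\<And>n. (wnorm \<Omega> c (\<lambda>x. indicator A x - indicator (B n) x))\<^sup>2 \<le> 1 / lo\<^sup>2 * (2 / real (Suc n))"
      by metis
    have "(\<lambda>n. 1 / lo\<^sup>2 * (2 * (1 / real (Suc n)))) \<longlonglongrightarrow> 1 / lo\<^sup>2 * (2 * 0)"
      by (intro tendsto_intros LIMSEQ_Suc[OF lim_1_over_n])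
    then have "(\<lambda>n. 1 / lo\<^sup>2 * (2 / real (Suc n))) \<longlonglongrightarrow> 0" by simp
    then have "(\<lambda>n. (wnorm \<Omega> c (\<lambda>x. indicator A x - indicator (B n) x))\<^sup>2) \<longlonglongrightarrow> 0"
    proof (rule Lim_null_comparison[rotated])
      show "\<forall>\<^sub>F n in sequentially. norm ((wnorm \<Omega> c (\<lambda>x. indicator A x - indicator (B n) x))\<^sup>2) \<le> 1 / lo\<^sup>2 * (2 / real (Suc n))"
        using B(3) by (intro always_eventually allI) simp
    qed
    then have "(\<lambda>n. wnorm \<Omega> c (\<lambda>x. indicator A x - indicator (B n) x)) \<longlonglongrightarrow> 0" by simp
    from lim[OF L2_indicator[OF A(1)] L2_indicator[OF B(1)] B(2) this] show ?thesis .
  qed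
  have simple: "P s" if s: "simple_function M s" "s \<in> L2 \<Omega>" for s
  proof -
    let ?A = "\<lambda>y. s -` {y} \<inter> \<Omega>"
    let ?S = "\<lambda>Y x. \<Sum>y\<in>Y. y * indicator (?A y) x"
    have A: "?A y \<in> sets lebesgue" for y
      using simple_functionD(2)[OF s(1), of "{y}"] domain_sets by (simp add: space_M sets_restrict_space_iff)
    have sums: "?S Y \<in> L2 \<Omega> \<and> P (?S Y)" if "finite Y" for Y
      using that
    proof (induction Y rule: finite_induct)
      case empty
      have "test_function \<Omega> (\<lambda>_. 0)"
        by (auto simp: test_function_def smooth_on_const intro: exI[of _ "{}"])
      from test[OF this] show ?case by (simp add: L2_zero)
    next
      case (insert y Y)
      have "?S (insert y Y) = (\<lambda>x. ?S Y x + y * indicator (?A y) x)"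
        unfolding sum.insert[OF insert.hyps] by (intro ext add.commute)
      then show ?case
        using insert.IH indicator[OF A] L2_indicator[OF A] by (simp only:) (intro conjI L2_lin lin; auto)
    qed
    have "finite (s ` \<Omega>)"
      using simple_functionD(1)[OF s(1)] by (simp only: space_M)
    then have S: "?S (s ` \<Omega>) \<in> L2 \<Omega>" "P (?S (s ` \<Omega>))"
      using sums by blast+
    have eq: "s x = ?S (s ` \<Omega>) x" if "x \<in> \<Omega>" for x
    proof -
      have "s x = (\<Sum>y\<in>s ` \<Omega>. indicator (?A y) x *\<^sub>R y)"
        using simple_function_indicator_representation_banach[OF s(1), of x] that by (simp only: space_M)
      also have "\<dots> = ?S (s ` \<Omega>) x"
        by (intro sum.cong refl) (simp add: indicator_def)
      finally show ?thesis .
    qed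
    show ?thesis
    proof (rule lim[OF s(2) S])
      show "(\<lambda>n::nat. wnorm \<Omega> c (\<lambda>x. s x - ?S (s ` \<Omega>) x)) \<longlonglongrightarrow> 0"
      proof (rule wnorm_dominated_convergence[OF s(2) S(1) const_integrable])
        fix x assume "x \<in> \<Omega>"
        from eq[OF this] show "cmod (s x - ?S (s ` \<Omega>) x) \<le> 1" "(\<lambda>n::nat. ?S (s ` \<Omega>) x) \<longlonglongrightarrow> s x"
          by (simp_all only: diff_self norm_zero zero_le_one tendsto_const)
      qed
    qed
  qed
  obtain s where s: "\<And>i. simple_function M (s i)" "\<And>x. x \<in> \<Omega> \<Longrightarrow> (\<lambda>i. s i x) \<longlonglongrightarrow> g x"
      "\<And>i x. x \<in> \<Omega> \<Longrightarrow> cmod (s i x) \<le> 2 * cmod (g x)"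
    using borel_measurable_implies_sequence_metric[OF L2_measurable[OF assms(1)], of 0]
    unfolding space_M dist_0_norm dist_commute[of _ 0] by blast
  have dom: "integrable M (\<lambda>x. (3 * cmod (g x))\<^sup>2)"
    using L2_integrable[OF assms(1)] by (simp add: power_mult_distrib)
  have sL2: "s i \<in> L2 \<Omega>" for i
  proof (rule L2_I_dominated[OF borel_measurable_simple_function[OF s(1)] dom])
    show "(cmod (s i x))\<^sup>2 \<le> (3 * cmod (g x))\<^sup>2" if "x \<in> \<Omega>" for x
      using s(3)[OF that, of i] norm_ge_zero[of "g x"] by (intro power_mono; linarith?) auto
  qed
  show "P g"
  proof (rule lim[OF assms(1) sL2 simple[OF s(1) sL2]])
    show "(\<lambda>n. wnorm \<Omega> c (\<lambda>x. g x - s n x)) \<longlonglongrightarrow> 0"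
    proof (rule wnorm_dominated_convergence[OF assms(1) sL2 dom _ s(2)])
      show "cmod (g x - s n x) \<le> 3 * cmod (g x)" if "x \<in> \<Omega>" for n x
        using s(3)[OF that, of n] norm_triangle_ineq4[of "g x" "s n x"] by linarith
    qed
  qed
qed

text \<open>Both uniqueness of weak gradients (for a constant family) and the weak convergence of gradients come from this.\<close>

lemma weak_null_of_test_functions:
  assumes G: "\<forall>\<^sub>F i in F. G i \<in> L2 \<Omega>" and bd: "\<forall>\<^sub>F i in F. wnorm \<Omega> c (G i) \<le> C"
    and test: "\<And>\<eta>. test_function \<Omega> \<eta> \<Longrightarrow> ((\<lambda>i. winner \<Omega> c (G i) (\<lambda>x. complex_of_real (\<eta> x))) \<longlongrightarrow> 0) F"
    and "h \<in> L2 \<Omega>"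
  shows "((\<lambda>i. winner \<Omega> c (G i) h) \<longlongrightarrow> 0) F"
  using \<open>h \<in> L2 \<Omega>\<close>
proof (induction rule: L2_test_induct)
  case (test \<eta>)
  then show ?case by (rule assms(3))
next
  case (lin g h a)
  have "((\<lambda>i. winner \<Omega> c (G i) g + cnj a * winner \<Omega> c (G i) h) \<longlongrightarrow> 0 + cnj a * 0) F"
    by (intro tendsto_intros lin.IH)
  moreover have "\<forall>\<^sub>F i in F. winner \<Omega> c (G i) g + cnj a * winner \<Omega> c (G i) h = winner \<Omega> c (G i) (\<lambda>x. g x + a * h x)"
    using G by eventually_elim (simp add: L2.lin_right lin.hyps)
  ultimately show ?case
    using Lim_transform_eventually by force
next
  case (lim g gs)
  show ?case
    by (rule L2.weak_limit_closed[OF G bd[folded nrm_eq_wnorm] lim(1,2) lim(3)[folded nrm_eq_wnorm] lim(4)])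
qed

end

section \<open>Weak gradients\<close>

context bounded_open_domain
begin

text \<open>The components of gradients are paired without weight, that is, with \<open>c = 1\<close>.\<close>

lemma unit_weighted_domain: "weighted_domain \<Omega> (\<lambda>_. 1) 1 1"
  by unfold_locales auto

interpretation unit: weighted_domain \<Omega> "\<lambda>_. 1" 1 1
  by (rule unit_weighted_domain)

abbreviation partial :: "'d \<Rightarrow> (real^'d \<Rightarrow> complex) \<Rightarrow> real^'d \<Rightarrow> complex" where
  "partial i g \<equiv> \<lambda>x. grad \<Omega> g x $ i"

lemma L2_test_function_derivative:
  assumes "test_function \<Omega> \<eta>"
  shows "(\<lambda>x. complex_of_real (frechet_derivative \<eta> (at x) v)) \<in> L2 \<Omega>"
  using test_function_derivative[OF assms, of v] L2_continuous_bounded by metis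

lemma L2_weak_gradient_iff:
  "L2_weak_gradient \<Omega> g G \<longleftrightarrow>
     (\<forall>i. (\<lambda>x. G x $ i) \<in> L2 \<Omega>) \<and>
     (\<forall>\<eta> i. test_function \<Omega> \<eta> \<longrightarrow>
        winner \<Omega> (\<lambda>_. 1) g (\<lambda>x. complex_of_real (frechet_derivative \<eta> (at x) (axis i 1))) =
        - winner \<Omega> (\<lambda>_. 1) (\<lambda>x. G x $ i) (\<lambda>x. complex_of_real (\<eta> x)))"
  by (simp add: L2_weak_gradient_def winner_def)

lemma L2_weak_gradient_lin:
  assumes "g \<in> L2 \<Omega>" "h \<in> L2 \<Omega>" "L2_weak_gradient \<Omega> g G" "L2_weak_gradient \<Omega> h H"
  shows "L2_weak_gradient \<Omega> (\<lambda>x. g x + a * h x) (\<lambda>x. \<chi> i. G x $ i + a * H x $ i)"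
  using assms unfolding L2_weak_gradient_iff
  by (simp add: L2_lin unit.L2.lin unit.L2_test_function L2_test_function_derivative)

text \<open>Since \<open>grad\<close> is an arbitrary choice of a weak gradient, this is what makes the Dirichlet form sesquilinear.\<close>

lemma L2_weak_gradient_unique:
  assumes "L2_weak_gradient \<Omega> g G" "L2_weak_gradient \<Omega> g G'" "k \<in> L2 \<Omega>"
  shows "winner \<Omega> (\<lambda>_. 1) (\<lambda>x. G x $ i) k = winner \<Omega> (\<lambda>_. 1) (\<lambda>x. G' x $ i) k"
proof -
  have G: "(\<lambda>x. G x $ i) \<in> L2 \<Omega>" "(\<lambda>x. G' x $ i) \<in> L2 \<Omega>"
    using assms by (auto simp: L2_weak_gradient_def)
  have "((\<lambda>_::nat. winner \<Omega> (\<lambda>_. 1) (\<lambda>x. G x $ i - G' x $ i) k) \<longlongrightarrow> 0) sequentially"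
  proof (rule unit.weak_null_of_test_functions)
    show "\<forall>\<^sub>F j in sequentially. (\<lambda>x. G x $ i - G' x $ i) \<in> L2 \<Omega>"
      using G by (simp add: unit.L2.diff_mem)
    show "\<forall>\<^sub>F j in sequentially. wnorm \<Omega> (\<lambda>_. 1) (\<lambda>x. G x $ i - G' x $ i) \<le> wnorm \<Omega> (\<lambda>_. 1) (\<lambda>x. G x $ i - G' x $ i)"
      by simp
    fix \<eta> assume \<eta>: "test_function \<Omega> \<eta>"
    then have "winner \<Omega> (\<lambda>_. 1) (\<lambda>x. G x $ i) (\<lambda>x. complex_of_real (\<eta> x))
        = winner \<Omega> (\<lambda>_. 1) (\<lambda>x. G' x $ i) (\<lambda>x. complex_of_real (\<eta> x))"
      using assms(1,2) unfolding L2_weak_gradient_iff by (metis neg_equal_iff_equal)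
    then show "((\<lambda>_::nat. winner \<Omega> (\<lambda>_. 1) (\<lambda>x. G x $ i - G' x $ i) (\<lambda>x. complex_of_real (\<eta> x))) \<longlongrightarrow> 0) sequentially"
      using G unit.L2_test_function[OF \<eta>] by (simp add: unit.L2.diff_left)
  qed fact
  then show ?thesis
    using G assms(3) by (simp add: unit.L2.diff_left tendsto_const_iff)
qed

lemma H1_L2: "g \<in> H1 \<Omega> \<Longrightarrow> g \<in> L2 \<Omega>"
  by (simp add: H1_def)

lemma grad_works: "g \<in> H1 \<Omega> \<Longrightarrow> L2_weak_gradient \<Omega> g (grad \<Omega> g)"
  unfolding grad_def by (rule someI_ex[where P = "L2_weak_gradient \<Omega> g"]) (simp add: H1_def)

lemma partial_L2: "g \<in> H1 \<Omega> \<Longrightarrow> partial i g \<in> L2 \<Omega>"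
  using grad_works by (auto simp: L2_weak_gradient_def)

lemma H1_lin: "g \<in> H1 \<Omega> \<Longrightarrow> h \<in> H1 \<Omega> \<Longrightarrow> (\<lambda>x. g x + a * h x) \<in> H1 \<Omega>"
  using L2_weak_gradient_lin[of g h "grad \<Omega> g" "grad \<Omega> h" a] grad_works L2_lin
  unfolding H1_def by blast

lemma partial_lin:
  assumes "g \<in> H1 \<Omega>" "h \<in> H1 \<Omega>" "k \<in> L2 \<Omega>"
  shows "winner \<Omega> (\<lambda>_. 1) (partial i (\<lambda>x. g x + a * h x)) k
    = winner \<Omega> (\<lambda>_. 1) (partial i g) k + a * winner \<Omega> (\<lambda>_. 1) (partial i h) k"
proof -
  have "winner \<Omega> (\<lambda>_. 1) (partial i (\<lambda>x. g x + a * h x)) k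
      = winner \<Omega> (\<lambda>_. 1) (\<lambda>x. (\<chi> j. grad \<Omega> g x $ j + a * grad \<Omega> h x $ j) $ i) k"
    by (rule L2_weak_gradient_unique[OF grad_works[OF H1_lin] L2_weak_gradient_lin])
      (intro assms H1_L2 grad_works)+
  also have "\<dots> = winner \<Omega> (\<lambda>_. 1) (\<lambda>x. grad \<Omega> g x $ i + a * grad \<Omega> h x $ i) k"
    by simp
  finally show ?thesis
    using assms by (simp add: unit.L2.lin partial_L2)
qed

lemma grad_inner_eq_sum:
  assumes "g \<in> H1 \<Omega>" "h \<in> H1 \<Omega>"
  shows "grad_inner \<Omega> g h = (\<Sum>i\<in>UNIV. winner \<Omega> (\<lambda>_. 1) (partial i g) (partial i h))"
proof -
  have "integrable M (\<lambda>x. grad \<Omega> g x $ i * cnj (grad \<Omega> h x $ i))" for i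
    using unit.winner_integrable[OF partial_L2[OF assms(1), of i] partial_L2[OF assms(2), of i]] by simp
  then show ?thesis
    by (simp add: grad_inner_def winner_def Bochner_Integration.integral_sum)
qed

end

sublocale bounded_open_domain \<subseteq> grad: hermitian_form "H1 \<Omega>" "grad_inner \<Omega>"
proof -
  interpret unit: weighted_domain \<Omega> "\<lambda>_. 1" 1 1
    by (rule unit_weighted_domain)
  show "hermitian_form (H1 \<Omega>) (grad_inner \<Omega>)"
  proof
    have "L2_weak_gradient \<Omega> (\<lambda>_. 0) (\<lambda>_. 0)"
      using L2_zero by (simp add: L2_weak_gradient_def)
    then show "(\<lambda>_. 0) \<in> H1 \<Omega>"
      using L2_zero unfolding H1_def by blast
  next
    fix g h :: "real^'d \<Rightarrow> complex" and a assume g: "g \<in> H1 \<Omega>" and h: "h \<in> H1 \<Omega>"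
    then show "(\<lambda>x. g x + a * h x) \<in> H1 \<Omega>" by (rule H1_lin)
    have "winner \<Omega> (\<lambda>_. 1) (partial i h) (partial i g) = cnj (winner \<Omega> (\<lambda>_. 1) (partial i g) (partial i h))" for i
      by (rule unit.L2.herm) (intro partial_L2 g h)+
    then show "grad_inner \<Omega> h g = cnj (grad_inner \<Omega> g h)"
      unfolding grad_inner_eq_sum[OF g h] grad_inner_eq_sum[OF h g] by simp
    show "0 \<le> Re (grad_inner \<Omega> g g)"
      unfolding grad_inner_eq_sum[OF g g] Re_sum by (intro sum_nonneg unit.L2.nonneg partial_L2 g)
    fix k assume k: "k \<in> H1 \<Omega>"
    show "grad_inner \<Omega> (\<lambda>x. g x + a * h x) k = grad_inner \<Omega> g k + a * grad_inner \<Omega> h k"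
      unfolding grad_inner_eq_sum[OF H1_lin[OF g h] k] grad_inner_eq_sum[OF g k] grad_inner_eq_sum[OF h k]
      by (simp add: partial_lin g h partial_L2 k sum.distrib sum_distrib_left)
  qed
qed

context bounded_open_domain
begin

lemma wnorm_partial_le:
  assumes "g \<in> H1 \<Omega>"
  shows "wnorm \<Omega> (\<lambda>_. 1) (partial i g) \<le> grad.nrm g"
proof -
  interpret unit: weighted_domain \<Omega> "\<lambda>_. 1" 1 1
    by (rule unit_weighted_domain)
  have "Re (winner \<Omega> (\<lambda>_. 1) (partial i g) (partial i g)) \<le> (\<Sum>j\<in>UNIV. Re (winner \<Omega> (\<lambda>_. 1) (partial j g) (partial j g)))"
    by (rule member_le_sum) (auto intro: unit.L2.nonneg partial_L2 assms)
  then show ?thesis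
    unfolding wnorm_def grad.nrm_def grad_inner_eq_sum[OF assms assms] Re_sum by (rule real_sqrt_le_mono)
qed

text \<open>Lebesgue measure is complete.\<close>

lemma borel_measurable_cong_AE:
  fixes g :: "real^'d \<Rightarrow> complex"
  assumes "g \<in> borel_measurable M" "AE x in M. g x = h x"
  shows "h \<in> borel_measurable M"
proof -
  have "AE x in lebesgue. x \<in> \<Omega> \<longrightarrow> g x = h x"
    using assms(2) AE_restrict_space_iff[of \<Omega> lebesgue "\<lambda>x. g x = h x"] domain_sets by simp
  then have eq: "AE x in lebesgue. (if x \<in> \<Omega> then g x else 0) = (if x \<in> \<Omega> then h x else 0)"
    by eventually_elim simp
  show ?thesis
    using borel_measurable_AE[OF _ eq] assms(1) by (simp only: borel_measurable_if[OF domain_sets])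
qed

lemma L2_cong_AE:
  assumes "g \<in> L2 \<Omega>" "AE x in M. g x = h x"
  shows "h \<in> L2 \<Omega>"
proof -
  have h: "h \<in> borel_measurable M"
    using borel_measurable_cong_AE[OF L2_measurable[OF assms(1)] assms(2)] .
  have "integrable M (\<lambda>x. (cmod (h x))\<^sup>2)"
  proof (rule integrable_cong_AE_imp[OF L2_integrable[OF assms(1)]])
    show "(\<lambda>x. (cmod (h x))\<^sup>2) \<in> borel_measurable M" using h by measurable
    show "AE x in M. (cmod (g x))\<^sup>2 = (cmod (h x))\<^sup>2" using assms(2) by eventually_elim simp
  qed
  with h show ?thesis by (simp add: L2_def)
qed

end

context weighted_domain
begin

lemma winner_cong_AE:
  assumes "g \<in> L2 \<Omega>" "AE x in M. g x = h x" "k \<in> L2 \<Omega>"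
  shows "winner \<Omega> c g k = winner \<Omega> c h k"
  unfolding winner_def
proof (rule integral_cong_AE)
  show "(\<lambda>x. complex_of_real (1 / (c x)\<^sup>2) * g x * cnj (k x)) \<in> borel_measurable M"
    using winner_integrable[OF assms(1,3)] by (rule borel_measurable_integrable)
  show "(\<lambda>x. complex_of_real (1 / (c x)\<^sup>2) * h x * cnj (k x)) \<in> borel_measurable M"
    using winner_integrable[OF L2_cong_AE[OF assms(1,2)] assms(3)] by (rule borel_measurable_integrable)
  show "AE x in M. complex_of_real (1 / (c x)\<^sup>2) * g x * cnj (k x) = complex_of_real (1 / (c x)\<^sup>2) * h x * cnj (k x)"
    using assms(2) by eventually_elim simp
qed

lemma winner_zero_AE:
  assumes "AE x in M. g x = 0" "k \<in> L2 \<Omega>"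
  shows "winner \<Omega> c g k = 0"
proof -
  have "AE x in M. 0 = g x"
    using assms(1) by eventually_elim simp
  from winner_cong_AE[OF L2_zero this assms(2)] show ?thesis
    using assms(2) by (simp add: L2.zero_left)
qed

lemma H1_cong_AE:
  assumes "g \<in> H1 \<Omega>" "AE x in M. g x = h x"
  shows "h \<in> H1 \<Omega>" "k \<in> H1 \<Omega> \<Longrightarrow> H1_inner \<Omega> c g k = H1_inner \<Omega> c h k"
proof -
  interpret unit: weighted_domain \<Omega> "\<lambda>_. 1" 1 1
    by (rule unit_weighted_domain)
  have L2: "g \<in> L2 \<Omega>" using assms(1) by (rule H1_L2)
  have "L2_weak_gradient \<Omega> g = L2_weak_gradient \<Omega> h"
    unfolding L2_weak_gradient_iff fun_eq_iff
    using unit.winner_cong_AE[OF L2 assms(2) L2_test_function_derivative] by auto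
  then have "grad \<Omega> g = grad \<Omega> h" "(\<exists>G. L2_weak_gradient \<Omega> g G) \<longleftrightarrow> (\<exists>G. L2_weak_gradient \<Omega> h G)"
    by (simp_all add: grad_def)
  then show "h \<in> H1 \<Omega>" "k \<in> H1 \<Omega> \<Longrightarrow> H1_inner \<Omega> c g k = H1_inner \<Omega> c h k"
    using assms L2_cong_AE[OF L2 assms(2)] winner_cong_AE[OF L2 assms(2) H1_L2]
    by (simp_all add: H1_def H1_inner_def grad_inner_def)
qed

text \<open>Weak convergence in \<open>L\<^sup>2\<close> passes to the gradients as soon as these are bounded: against a test function, the
  derivative is moved onto the test function by the definition of a weak gradient, and the test functions are dense.\<close>

lemma grad_weak_null:
  assumes R: "\<forall>\<^sub>F i in F. R i \<in> H1 \<Omega>" and bd: "\<forall>\<^sub>F i in F. grad.nrm (R i) \<le> C"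
    and weak: "\<And>h. h \<in> L2 \<Omega> \<Longrightarrow> ((\<lambda>i. winner \<Omega> c (R i) h) \<longlongrightarrow> 0) F" and \<zeta>: "\<zeta> \<in> H1 \<Omega>"
  shows "((\<lambda>i. grad_inner \<Omega> (R i) \<zeta>) \<longlongrightarrow> 0) F"
proof -
  interpret unit: weighted_domain \<Omega> "\<lambda>_. 1" 1 1
    by (rule unit_weighted_domain)
  have "((\<lambda>i. winner \<Omega> (\<lambda>_. 1) (partial j (R i)) (partial j \<zeta>)) \<longlongrightarrow> 0) F" for j
  proof (rule unit.weak_null_of_test_functions[OF _ _ _ partial_L2[OF \<zeta>]])
    show "\<forall>\<^sub>F i in F. partial j (R i) \<in> L2 \<Omega>"
      using R by eventually_elim (rule partial_L2)
    show "\<forall>\<^sub>F i in F. wnorm \<Omega> (\<lambda>_. 1) (partial j (R i)) \<le> C"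
      using R bd by eventually_elim (rule order_trans[OF wnorm_partial_le])
    fix \<eta> assume \<eta>: "test_function \<Omega> \<eta>"
    let ?d = "\<lambda>x. complex_of_real (frechet_derivative \<eta> (at x) (axis j 1))"
    \<comment> \<open>The factor \<open>c\<^sup>2\<close> cancels the weight of the product in which \<open>R\<close> is known to converge.\<close>
    let ?h = "\<lambda>x. complex_of_real ((c x)\<^sup>2) * ?d x"
    have h: "?h \<in> L2 \<Omega>"
    proof (rule L2_scale_bounded[OF L2_test_function_derivative[OF \<eta>]])
      show "(\<lambda>x. complex_of_real ((c x)\<^sup>2)) \<in> borel_measurable M"
        using weight_measurable by measurable
      show "cmod (complex_of_real ((c x)\<^sup>2)) \<le> hi\<^sup>2" if "x \<in> \<Omega>" for x
        using weight_bounds[OF that] lo_pos by (simp add: norm_power power_mono)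
    qed
    have swap: "winner \<Omega> (\<lambda>_. 1) (R i) ?d = winner \<Omega> c (R i) ?h" for i
      unfolding winner_def
    proof (rule Bochner_Integration.integral_cong)
      fix x assume "x \<in> space M"
      then have "c x \<noteq> 0" using weight_bounds[of x] lo_pos by (auto simp: space_M)
      then show "complex_of_real (1 / 1\<^sup>2) * R i x * cnj (?d x) = complex_of_real (1 / (c x)\<^sup>2) * R i x * cnj (?h x)"
        by simp
    qed simp
    have ev: "\<forall>\<^sub>F i in F. - winner \<Omega> c (R i) ?h = winner \<Omega> (\<lambda>_. 1) (partial j (R i)) (\<lambda>x. complex_of_real (\<eta> x))"
      using R
    proof eventually_elim
      case (elim i)
      then show ?case
        using grad_works[OF elim] \<eta> unfolding L2_weak_gradient_iff swap[of i, symmetric] by simp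
    qed
    show "((\<lambda>i. winner \<Omega> (\<lambda>_. 1) (partial j (R i)) (\<lambda>x. complex_of_real (\<eta> x))) \<longlongrightarrow> 0) F"
      using tendsto_minus[OF weak[OF h]] Lim_transform_eventually[OF _ ev] by simp
  qed
  then have "((\<lambda>i. \<Sum>j\<in>UNIV. winner \<Omega> (\<lambda>_. 1) (partial j (R i)) (partial j \<zeta>)) \<longlongrightarrow> (\<Sum>j\<in>(UNIV :: 'd set). 0)) F"
    by (intro tendsto_sum)
  moreover have "\<forall>\<^sub>F i in F. (\<Sum>j\<in>UNIV. winner \<Omega> (\<lambda>_. 1) (partial j (R i)) (partial j \<zeta>)) = grad_inner \<Omega> (R i) \<zeta>"
    using R by eventually_elim (simp add: grad_inner_eq_sum \<zeta>)
  ultimately show ?thesis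
    using Lim_transform_eventually by force
qed

section \<open>Gradients and eigenfunction expansions\<close>

lemma eigenbasis_coefficient:
  assumes V: "V \<subseteq> H1 \<Omega>" and eig: "weak_eigenfunction \<Omega> c V \<mu> e" and g: "g \<in> V"
  shows "grad_inner \<Omega> g e = complex_of_real (\<mu>\<^sup>2) * winner \<Omega> c g e"
proof -
  have e: "e \<in> H1 \<Omega>" "g \<in> H1 \<Omega>" and eq: "grad_inner \<Omega> e g = complex_of_real (\<mu>\<^sup>2) * winner \<Omega> c e g"
    using eig V g by (auto simp: weak_eigenfunction_def)
  show ?thesis
    using grad.herm[OF e] L2.herm[OF e[THEN H1_L2]] by (simp add: eq)
qed

lemma eigenbasis_grad_orthogonal:
  assumes V: "V \<subseteq> H1 \<Omega>" and basis: "eigenbasis \<Omega> c V \<mu> e"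
  shows "grad_inner \<Omega> (e m) (e n) = (if m = n then complex_of_real ((\<mu> n)\<^sup>2) else 0)"
proof -
  have "e m \<in> V" "weak_eigenfunction \<Omega> c V (\<mu> n) (e n)"
    using basis by (auto simp: eigenbasis_def weak_eigenfunction_def)
  from eigenbasis_coefficient[OF V this(2,1)] show ?thesis
    using basis by (simp add: eigenbasis_def orthonormal_basis_L2_def)
qed

lemma eigenbasis_grad_bessel:
  assumes V: "V \<subseteq> H1 \<Omega>" and basis: "eigenbasis \<Omega> c V \<mu> e" and g: "g \<in> V"
  shows "(\<Sum>n<(N::nat). (\<mu> n)\<^sup>2 * (cmod (winner \<Omega> c g (e n)))\<^sup>2) \<le> (grad.nrm g)\<^sup>2"
proof (rule grad.bessel)
  show "e n \<in> H1 \<Omega>" for n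
    using basis V by (auto simp: eigenbasis_def weak_eigenfunction_def)
  show "grad_inner \<Omega> g (e n) = complex_of_real ((\<mu> n)\<^sup>2) * winner \<Omega> c g (e n)" for n
    using basis by (intro eigenbasis_coefficient[OF V _ g]) (simp add: eigenbasis_def)
qed (use V g eigenbasis_grad_orthogonal[OF V basis] in auto)

text \<open>The converse of Bessel's inequality for the Dirichlet form. Completeness of the eigenfunctions is only known in \<open>L\<^sup>2\<close>, so
  one has to show that the gradient of the remainder \<open>R N\<close> of the expansion tends to \<open>0\<close>. Its squared norm equals
  \<open>\<langle>\<nabla>R N, \<nabla>g\<rangle>\<close>, and this product tends to \<open>0\<close> because \<open>R N\<close> tends to \<open>0\<close> in \<open>L\<^sup>2\<close> with bounded gradients.\<close>

lemma eigenbasis_grad_le_of_coefficients: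
  assumes V: "V \<subseteq> H1 \<Omega>" and basis: "eigenbasis \<Omega> c V \<mu> e" and g: "g \<in> V"
    and le: "\<And>N::nat. (\<Sum>n<N. (\<mu> n)\<^sup>2 * (cmod (winner \<Omega> c g (e n)))\<^sup>2) \<le> C\<^sup>2" and C: "0 \<le> C"
  shows "grad.nrm g \<le> C"
proof -
  let ?a = "\<lambda>n. winner \<Omega> c g (e n)"
  define R where "R N = (\<lambda>x. g x - (\<Sum>n<N. ?a n * e n x))" for N :: nat
  have e: "e n \<in> H1 \<Omega>" for n
    using basis V by (auto simp: eigenbasis_def weak_eigenfunction_def)
  have gH: "g \<in> H1 \<Omega>" using g V by blast
  have coeff: "grad_inner \<Omega> g (e n) = complex_of_real ((\<mu> n)\<^sup>2) * ?a n" for n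
    using basis by (intro eigenbasis_coefficient[OF V _ g]) (simp add: eigenbasis_def)
  note rem = grad.remainder[OF e eigenbasis_grad_orthogonal[OF V basis] gH coeff, folded R_def]
  have "((\<lambda>N. grad_inner \<Omega> (R N) g) \<longlongrightarrow> 0) sequentially"
  proof (rule grad_weak_null[OF _ _ _ gH])
    show "\<forall>\<^sub>F N in sequentially. R N \<in> H1 \<Omega>"
      using rem(1) by simp
    have "grad.nrm (R N) \<le> grad.nrm g" for N
    proof (rule power2_le_imp_le)
      show "(grad.nrm (R N))\<^sup>2 \<le> (grad.nrm g)\<^sup>2"
        unfolding rem(3) by (simp add: sum_nonneg)
    qed (rule grad.nrm_nonneg[OF gH])
    then show "\<forall>\<^sub>F N in sequentially. grad.nrm (R N) \<le> grad.nrm g" by simp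
    fix h assume h: "h \<in> L2 \<Omega>"
    have "(\<lambda>N. L2.nrm (R N)) \<longlonglongrightarrow> 0"
      using basis H1_L2[OF gH] by (simp add: R_def eigenbasis_def orthonormal_basis_L2_def nrm_eq_wnorm)
    then have "(\<lambda>N. L2.nrm (R N) * L2.nrm h) \<longlonglongrightarrow> 0"
      by (rule tendsto_mult_left_zero)
    then show "((\<lambda>N. winner \<Omega> c (R N) h) \<longlongrightarrow> 0) sequentially"
      by (rule Lim_null_comparison[rotated])
        (intro always_eventually allI L2.cauchy_schwarz H1_L2[OF rem(1)] h)
  qed
  then have "(\<lambda>N. Re (grad_inner \<Omega> (R N) g)) \<longlonglongrightarrow> Re 0"
    by (rule tendsto_Re)
  then have lim: "(\<lambda>N. (grad.nrm g)\<^sup>2 - (\<Sum>n<N. (\<mu> n)\<^sup>2 * (cmod (?a n))\<^sup>2)) \<longlonglongrightarrow> 0"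
    unfolding rem(2) Re_complex_of_real by simp
  have "(grad.nrm g)\<^sup>2 - C\<^sup>2 \<le> 0"
    by (rule tendsto_lowerbound[OF lim]) (use le in \<open>simp_all add: algebra_simps\<close>)
  then have "(grad.nrm g)\<^sup>2 \<le> C\<^sup>2" by simp
  then show ?thesis
    using C by (rule power2_le_imp_le)
qed

end

section \<open>Oscillators with slowly varying coefficients\<close>

text \<open>All time integrals are estimated through primitives with this mean value inequality, so that neither integrability nor
  vector-valued integrals in time enter.\<close>

lemma norm_diff_le_of_vector_derivative:
  fixes f :: "real \<Rightarrow> complex"
  assumes "0 \<le> T" and "\<And>t. t \<in> {0..T} \<Longrightarrow> (f has_vector_derivative f' t) (at t within {0..T})"
    and "\<And>t. t \<in> {0..T} \<Longrightarrow> cmod (f' t) \<le> b"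
  shows "cmod (f T - f 0) \<le> b * T"
proof -
  have "(f' has_integral f T - f 0) {0..T}"
    using assms(1,2) by (rule fundamental_theorem_of_calculus)
  moreover have "0 \<le> b"
    using assms(1) order_trans[OF norm_ge_zero assms(3)[of 0]] by simp
  ultimately show ?thesis
    using has_integral_bound_real[of b "{}" f' "f T - f 0" 0 T] assms(1,3) by simp
qed

lemma eq_of_vector_derivative_zero:
  fixes f :: "real \<Rightarrow> complex"
  assumes "\<And>t. 0 \<le> t \<Longrightarrow> (f has_vector_derivative 0) (at t within {0..})" and "0 \<le> t"
  shows "f t = f 0"
proof -
  have "cmod (f t - f 0) \<le> 0 * t"
    using assms(2)
  proof (rule norm_diff_le_of_vector_derivative)
    show "(f has_vector_derivative 0) (at s within {0..t})" if "s \<in> {0..t}" for s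
      using assms(1)[of s] that by (auto intro: has_vector_derivative_within_subset)
  qed simp
  then show ?thesis by simp
qed

text \<open>Turning the pair \<open>(z, \<mu> y)\<close> back by the angle \<open>\<mu> t\<close> makes it constant; this gives \<open>z\<close>, and then \<open>y\<close> by integration, also
  in the case \<open>\<mu> = 0\<close>.\<close>

lemma oscillator_solution:
  fixes y z :: "real \<Rightarrow> complex"
  assumes y: "\<And>t. 0 \<le> t \<Longrightarrow> (y has_vector_derivative z t) (at t within {0..})"
    and z: "\<And>t. 0 \<le> t \<Longrightarrow> (z has_vector_derivative - (\<mu>\<^sup>2 *\<^sub>R y t)) (at t within {0..})"
    and z0: "z 0 = 0" and t: "0 \<le> t"
  shows "z t = (- \<mu> * sin (\<mu> * t)) *\<^sub>R y 0" and "y t = cos (\<mu> * t) *\<^sub>R y 0"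
proof -
  have vel: "z t = (- \<mu> * sin (\<mu> * t)) *\<^sub>R y 0" if t: "0 \<le> t" for t
  proof -
    have d1: "((\<lambda>t. cos (\<mu> * t) *\<^sub>R z t + (\<mu> * sin (\<mu> * t)) *\<^sub>R y t) has_vector_derivative 0) (at t within {0..})" if "0 \<le> t" for t
      by (rule derivative_eq_intros y z that refl)+ (simp add: algebra_simps power2_eq_square)
    have p: "cos (\<mu> * t) *\<^sub>R z t + (\<mu> * sin (\<mu> * t)) *\<^sub>R y t = 0"
      using eq_of_vector_derivative_zero[OF d1 t] by (simp add: z0)
    have d2: "((\<lambda>t. sin (\<mu> * t) *\<^sub>R z t - (\<mu> * cos (\<mu> * t)) *\<^sub>R y t) has_vector_derivative 0) (at t within {0..})" if "0 \<le> t" for t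
      by (rule derivative_eq_intros y z that refl)+ (simp add: algebra_simps power2_eq_square)
    have q: "sin (\<mu> * t) *\<^sub>R z t - (\<mu> * cos (\<mu> * t)) *\<^sub>R y t = - (\<mu> *\<^sub>R y 0)"
      using eq_of_vector_derivative_zero[OF d2 t] by (simp add: z0)
    have "z t = ((cos (\<mu> * t))\<^sup>2 + (sin (\<mu> * t))\<^sup>2) *\<^sub>R z t" by simp
    also have "\<dots> = cos (\<mu> * t) *\<^sub>R (cos (\<mu> * t) *\<^sub>R z t + (\<mu> * sin (\<mu> * t)) *\<^sub>R y t)
        + sin (\<mu> * t) *\<^sub>R (sin (\<mu> * t) *\<^sub>R z t - (\<mu> * cos (\<mu> * t)) *\<^sub>R y t)"
      by (simp add: algebra_simps power2_eq_square) (simp flip: scaleR_add_left)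
    finally show ?thesis
      unfolding p q by (simp add: algebra_simps)
  qed
  then show "z t = (- \<mu> * sin (\<mu> * t)) *\<^sub>R y 0" using t .
  have "((\<lambda>t. y t - cos (\<mu> * t) *\<^sub>R y 0) has_vector_derivative 0) (at t within {0..})" if "0 \<le> t" for t
    by (rule derivative_eq_intros y that refl)+ (simp add: vel that algebra_simps)
  from eq_of_vector_derivative_zero[OF this t] show "y t = cos (\<mu> * t) *\<^sub>R y 0" by simp
qed

lemma oscillator_bounds:
  fixes y z :: "real \<Rightarrow> complex"
  assumes "\<And>t. 0 \<le> t \<Longrightarrow> (y has_vector_derivative z t) (at t within {0..})"
    and "\<And>t. 0 \<le> t \<Longrightarrow> (z has_vector_derivative - (\<mu>\<^sup>2 *\<^sub>R y t)) (at t within {0..})"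
    and "z 0 = 0" and "0 \<le> t"
  shows "cmod (z t) \<le> \<bar>\<mu>\<bar> * cmod (y 0)" and "cmod (y t) \<le> cmod (y 0)"
proof -
  have "cmod (z t) = \<bar>\<mu>\<bar> * \<bar>sin (\<mu> * t)\<bar> * cmod (y 0)" "cmod (y t) = \<bar>cos (\<mu> * t)\<bar> * cmod (y 0)"
    using oscillator_solution[OF assms] by (simp_all add: abs_mult)
  moreover have "\<bar>\<mu>\<bar> * \<bar>sin (\<mu> * t)\<bar> * cmod (y 0) \<le> \<bar>\<mu>\<bar> * 1 * cmod (y 0)"
    by (intro mult_right_mono mult_left_mono) auto
  moreover have "\<bar>cos (\<mu> * t)\<bar> * cmod (y 0) \<le> 1 * cmod (y 0)"
    by (intro mult_right_mono) auto
  ultimately show "cmod (z t) \<le> \<bar>\<mu>\<bar> * cmod (y 0)" and "cmod (y t) \<le> cmod (y 0)" by simp_all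
qed

text \<open>The velocity \<open>z\<close> is itself an oscillation of frequency \<open>\<mu>\<close>, so \<open>z' sin(\<nu>t) - \<nu> z cos(\<nu>t)\<close> has derivative
  \<open>(\<nu>\<^sup>2 - \<mu>\<^sup>2) z sin(\<nu>t)\<close>. When the frequencies differ, dividing by the factor gives a bounded primitive; this is the only
  place where the absence of resonance matters.\<close>

lemma nonresonant_primitive:
  fixes y z :: "real \<Rightarrow> complex"
  assumes y: "\<And>t. 0 \<le> t \<Longrightarrow> (y has_vector_derivative z t) (at t within {0..})"
    and z: "\<And>t. 0 \<le> t \<Longrightarrow> (z has_vector_derivative - (\<mu>\<^sup>2 *\<^sub>R y t)) (at t within {0..})"
    and z0: "z 0 = 0" and ne: "\<nu>\<^sup>2 \<noteq> \<mu>\<^sup>2"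
  obtains P K where "\<And>t. 0 \<le> t \<Longrightarrow> (P has_vector_derivative sin (\<nu> * t) *\<^sub>R z t) (at t within {0..})"
    and "\<And>t. 0 \<le> t \<Longrightarrow> cmod (P t) \<le> K"
proof
  define r where "r = 1 / (\<nu>\<^sup>2 - \<mu>\<^sup>2)"
  define P where "P t = r *\<^sub>R (- (sin (\<nu> * t) *\<^sub>R (\<mu>\<^sup>2 *\<^sub>R y t)) - (\<nu> * cos (\<nu> * t)) *\<^sub>R z t)" for t
  have r: "r * (\<nu>\<^sup>2 - \<mu>\<^sup>2) = 1" using ne by (simp add: r_def)
  show "(P has_vector_derivative sin (\<nu> * t) *\<^sub>R z t) (at t within {0..})" if "0 \<le> t" for t
  proof -
    have "(P has_vector_derivative r *\<^sub>R ((\<nu>\<^sup>2 - \<mu>\<^sup>2) *\<^sub>R (sin (\<nu> * t) *\<^sub>R z t))) (at t within {0..})"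
      unfolding P_def
      by (rule derivative_eq_intros y z that refl)+ (simp add: algebra_simps power2_eq_square)
    then show ?thesis by (simp only: scaleR_scaleR[of r "\<nu>\<^sup>2 - \<mu>\<^sup>2"] r scaleR_one)
  qed
  show "cmod (P t) \<le> \<bar>r\<bar> * (\<mu>\<^sup>2 * cmod (y 0) + \<bar>\<nu>\<bar> * (\<bar>\<mu>\<bar> * cmod (y 0)))" if "0 \<le> t" for t
  proof -
    have "cmod (P t) \<le> \<bar>r\<bar> * (\<bar>sin (\<nu> * t)\<bar> * (\<mu>\<^sup>2 * cmod (y t)) + \<bar>\<nu>\<bar> * \<bar>cos (\<nu> * t)\<bar> * cmod (z t))"
      unfolding P_def norm_scaleR
      by (intro mult_left_mono order_trans[OF norm_triangle_ineq4]) (simp_all add: abs_mult)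
    also have "\<dots> \<le> \<bar>r\<bar> * (1 * (\<mu>\<^sup>2 * cmod (y 0)) + \<bar>\<nu>\<bar> * 1 * (\<bar>\<mu>\<bar> * cmod (y 0)))"
      using oscillator_bounds[OF y z z0 that]
      by (intro mult_left_mono add_mono mult_mono) auto
    finally show ?thesis by simp
  qed
qed

text \<open>Variation of constants for \<open>b'' + \<nu>\<^sup>2 b = F\<close>. The value of the differentiated function at \<open>t = 0\<close> is \<open>-\<nu> b(0)\<close>.\<close>

lemma oscillation_integrand:
  fixes a b :: "real \<Rightarrow> complex"
  assumes "(b has_vector_derivative a t) (at t within I)"
    and "(a has_vector_derivative F - \<nu>\<^sup>2 *\<^sub>R b t) (at t within I)"
  shows "((\<lambda>t. sin (\<nu> * t) *\<^sub>R a t - (\<nu> * cos (\<nu> * t)) *\<^sub>R b t) has_vector_derivative sin (\<nu> * t) *\<^sub>R F) (at t within I)"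
  by (rule derivative_eq_intros assms refl)+ (simp add: algebra_simps power2_eq_square)

text \<open>By variation of constants, \<open>-\<nu> b(0)\<close> is the value at \<open>0\<close> of a function with derivative \<open>F sin(\<nu>t)\<close> that vanishes at time \<open>1/\<epsilon>\<close>.
  The main part of the source \<open>F\<close> is \<open>-2\<epsilon> \<alpha>\<^sub>1(\<epsilon>t) p\<close>, which is of order \<open>\<epsilon>\<close> and acts for a time \<open>1/\<epsilon>\<close>, so its size alone does not
  make \<open>b(0)\<close> small. But \<open>p sin(\<nu>t)\<close> has the bounded primitive \<open>P\<close>, and adding \<open>2\<epsilon> \<alpha>\<^sub>1(\<epsilon>t) P\<close> replaces this main part by a term of
  order \<open>\<epsilon>\<^sup>2\<close>, as the derivative falls on the slow factor. What remains is the error \<open>\<delta>\<close> of replacing \<open>g\<close> by \<open>p\<close>.\<close>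

lemma adiabatic_bound:
  fixes a b g k p P :: "real \<Rightarrow> complex" and \<alpha>\<^sub>1 \<alpha>\<^sub>2 :: "real \<Rightarrow> real"
  assumes \<epsilon>: "0 < \<epsilon>" and \<nu>: "0 < \<nu>"
    and b: "\<And>t. t \<in> {0..1/\<epsilon>} \<Longrightarrow> (b has_vector_derivative a t) (at t within {0..1/\<epsilon>})"
    and a: "\<And>t. t \<in> {0..1/\<epsilon>} \<Longrightarrow> (a has_vector_derivative
        - \<epsilon> *\<^sub>R ((2 * \<alpha>\<^sub>1 (\<epsilon> * t)) *\<^sub>R g t + (\<epsilon> * \<alpha>\<^sub>2 (\<epsilon> * t)) *\<^sub>R k t) - \<nu>\<^sup>2 *\<^sub>R b t) (at t within {0..1/\<epsilon>})"
    and terminal: "a (1/\<epsilon>) = 0" "b (1/\<epsilon>) = 0"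
    and \<alpha>': "\<And>s. s \<in> {0..1} \<Longrightarrow> (\<alpha>\<^sub>1 has_real_derivative \<alpha>\<^sub>2 s) (at s within {0..1})"
    and A: "\<And>s. s \<in> {0..1} \<Longrightarrow> \<bar>\<alpha>\<^sub>1 s\<bar> \<le> A" "\<And>s. s \<in> {0..1} \<Longrightarrow> \<bar>\<alpha>\<^sub>2 s\<bar> \<le> A"
    and gp: "\<And>t. t \<in> {0..1/\<epsilon>} \<Longrightarrow> cmod (g t - p t) \<le> \<delta>"
    and k: "\<And>t. t \<in> {0..1/\<epsilon>} \<Longrightarrow> cmod (k t) \<le> E"
    and P: "\<And>t. t \<in> {0..1/\<epsilon>} \<Longrightarrow> (P has_vector_derivative sin (\<nu> * t) *\<^sub>R p t) (at t within {0..1/\<epsilon>})"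
      "\<And>t. t \<in> {0..1/\<epsilon>} \<Longrightarrow> cmod (P t) \<le> K"
  shows "\<nu> * cmod (b 0) \<le> 2 * A * \<delta> + \<epsilon> * (A * E + 6 * A * K)"
proof -
  let ?T = "1/\<epsilon>"
  define \<Psi> where "\<Psi> t = (sin (\<nu> * t) *\<^sub>R a t - (\<nu> * cos (\<nu> * t)) *\<^sub>R b t) + (2 * \<epsilon> * \<alpha>\<^sub>1 (\<epsilon> * t)) *\<^sub>R P t" for t
  define \<Psi>' where "\<Psi>' t = (2 * \<epsilon>\<^sup>2 * \<alpha>\<^sub>2 (\<epsilon> * t)) *\<^sub>R P t - (2 * \<epsilon> * \<alpha>\<^sub>1 (\<epsilon> * t) * sin (\<nu> * t)) *\<^sub>R (g t - p t)
      - (\<epsilon>\<^sup>2 * \<alpha>\<^sub>2 (\<epsilon> * t) * sin (\<nu> * t)) *\<^sub>R k t" for t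
  have T: "0 \<le> ?T" using \<epsilon> by simp
  have unit: "\<epsilon> * t \<in> {0..1}" if "t \<in> {0..?T}" for t
    using that \<epsilon> by (auto simp: field_simps)
  have nonneg: "0 \<le> A" "0 \<le> \<delta>" "0 \<le> E" "0 \<le> K"
    using A(1)[of 0] gp[of 0] k[of 0] P(2)[of 0] T
    by (auto intro: order_trans[OF abs_ge_zero] order_trans[OF norm_ge_zero])
  have "(\<Psi> has_vector_derivative \<Psi>' t) (at t within {0..?T})" if t: "t \<in> {0..?T}" for t
  proof -
    have "((\<lambda>t. \<alpha>\<^sub>1 (\<epsilon> * t)) has_real_derivative \<alpha>\<^sub>2 (\<epsilon> * t) * \<epsilon>) (at t within {0..?T})"
    proof (rule DERIV_image_chain[where f = \<alpha>\<^sub>1 and g = "(*) \<epsilon>", unfolded o_def])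
      show "(\<alpha>\<^sub>1 has_real_derivative \<alpha>\<^sub>2 (\<epsilon> * t)) (at (\<epsilon> * t) within (*) \<epsilon> ` {0..?T})"
        by (rule DERIV_subset[OF \<alpha>'[OF unit[OF t]]]) (use unit in auto)
      show "((*) \<epsilon> has_real_derivative \<epsilon>) (at t within {0..?T})"
        by (auto intro!: derivative_eq_intros)
    qed
    then have "((\<lambda>t. 2 * \<epsilon> * \<alpha>\<^sub>1 (\<epsilon> * t)) has_real_derivative 2 * \<epsilon> * (\<alpha>\<^sub>2 (\<epsilon> * t) * \<epsilon>)) (at t within {0..?T})"
      by (rule DERIV_cmult)
    from has_vector_derivative_add[OF oscillation_integrand[OF b[OF t] a[OF t]] has_vector_derivative_scaleR[OF this P(1)[OF t]]]
    show ?thesis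
      unfolding \<Psi>_def[abs_def, symmetric]
      by (rule has_vector_derivative_eq_rhs) (simp add: \<Psi>'_def algebra_simps power2_eq_square)
  qed
  moreover have "cmod (\<Psi>' t) \<le> \<epsilon> * (2 * A * \<delta> + \<epsilon> * (A * E + 2 * A * K))" if t: "t \<in> {0..?T}" for t
  proof -
    have "cmod (\<Psi>' t) \<le> cmod ((2 * \<epsilon>\<^sup>2 * \<alpha>\<^sub>2 (\<epsilon> * t)) *\<^sub>R P t) + cmod ((2 * \<epsilon> * \<alpha>\<^sub>1 (\<epsilon> * t) * sin (\<nu> * t)) *\<^sub>R (g t - p t))
        + cmod ((\<epsilon>\<^sup>2 * \<alpha>\<^sub>2 (\<epsilon> * t) * sin (\<nu> * t)) *\<^sub>R k t)"
      unfolding \<Psi>'_def by (intro order_trans[OF norm_triangle_ineq4] add_right_mono norm_triangle_ineq4)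
    also have "\<dots> = 2 * \<epsilon>\<^sup>2 * (\<bar>\<alpha>\<^sub>2 (\<epsilon> * t)\<bar> * cmod (P t)) + 2 * \<epsilon> * ((\<bar>\<alpha>\<^sub>1 (\<epsilon> * t)\<bar> * \<bar>sin (\<nu> * t)\<bar>) * cmod (g t - p t))
        + \<epsilon>\<^sup>2 * ((\<bar>\<alpha>\<^sub>2 (\<epsilon> * t)\<bar> * \<bar>sin (\<nu> * t)\<bar>) * cmod (k t))"
      using \<epsilon> by (simp add: abs_mult)
    also have "\<dots> \<le> 2 * \<epsilon>\<^sup>2 * (A * K) + 2 * \<epsilon> * ((A * 1) * \<delta>) + \<epsilon>\<^sup>2 * ((A * 1) * E)"
      using A[OF unit[OF t]] P(2)[OF t] gp[OF t] k[OF t] \<epsilon> nonneg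
      by (intro add_mono mult_left_mono mult_mono) auto
    finally show ?thesis by (simp add: algebra_simps power2_eq_square)
  qed
  ultimately have "cmod (\<Psi> ?T - \<Psi> 0) \<le> \<epsilon> * (2 * A * \<delta> + \<epsilon> * (A * E + 2 * A * K)) * ?T"
    using T by (intro norm_diff_le_of_vector_derivative)
  then have diff: "cmod (\<Psi> ?T - \<Psi> 0) \<le> 2 * A * \<delta> + \<epsilon> * (A * E + 2 * A * K)"
    using \<epsilon> by simp
  have end_bound: "cmod ((2 * \<epsilon> * \<alpha>\<^sub>1 (\<epsilon> * t)) *\<^sub>R P t) \<le> 2 * \<epsilon> * (A * K)" if t: "t \<in> {0..?T}" for t
  proof -
    have "\<bar>\<alpha>\<^sub>1 (\<epsilon> * t)\<bar> * cmod (P t) \<le> A * K"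
      using A(1)[OF unit[OF t]] P(2)[OF t] nonneg by (intro mult_mono) auto
    then show ?thesis using \<epsilon> by (simp add: abs_mult)
  qed
  have "\<Psi> ?T = (2 * \<epsilon> * \<alpha>\<^sub>1 (\<epsilon> * ?T)) *\<^sub>R P ?T"
    by (simp only: \<Psi>_def terminal scaleR_zero_right diff_zero add_0_left)
  moreover have "\<nu> *\<^sub>R b 0 = (2 * \<epsilon> * \<alpha>\<^sub>1 (\<epsilon> * 0)) *\<^sub>R P 0 - \<Psi> 0"
    by (simp add: \<Psi>_def)
  ultimately have "\<nu> *\<^sub>R b 0 = (\<Psi> ?T - \<Psi> 0) + ((2 * \<epsilon> * \<alpha>\<^sub>1 (\<epsilon> * 0)) *\<^sub>R P 0 - (2 * \<epsilon> * \<alpha>\<^sub>1 (\<epsilon> * ?T)) *\<^sub>R P ?T)"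
    by simp
  then have "cmod (\<nu> *\<^sub>R b 0) \<le> cmod (\<Psi> ?T - \<Psi> 0) + (cmod ((2 * \<epsilon> * \<alpha>\<^sub>1 (\<epsilon> * 0)) *\<^sub>R P 0) + cmod ((2 * \<epsilon> * \<alpha>\<^sub>1 (\<epsilon> * ?T)) *\<^sub>R P ?T))"
    by (metis norm_triangle_le norm_triangle_ineq4 add_left_mono)
  also have "\<dots> \<le> (2 * A * \<delta> + \<epsilon> * (A * E + 2 * A * K)) + (2 * \<epsilon> * (A * K) + 2 * \<epsilon> * (A * K))"
    using T by (intro add_mono diff end_bound) auto
  finally show ?thesis
    using \<nu> by (simp add: algebra_simps)
qed

lemma cutoff_derivatives:
  assumes "cutoff \<alpha>"
  shows "s \<in> {0..1} \<Longrightarrow> (unit_deriv n \<alpha> has_real_derivative unit_deriv (Suc n) \<alpha> s) (at s within {0..1})"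
    and "\<exists>A. \<forall>s\<in>{0..1}. \<bar>unit_deriv n \<alpha> s\<bar> \<le> A"
    and "\<alpha> 0 = 1"
proof -
  have diff: "unit_deriv n \<alpha> differentiable (at t within {0..1})" if "t \<in> {0..1}" for n t
    using assms that by (auto simp: cutoff_def)
  show "(unit_deriv n \<alpha> has_real_derivative unit_deriv (Suc n) \<alpha> s) (at s within {0..1})" if "s \<in> {0..1}"
    using diff[OF that, of n]
    by (simp add: vector_derivative_works unit_deriv_def has_real_derivative_iff_has_vector_derivative)
  have "continuous_on {0..1} (unit_deriv n \<alpha>)"
    using diff by (intro differentiable_imp_continuous_on) (auto simp: differentiable_on_def)
  then have "bounded (unit_deriv n \<alpha> ` {0..1})"
    by (intro compact_imp_bounded compact_continuous_image) auto
  then show "\<exists>A. \<forall>s\<in>{0..1}. \<bar>unit_deriv n \<alpha> s\<bar> \<le> A"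
    by (auto simp: bounded_iff)
  show "\<alpha> 0 = 1"
    using assms by (auto simp: cutoff_def)
qed

section \<open>Coefficients of weak solutions of the wave equation\<close>

context weighted_domain
begin

text \<open>By Cauchy-Schwarz, the difference quotients of a coefficient converge because those of the solution converge in norm.\<close>

lemma coefficient_has_derivative:
  assumes sol: "weak_wave_solution \<Omega> c V I F w wt" and V: "V \<subseteq> H1 \<Omega>" and t: "t \<in> I" and h: "h \<in> L2 \<Omega>"
  shows "((\<lambda>s. winner \<Omega> c (w s) h) has_vector_derivative winner \<Omega> c (wt t) h) (at t within I)"
proof -
  have L2: "w s \<in> L2 \<Omega>" "wt s \<in> L2 \<Omega>" if "s \<in> I" for s
    using sol that V by (auto simp: weak_wave_solution_def intro: H1_L2)
  let ?q = "\<lambda>s x. (w s x - w t x) / complex_of_real (s - t) - wt t x"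
  have lim: "((\<lambda>s. wnorm \<Omega> c (?q s)) \<longlongrightarrow> 0) (at t within I)"
    using sol t by (simp add: weak_wave_solution_def)
  have "\<forall>\<^sub>F s in at t within I. norm ((1 / norm (s - t)) *\<^sub>R (winner \<Omega> c (w s) h -
      (winner \<Omega> c (w t) h + (s - t) *\<^sub>R winner \<Omega> c (wt t) h))) \<le> wnorm \<Omega> c (?q s) * wnorm \<Omega> c h"
    unfolding eventually_at_filter
  proof (intro always_eventually allI impI)
    fix s assume s: "s \<noteq> t" "s \<in> I"
    define r where "r = complex_of_real (s - t)"
    have r: "r \<noteq> 0" using s by (simp add: r_def)
    have q: "?q s = (\<lambda>x. inverse r * (w s x - w t x) - wt t x)"
      by (simp add: r_def divide_inverse mult.commute)
    have mem1: "(\<lambda>x. w s x - w t x) \<in> L2 \<Omega>"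
      by (rule L2.diff_mem[OF L2(1)[OF s(2)] L2(1)[OF t]])
    note mem = mem1 L2.scale_mem[OF mem1, of "inverse r"]
    have eq: "winner \<Omega> c (?q s) h = inverse r * (winner \<Omega> c (w s) h - winner \<Omega> c (w t) h) - winner \<Omega> c (wt t) h"
      unfolding q L2.diff_left[OF mem(2) L2(2)[OF t] h] L2.scale_left[OF mem(1) h]
        L2.diff_left[OF L2(1)[OF s(2)] L2(1)[OF t] h] ..
    have "(s - t) *\<^sub>R winner \<Omega> c (wt t) h = r * winner \<Omega> c (wt t) h"
      by (simp only: scaleR_conv_of_real r_def)
    moreover have "r * (inverse r * X - Y) = X - r * Y" for X Y
      using r by (simp add: right_diff_distrib mult.assoc[symmetric])
    ultimately have "winner \<Omega> c (w s) h - (winner \<Omega> c (w t) h + (s - t) *\<^sub>R winner \<Omega> c (wt t) h) = r * winner \<Omega> c (?q s) h"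
      unfolding eq by simp
    moreover have "cmod (winner \<Omega> c (?q s) h) \<le> wnorm \<Omega> c (?q s) * wnorm \<Omega> c h"
      unfolding nrm_eq_wnorm[symmetric] unfolding q
      by (intro L2.cauchy_schwarz L2.diff_mem mem L2(2) t h)
    moreover have cancel: "norm ((1 / norm (s - t)) *\<^sub>R (r * X)) = cmod X" for X
    proof -
      have "cmod r = norm (s - t)"
        by (simp only: r_def norm_of_real real_norm_def)
      then show ?thesis using s(1) by (simp add: norm_mult)
    qed
    ultimately show "norm ((1 / norm (s - t)) *\<^sub>R (winner \<Omega> c (w s) h -
      (winner \<Omega> c (w t) h + (s - t) *\<^sub>R winner \<Omega> c (wt t) h))) \<le> wnorm \<Omega> c (?q s) * wnorm \<Omega> c h"
      by (simp only: cancel)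
  qed
  moreover have "((\<lambda>s. wnorm \<Omega> c (?q s) * wnorm \<Omega> c h) \<longlongrightarrow> 0) (at t within I)"
    using lim by (rule tendsto_mult_left_zero)
  ultimately have "((\<lambda>s. (1 / norm (s - t)) *\<^sub>R (winner \<Omega> c (w s) h -
      (winner \<Omega> c (w t) h + (s - t) *\<^sub>R winner \<Omega> c (wt t) h))) \<longlongrightarrow> 0) (at t within I)"
    by (rule Lim_null_comparison)
  then show ?thesis
    unfolding has_vector_derivative_def has_derivative_within
    by (auto intro: bounded_linear_scaleR_left)
qed

lemma velocity_coefficient_has_derivative:
  assumes sol: "weak_wave_solution \<Omega> c V I F w wt" and V: "V \<subseteq> H1 \<Omega>" and t: "t \<in> I"
    and e: "weak_eigenfunction \<Omega> c V \<mu> e"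
  shows "((\<lambda>s. winner \<Omega> c (wt s) e) has_vector_derivative winner \<Omega> c (F t) e - \<mu>\<^sup>2 *\<^sub>R winner \<Omega> c (w t) e) (at t within I)"
proof -
  have "w t \<in> V" "e \<in> V"
    using sol e t by (auto simp: weak_wave_solution_def weak_eigenfunction_def)
  moreover from this have "((\<lambda>s. winner \<Omega> c (wt s) e) has_vector_derivative winner \<Omega> c (F t) e - grad_inner \<Omega> (w t) e) (at t within I)"
    using sol t by (simp add: weak_wave_solution_def)
  ultimately show ?thesis
    using eigenbasis_coefficient[OF V e] by (simp add: scaleR_conv_of_real)
qed

lemma forward_coefficients:
  assumes basis: "eigenbasis \<Omega> c (H1 \<Omega>) lam \<phi>" and fwd: "forward_solution \<Omega> c f u ut"
  shows "0 \<le> t \<Longrightarrow> ((\<lambda>s. winner \<Omega> c (u s) (\<phi> n)) has_vector_derivative winner \<Omega> c (ut t) (\<phi> n)) (at t within {0..})"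
    and "0 \<le> t \<Longrightarrow> ((\<lambda>s. winner \<Omega> c (ut s) (\<phi> n)) has_vector_derivative - ((lam n)\<^sup>2 *\<^sub>R winner \<Omega> c (u t) (\<phi> n))) (at t within {0..})"
    and "winner \<Omega> c (u 0) (\<phi> n) = winner \<Omega> c f (\<phi> n)"
    and "winner \<Omega> c (ut 0) (\<phi> n) = 0"
    and "0 \<le> t \<Longrightarrow> u t \<in> L2 \<Omega>" and "0 \<le> t \<Longrightarrow> ut t \<in> L2 \<Omega>"
proof -
  have sol: "weak_wave_solution \<Omega> c (H1 \<Omega>) {0..} (\<lambda>_ _. 0) u ut"
    and init: "AE x in M. u 0 x = f x" "AE x in M. ut 0 x = 0"
    using fwd by (auto simp: forward_solution_def)
  have eig: "weak_eigenfunction \<Omega> c (H1 \<Omega>) (lam n) (\<phi> n)" and \<phi>: "\<phi> n \<in> L2 \<Omega>"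
    using basis by (auto simp: eigenbasis_def orthonormal_basis_L2_def)
  show u: "u t \<in> L2 \<Omega>" if "0 \<le> t" for t
    using sol that by (auto simp: weak_wave_solution_def intro: H1_L2)
  show "ut t \<in> L2 \<Omega>" if "0 \<le> t" for t
    using sol that by (auto simp: weak_wave_solution_def)
  show "((\<lambda>s. winner \<Omega> c (u s) (\<phi> n)) has_vector_derivative winner \<Omega> c (ut t) (\<phi> n)) (at t within {0..})" if "0 \<le> t"
    using that by (intro coefficient_has_derivative[OF sol order_refl _ \<phi>]) simp
  show "((\<lambda>s. winner \<Omega> c (ut s) (\<phi> n)) has_vector_derivative - ((lam n)\<^sup>2 *\<^sub>R winner \<Omega> c (u t) (\<phi> n))) (at t within {0..})" if "0 \<le> t"
    using velocity_coefficient_has_derivative[OF sol order_refl _ eig, of t] that by (simp add: L2.zero_left \<phi>)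
  show "winner \<Omega> c (u 0) (\<phi> n) = winner \<Omega> c f (\<phi> n)"
    by (rule winner_cong_AE[OF u init(1) \<phi>]) simp
  show "winner \<Omega> c (ut 0) (\<phi> n) = 0"
    by (rule winner_zero_AE[OF init(2) \<phi>])
qed

text \<open>Each coefficient oscillates with the amplitude of its initial value; summing gives bounds that are uniform in time.\<close>

lemma forward_energy:
  assumes basis: "eigenbasis \<Omega> c (H1 \<Omega>) lam \<phi>" and fwd: "forward_solution \<Omega> c f u ut"
    and f: "f \<in> H1 \<Omega>" and t: "0 \<le> t"
  shows "L2.nrm (ut t) \<le> grad.nrm f" and "L2.nrm (u t) \<le> L2.nrm f"
proof -
  note co = forward_coefficients[OF basis fwd]
  have \<phi>: "\<phi> n \<in> L2 \<Omega>" "winner \<Omega> c (\<phi> m) (\<phi> n) = (if m = n then 1 else 0)" for m n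
    using basis by (auto simp: eigenbasis_def orthonormal_basis_L2_def)
  have complete: "(\<lambda>N. L2.nrm (\<lambda>x. g x - (\<Sum>n<N. winner \<Omega> c g (\<phi> n) * \<phi> n x))) \<longlonglongrightarrow> 0" if "g \<in> L2 \<Omega>" for g
    using basis that by (simp add: eigenbasis_def orthonormal_basis_L2_def nrm_eq_wnorm)
  have bound: "cmod (winner \<Omega> c (ut t) (\<phi> n)) \<le> \<bar>lam n\<bar> * cmod (winner \<Omega> c f (\<phi> n))"
    "cmod (winner \<Omega> c (u t) (\<phi> n)) \<le> cmod (winner \<Omega> c f (\<phi> n))" for n
    using oscillator_bounds[OF co(1,2,4) t] unfolding co(3) by blast+
  show "L2.nrm (ut t) \<le> grad.nrm f"
  proof (rule L2.nrm_le_of_coefficients[OF \<phi> co(6)[OF t] complete[OF co(6)[OF t]]])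
    fix N
    have "(\<Sum>n<N. (cmod (winner \<Omega> c (ut t) (\<phi> n)))\<^sup>2) \<le> (\<Sum>n<N. (lam n)\<^sup>2 * (cmod (winner \<Omega> c f (\<phi> n)))\<^sup>2)"
    proof (rule sum_mono)
      fix n
      show "(cmod (winner \<Omega> c (ut t) (\<phi> n)))\<^sup>2 \<le> (lam n)\<^sup>2 * (cmod (winner \<Omega> c f (\<phi> n)))\<^sup>2"
        using power_mono[OF bound(1)[of n] norm_ge_zero, of 2] by (simp add: power_mult_distrib)
    qed
    also have "\<dots> \<le> (grad.nrm f)\<^sup>2"
      by (rule eigenbasis_grad_bessel[OF order_refl basis f])
    finally show "(\<Sum>n<N. (cmod (winner \<Omega> c (ut t) (\<phi> n)))\<^sup>2) \<le> (grad.nrm f)\<^sup>2" .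
  qed (rule grad.nrm_nonneg[OF f])
  show "L2.nrm (u t) \<le> L2.nrm f"
  proof (rule L2.nrm_le_of_coefficients[OF \<phi> co(5)[OF t] complete[OF co(5)[OF t]]])
    fix N
    have "(\<Sum>n<N. (cmod (winner \<Omega> c (u t) (\<phi> n)))\<^sup>2) \<le> (\<Sum>n<N. 1 * (cmod (winner \<Omega> c f (\<phi> n)))\<^sup>2)"
      using bound(2) by (intro sum_mono) (simp add: power_mono)
    also have "\<dots> \<le> (L2.nrm f)\<^sup>2"
      by (rule L2.bessel[OF \<phi>(1) _ H1_L2[OF f]]) (simp_all add: \<phi>(2))
    finally show "(\<Sum>n<N. (cmod (winner \<Omega> c (u t) (\<phi> n)))\<^sup>2) \<le> (L2.nrm f)\<^sup>2" .
  qed (rule L2.nrm_nonneg[OF H1_L2[OF f]])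
qed

text \<open>Energy estimate, backwards from the terminal time: \<open>F\<close> changes the square root of the energy at a rate of at most \<open>b\<close>.\<close>

lemma initial_energy_le:
  assumes basis: "eigenbasis \<Omega> c V \<nu> \<psi>" and V: "V \<subseteq> H1 \<Omega>"
    and sol: "weak_wave_solution \<Omega> c V {0..T} F w wt" and T: "0 \<le> T"
    and terminal: "AE x in M. w T x = 0" "AE x in M. wt T x = 0"
    and F: "\<And>t. t \<in> {0..T} \<Longrightarrow> F t \<in> L2 \<Omega>" "\<And>t. t \<in> {0..T} \<Longrightarrow> L2.nrm (F t) \<le> b"
  shows "grad.nrm (w 0) \<le> b * T"
proof -
  have \<psi>: "\<psi> k \<in> L2 \<Omega>" "winner \<Omega> c (\<psi> m) (\<psi> k) = (if m = k then 1 else 0)"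
    and eig: "weak_eigenfunction \<Omega> c V (\<nu> k) (\<psi> k)" for m k
    using basis by (auto simp: eigenbasis_def orthonormal_basis_L2_def)
  have b: "0 \<le> b"
    using L2.nrm_nonneg[OF F(1)[of 0]] F(2)[of 0] T by simp
  have w0: "w 0 \<in> V"
    using sol T by (simp add: weak_wave_solution_def)
  have bound: "(\<Sum>k<N. (\<nu> k)\<^sup>2 * (cmod (winner \<Omega> c (w 0) (\<psi> k)))\<^sup>2) \<le> (b * T)\<^sup>2" for N
  proof -
    \<comment> \<open>Up to sign, \<open>d\<close> is the vector of the values \<open>Q k 0\<close>. Pairing \<open>Q\<close> with this fixed vector yields a scalar function, whose increment is
      \<open>D\<^sup>2\<close> and whose derivative is at most \<open>b * D\<close>.\<close>
    define d where "d k = \<nu> k *\<^sub>R winner \<Omega> c (w 0) (\<psi> k)" for k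
    define D where "D = sqrt (\<Sum>k<N. (cmod (d k))\<^sup>2)"
    have D: "0 \<le> D" "D\<^sup>2 = (\<Sum>k<N. (cmod (d k))\<^sup>2)"
      by (simp_all add: D_def sum_nonneg)
    define Q where "Q k t = sin (\<nu> k * t) *\<^sub>R winner \<Omega> c (wt t) (\<psi> k) - (\<nu> k * cos (\<nu> k * t)) *\<^sub>R winner \<Omega> c (w t) (\<psi> k)" for k t
    define \<Phi> where "\<Phi> t = (\<Sum>k<N. cnj (d k) * Q k t)" for t
    let ?S = "\<lambda>t x. \<Sum>k<N. (sin (\<nu> k * t) *\<^sub>R d k) * \<psi> k x"
    have S: "?S t \<in> L2 \<Omega>" for t
      by (intro L2.sum_mem \<psi>(1))
    have "(\<Phi> has_vector_derivative winner \<Omega> c (F t) (?S t)) (at t within {0..T})" if t: "t \<in> {0..T}" for t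
    proof -
      have "(Q k has_vector_derivative sin (\<nu> k * t) *\<^sub>R winner \<Omega> c (F t) (\<psi> k)) (at t within {0..T})" for k
        unfolding Q_def[abs_def]
        by (rule oscillation_integrand[OF coefficient_has_derivative[OF sol V t \<psi>(1)]
              velocity_coefficient_has_derivative[OF sol V t eig]])
      then have "(\<Phi> has_vector_derivative (\<Sum>k<N. cnj (d k) * (sin (\<nu> k * t) *\<^sub>R winner \<Omega> c (F t) (\<psi> k)))) (at t within {0..T})"
        unfolding \<Phi>_def[abs_def] by (intro has_vector_derivative_sum has_vector_derivative_mult_right)
      moreover have "(\<Sum>k<N. cnj (d k) * (sin (\<nu> k * t) *\<^sub>R winner \<Omega> c (F t) (\<psi> k))) = winner \<Omega> c (F t) (?S t)"
        unfolding L2.sum_right[OF \<psi>(1) F(1)[OF t]] by (intro sum.cong refl) (simp add: scaleR_conv_of_real)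
      ultimately show ?thesis by simp
    qed
    moreover have "cmod (winner \<Omega> c (F t) (?S t)) \<le> b * D" if t: "t \<in> {0..T}" for t
    proof -
      have "(L2.nrm (?S t))\<^sup>2 = (\<Sum>k<N. (cmod (sin (\<nu> k * t) *\<^sub>R d k))\<^sup>2)"
        by (rule L2.nrm_orthonormal_sum[OF \<psi>])
      also have "\<dots> \<le> D\<^sup>2"
        unfolding D(2) by (intro sum_mono power_mono) (simp_all add: mult_left_le_one_le)
      finally have "L2.nrm (?S t) \<le> D"
        using D(1) by (rule power2_le_imp_le)
      then have "L2.nrm (F t) * L2.nrm (?S t) \<le> b * D"
        using F(2)[OF t] b L2.nrm_nonneg[OF S] by (intro mult_mono) auto
      then show ?thesis
        using L2.cauchy_schwarz[OF F(1)[OF t] S] by (rule order_trans[rotated])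
    qed
    ultimately have diff: "cmod (\<Phi> T - \<Phi> 0) \<le> b * D * T"
      using T by (intro norm_diff_le_of_vector_derivative)
    have "\<Phi> T = 0"
      by (simp add: \<Phi>_def Q_def winner_zero_AE[OF terminal(1) \<psi>(1)] winner_zero_AE[OF terminal(2) \<psi>(1)])
    moreover have "\<Phi> 0 = - complex_of_real (D\<^sup>2)"
    proof -
      have "\<Phi> 0 = (\<Sum>k<N. - (d k * cnj (d k)))"
        unfolding \<Phi>_def by (intro sum.cong refl) (simp add: Q_def d_def[symmetric])
      also have "\<dots> = - complex_of_real (D\<^sup>2)"
        unfolding D(2) of_real_sum sum_negf by (simp only: complex_norm_square)
      finally show ?thesis .
    qed
    ultimately have "D\<^sup>2 \<le> (b * T) * D"
      using diff by (simp add: norm_power mult_ac)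
    then have "D \<le> b * T"
      using D(1) b T by (cases "D = 0") (auto simp: power2_eq_square)
    then have "D\<^sup>2 \<le> (b * T)\<^sup>2"
      using D(1) by (intro power_mono)
    then show ?thesis
      unfolding D(2) by (simp add: d_def power_mult_distrib)
  qed
  show ?thesis
    using b T by (intro eigenbasis_grad_le_of_coefficients[OF V basis w0 bound]) simp
qed

lemma reversal_source_coefficient:
  assumes "u t \<in> L2 \<Omega>" "ut t \<in> L2 \<Omega>"
  shows "reversal_source \<alpha> u ut \<epsilon> t \<in> L2 \<Omega>"
    and "h \<in> L2 \<Omega> \<Longrightarrow> winner \<Omega> c (reversal_source \<alpha> u ut \<epsilon> t) h =
      - \<epsilon> *\<^sub>R ((2 * unit_deriv 1 \<alpha> (\<epsilon> * t)) *\<^sub>R winner \<Omega> c (ut t) h + (\<epsilon> * unit_deriv 2 \<alpha> (\<epsilon> * t)) *\<^sub>R winner \<Omega> c (u t) h)"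
    and "L2.nrm (reversal_source \<alpha> u ut \<epsilon> t) \<le>
      \<bar>\<epsilon>\<bar> * (2 * \<bar>unit_deriv 1 \<alpha> (\<epsilon> * t)\<bar> * L2.nrm (ut t) + \<bar>\<epsilon>\<bar> * \<bar>unit_deriv 2 \<alpha> (\<epsilon> * t)\<bar> * L2.nrm (u t))"
proof -
  let ?a = "complex_of_real (- (\<epsilon> * (2 * unit_deriv 1 \<alpha> (\<epsilon> * t))))"
  let ?b = "complex_of_real (- (\<epsilon> * (\<epsilon> * unit_deriv 2 \<alpha> (\<epsilon> * t))))"
  have eq: "reversal_source \<alpha> u ut \<epsilon> t = (\<lambda>x. ?a * ut t x + ?b * u t x)"
    by (rule ext) (simp add: reversal_source_def algebra_simps)
  have mem: "(\<lambda>x. ?a * ut t x) \<in> L2 \<Omega>"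
    by (rule L2.scale_mem[OF assms(2)])
  show "reversal_source \<alpha> u ut \<epsilon> t \<in> L2 \<Omega>"
    unfolding eq by (rule L2.lin_mem[OF mem assms(1)])
  show "winner \<Omega> c (reversal_source \<alpha> u ut \<epsilon> t) h =
      - \<epsilon> *\<^sub>R ((2 * unit_deriv 1 \<alpha> (\<epsilon> * t)) *\<^sub>R winner \<Omega> c (ut t) h + (\<epsilon> * unit_deriv 2 \<alpha> (\<epsilon> * t)) *\<^sub>R winner \<Omega> c (u t) h)"
    if h: "h \<in> L2 \<Omega>"
    unfolding eq L2.lin[OF mem assms(1) h] L2.scale_left[OF assms(2) h]
    by (simp add: scaleR_conv_of_real algebra_simps)
  have "L2.nrm (reversal_source \<alpha> u ut \<epsilon> t) \<le> cmod ?a * L2.nrm (ut t) + cmod ?b * L2.nrm (u t)"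
    unfolding eq using L2.nrm_triangle_scaled[OF mem assms(1), of ?b] L2.nrm_scale[OF assms(2), of ?a] by simp
  also have "\<dots> = \<bar>\<epsilon>\<bar> * (2 * \<bar>unit_deriv 1 \<alpha> (\<epsilon> * t)\<bar> * L2.nrm (ut t) + \<bar>\<epsilon>\<bar> * \<bar>unit_deriv 2 \<alpha> (\<epsilon> * t)\<bar> * L2.nrm (u t))"
    unfolding norm_of_real by (simp add: abs_mult algebra_simps)
  finally show "L2.nrm (reversal_source \<alpha> u ut \<epsilon> t) \<le>
      \<bar>\<epsilon>\<bar> * (2 * \<bar>unit_deriv 1 \<alpha> (\<epsilon> * t)\<bar> * L2.nrm (ut t) + \<bar>\<epsilon>\<bar> * \<bar>unit_deriv 2 \<alpha> (\<epsilon> * t)\<bar> * L2.nrm (u t))" .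
qed

end

section \<open>Weak convergence\<close>

context weighted_domain
begin

lemma nonresonant_velocity_primitive:
  assumes basis: "eigenbasis \<Omega> c (H1 \<Omega>) lam \<phi>" and fwd: "forward_solution \<Omega> c f u ut"
    and ne: "\<And>n. \<nu>\<^sup>2 \<noteq> (lam n)\<^sup>2"
  obtains P K where
    "\<And>t. 0 \<le> t \<Longrightarrow> (P has_vector_derivative sin (\<nu> * t) *\<^sub>R winner \<Omega> c (ut t) (\<lambda>x. \<Sum>n<(N::nat). a n * \<phi> n x)) (at t within {0..})"
    and "\<And>t. 0 \<le> t \<Longrightarrow> cmod (P t) \<le> K"
proof -
  note co = forward_coefficients[OF basis fwd]
  have \<phi>: "\<phi> n \<in> L2 \<Omega>" for n
    using basis by (auto simp: eigenbasis_def orthonormal_basis_L2_def)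
  have "\<exists>P K. (\<forall>t\<ge>0. (P has_vector_derivative sin (\<nu> * t) *\<^sub>R winner \<Omega> c (ut t) (\<phi> n)) (at t within {0..})) \<and>
      (\<forall>t\<ge>0. cmod (P t) \<le> K)" for n
    using nonresonant_primitive[OF co(1,2,4) ne, of n] by metis
  then obtain P K where P: "\<And>n t. 0 \<le> t \<Longrightarrow> (P n has_vector_derivative sin (\<nu> * t) *\<^sub>R winner \<Omega> c (ut t) (\<phi> n)) (at t within {0..})"
      "\<And>n t. 0 \<le> t \<Longrightarrow> cmod (P n t) \<le> K n"
    by metis
  show thesis
  proof
    fix t :: real assume t: "0 \<le> t"
    have "((\<lambda>t. \<Sum>n<N. cnj (a n) * P n t) has_vector_derivative
        (\<Sum>n<N. cnj (a n) * (sin (\<nu> * t) *\<^sub>R winner \<Omega> c (ut t) (\<phi> n)))) (at t within {0..})"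
      by (intro has_vector_derivative_sum has_vector_derivative_mult_right P(1) t)
    moreover have "(\<Sum>n<N. cnj (a n) * (sin (\<nu> * t) *\<^sub>R winner \<Omega> c (ut t) (\<phi> n)))
        = sin (\<nu> * t) *\<^sub>R winner \<Omega> c (ut t) (\<lambda>x. \<Sum>n<N. a n * \<phi> n x)"
      unfolding L2.sum_right[OF \<phi> co(6)[OF t]] by (simp add: scaleR_sum_right)
    ultimately show "((\<lambda>t. \<Sum>n<N. cnj (a n) * P n t) has_vector_derivative
        sin (\<nu> * t) *\<^sub>R winner \<Omega> c (ut t) (\<lambda>x. \<Sum>n<N. a n * \<phi> n x)) (at t within {0..})"
      by simp
    show "cmod (\<Sum>n<N. cnj (a n) * P n t) \<le> (\<Sum>n<N. cmod (a n) * K n)"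
      by (intro sum_norm_le) (simp add: norm_mult mult_left_mono P(2) t)
  qed
qed

text \<open>Replace \<open>\<psi>\<close> in \<open>\<langle>u\<^sub>t, \<psi>\<rangle>\<close> by a partial sum of its Neumann expansion. The error is small uniformly in time by the energy
  bound, and the rest is a finite sum of oscillations out of resonance with \<open>\<nu>\<close>, to which the adiabatic estimate applies.\<close>

lemma reversal_coefficient_tendsto_0:
  assumes neumann: "eigenbasis \<Omega> c (H1 \<Omega>) lam \<phi>" and fwd: "forward_solution \<Omega> c f u ut" and f: "f \<in> H1 \<Omega>"
    and \<alpha>: "cutoff \<alpha>" and V: "V \<subseteq> H1 \<Omega>" and eig: "weak_eigenfunction \<Omega> c V \<nu> \<psi>"
    and \<nu>: "0 < \<nu>" and ne: "\<And>n. \<nu>\<^sup>2 \<noteq> (lam n)\<^sup>2"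
    and sol: "\<And>\<epsilon>. 0 < \<epsilon> \<Longrightarrow> weak_wave_solution \<Omega> c V {0..1/\<epsilon>} (reversal_source \<alpha> u ut \<epsilon>) (w \<epsilon>) (wt \<epsilon>)"
    and terminal: "\<And>\<epsilon>. 0 < \<epsilon> \<Longrightarrow> AE x in M. w \<epsilon> (1/\<epsilon>) x = 0" "\<And>\<epsilon>. 0 < \<epsilon> \<Longrightarrow> AE x in M. wt \<epsilon> (1/\<epsilon>) x = 0"
  shows "((\<lambda>\<epsilon>. winner \<Omega> c (w \<epsilon> 0) \<psi>) \<longlongrightarrow> 0) (at_right 0)"
proof -
  note co = forward_coefficients[OF neumann fwd] and energy = forward_energy[OF neumann fwd f]
  have \<phi>: "\<phi> n \<in> L2 \<Omega>" for n
    using neumann by (auto simp: eigenbasis_def orthonormal_basis_L2_def)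
  have \<psi>: "\<psi> \<in> L2 \<Omega>"
    using eig V by (auto simp: weak_eigenfunction_def intro: H1_L2)
  obtain A1 A2 where A12: "\<And>s. s \<in> {0..1} \<Longrightarrow> \<bar>unit_deriv 1 \<alpha> s\<bar> \<le> A1" "\<And>s. s \<in> {0..1} \<Longrightarrow> \<bar>unit_deriv 2 \<alpha> s\<bar> \<le> A2"
    using cutoff_derivatives(2)[OF \<alpha>] by metis
  define A where "A = max A1 A2"
  have A: "\<And>s. s \<in> {0..1} \<Longrightarrow> \<bar>unit_deriv 1 \<alpha> s\<bar> \<le> A" "\<And>s. s \<in> {0..1} \<Longrightarrow> \<bar>unit_deriv 2 \<alpha> s\<bar> \<le> A"
    using A12 unfolding A_def by (meson max.coboundedI1 max.coboundedI2)+
  define S where "S N = (\<lambda>x. \<Sum>n<N. winner \<Omega> c \<psi> (\<phi> n) * \<phi> n x)" for N :: nat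
  define \<delta> where "\<delta> N = grad.nrm f * L2.nrm (\<lambda>x. \<psi> x - S N x)" for N
  have S: "S N \<in> L2 \<Omega>" for N
    unfolding S_def by (intro L2.sum_mem \<phi>)
  have bound: "\<exists>X. \<forall>\<epsilon>>0. \<nu> * cmod (winner \<Omega> c (w \<epsilon> 0) \<psi>) \<le> 2 * A * \<delta> N + \<epsilon> * X" for N
  proof -
    obtain P K where P: "\<And>t. 0 \<le> t \<Longrightarrow> (P has_vector_derivative sin (\<nu> * t) *\<^sub>R winner \<Omega> c (ut t) (S N)) (at t within {0..})"
        "\<And>t. 0 \<le> t \<Longrightarrow> cmod (P t) \<le> K"
      by (rule nonresonant_velocity_primitive[OF neumann fwd ne, where N = N and a = "\<lambda>n. winner \<Omega> c \<psi> (\<phi> n)",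
            folded S_def]) (rule that)
    have "\<nu> * cmod (winner \<Omega> c (w \<epsilon> 0) \<psi>) \<le> 2 * A * \<delta> N + \<epsilon> * (A * (L2.nrm f * L2.nrm \<psi>) + 6 * A * K)" if \<epsilon>: "0 < \<epsilon>" for \<epsilon>
    proof (rule adiabatic_bound[OF \<epsilon> \<nu>])
      show "winner \<Omega> c (wt \<epsilon> (1/\<epsilon>)) \<psi> = 0" "winner \<Omega> c (w \<epsilon> (1/\<epsilon>)) \<psi> = 0"
        using winner_zero_AE terminal[OF \<epsilon>] \<psi> by blast+
      show "(unit_deriv 1 \<alpha> has_real_derivative unit_deriv 2 \<alpha> s) (at s within {0..1})" if "s \<in> {0..1}" for s
        using cutoff_derivatives(1)[OF \<alpha> that, of 1] by (simp add: numeral_2_eq_2)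
      fix t assume t: "t \<in> {0..1/\<epsilon>}"
      then have t0: "0 \<le> t" by simp
      show "((\<lambda>t. winner \<Omega> c (w \<epsilon> t) \<psi>) has_vector_derivative winner \<Omega> c (wt \<epsilon> t) \<psi>) (at t within {0..1/\<epsilon>})"
        by (rule coefficient_has_derivative[OF sol[OF \<epsilon>] V t \<psi>])
      show "((\<lambda>t. winner \<Omega> c (wt \<epsilon> t) \<psi>) has_vector_derivative
          - \<epsilon> *\<^sub>R ((2 * unit_deriv 1 \<alpha> (\<epsilon> * t)) *\<^sub>R winner \<Omega> c (ut t) \<psi> + (\<epsilon> * unit_deriv 2 \<alpha> (\<epsilon> * t)) *\<^sub>R winner \<Omega> c (u t) \<psi>)
          - \<nu>\<^sup>2 *\<^sub>R winner \<Omega> c (w \<epsilon> t) \<psi>) (at t within {0..1/\<epsilon>})"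
        using velocity_coefficient_has_derivative[OF sol[OF \<epsilon>] V t eig]
        unfolding reversal_source_coefficient(2)[of u t ut, OF co(5)[OF t0] co(6)[OF t0] \<psi>] .
      have "cmod (winner \<Omega> c (ut t) (\<lambda>x. \<psi> x - S N x)) \<le> L2.nrm (ut t) * L2.nrm (\<lambda>x. \<psi> x - S N x)"
        by (rule L2.cauchy_schwarz[OF co(6)[OF t0] L2.diff_mem[OF \<psi> S]])
      also have "\<dots> \<le> \<delta> N"
        unfolding \<delta>_def by (rule mult_right_mono[OF energy(1)[OF t0] L2.nrm_nonneg[OF L2.diff_mem[OF \<psi> S]]])
      finally show "cmod (winner \<Omega> c (ut t) \<psi> - winner \<Omega> c (ut t) (S N)) \<le> \<delta> N"
        unfolding L2.diff_right[OF \<psi> S co(6)[OF t0]] .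
      have "cmod (winner \<Omega> c (u t) \<psi>) \<le> L2.nrm (u t) * L2.nrm \<psi>"
        by (rule L2.cauchy_schwarz[OF co(5)[OF t0] \<psi>])
      also have "\<dots> \<le> L2.nrm f * L2.nrm \<psi>"
        by (rule mult_right_mono[OF energy(2)[OF t0] L2.nrm_nonneg[OF \<psi>]])
      finally show "cmod (winner \<Omega> c (u t) \<psi>) \<le> L2.nrm f * L2.nrm \<psi>" .
      show "(P has_vector_derivative sin (\<nu> * t) *\<^sub>R winner \<Omega> c (ut t) (S N)) (at t within {0..1/\<epsilon>})"
        by (rule has_vector_derivative_within_subset[OF P(1)[OF t0]]) auto
      show "cmod (P t) \<le> K"
        by (rule P(2)[OF t0])
    qed (use A in auto)
    then show ?thesis by blast
  qed
  have "(\<lambda>N. L2.nrm (\<lambda>x. \<psi> x - S N x)) \<longlonglongrightarrow> 0"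
    using neumann \<psi> by (simp add: S_def eigenbasis_def orthonormal_basis_L2_def nrm_eq_wnorm)
  then have \<delta>: "(\<lambda>N. 2 * A * \<delta> N) \<longlonglongrightarrow> 0"
    unfolding \<delta>_def by (intro tendsto_mult_right_zero)
  show ?thesis
  proof (rule tendstoI)
    fix r :: real assume r: "0 < r"
    have "\<forall>\<^sub>F N in sequentially. 2 * A * \<delta> N < \<nu> * r / 2"
      using r \<nu> by (intro order_tendstoD(2)[OF \<delta>]) simp
    then obtain N where N: "2 * A * \<delta> N < \<nu> * r / 2"
      by (auto simp: eventually_sequentially)
    obtain X where X: "\<And>\<epsilon>. 0 < \<epsilon> \<Longrightarrow> \<nu> * cmod (winner \<Omega> c (w \<epsilon> 0) \<psi>) \<le> 2 * A * \<delta> N + \<epsilon> * X"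
      using bound by metis
    have "((\<lambda>\<epsilon>. \<epsilon> * X) \<longlongrightarrow> 0) (at_right 0)"
      by (intro tendsto_mult_left_zero tendsto_ident_at)
    then have "\<forall>\<^sub>F \<epsilon> in at_right 0. \<epsilon> * X < \<nu> * r / 2"
      using r \<nu> by (intro order_tendstoD(2)) auto
    then show "\<forall>\<^sub>F \<epsilon> in at_right 0. dist (winner \<Omega> c (w \<epsilon> 0) \<psi>) 0 < r"
      using eventually_at_right_less[of 0]
    proof eventually_elim
      case (elim \<epsilon>)
      have "\<nu> * cmod (winner \<Omega> c (w \<epsilon> 0) \<psi>) < \<nu> * r"
        using X[OF elim(2)] N elim(1) by simp
      then show ?case using \<nu> by simp
    qed
  qed
qed

text \<open>The source is of order \<open>\<epsilon>\<close> and acts for a time \<open>1/\<epsilon>\<close>.\<close>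

lemma reversal_energy_bounded:
  assumes neumann: "eigenbasis \<Omega> c (H1 \<Omega>) lam \<phi>" and fwd: "forward_solution \<Omega> c f u ut" and f: "f \<in> H1 \<Omega>"
    and \<alpha>: "cutoff \<alpha>" and V: "V \<subseteq> H1 \<Omega>" and mixed: "eigenbasis \<Omega> c V \<nu> \<psi>"
    and sol: "\<And>\<epsilon>. 0 < \<epsilon> \<Longrightarrow> weak_wave_solution \<Omega> c V {0..1/\<epsilon>} (reversal_source \<alpha> u ut \<epsilon>) (w \<epsilon>) (wt \<epsilon>)"
    and terminal: "\<And>\<epsilon>. 0 < \<epsilon> \<Longrightarrow> AE x in M. w \<epsilon> (1/\<epsilon>) x = 0" "\<And>\<epsilon>. 0 < \<epsilon> \<Longrightarrow> AE x in M. wt \<epsilon> (1/\<epsilon>) x = 0"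
  obtains C where "\<And>\<epsilon>. 0 < \<epsilon> \<Longrightarrow> \<epsilon> < 1 \<Longrightarrow> grad.nrm (w \<epsilon> 0) \<le> C"
proof -
  note co = forward_coefficients[OF neumann fwd] and energy = forward_energy[OF neumann fwd f]
  obtain A1 A2 where A: "\<And>s. s \<in> {0..1} \<Longrightarrow> \<bar>unit_deriv 1 \<alpha> s\<bar> \<le> A1" "\<And>s. s \<in> {0..1} \<Longrightarrow> \<bar>unit_deriv 2 \<alpha> s\<bar> \<le> A2"
    using cutoff_derivatives(2)[OF \<alpha>] by metis
  have A0: "0 \<le> A1" "0 \<le> A2"
    using A[of 0] by (auto intro: order_trans[OF abs_ge_zero])
  have E0: "0 \<le> grad.nrm f" "0 \<le> L2.nrm f"
    using grad.nrm_nonneg[OF f] L2.nrm_nonneg[OF H1_L2[OF f]] by auto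
  define C where "C = 2 * A1 * grad.nrm f + A2 * L2.nrm f"
  have "grad.nrm (w \<epsilon> 0) \<le> C" if \<epsilon>: "0 < \<epsilon>" "\<epsilon> < 1" for \<epsilon>
  proof -
    have "grad.nrm (w \<epsilon> 0) \<le> (\<epsilon> * C) * (1/\<epsilon>)"
    proof (rule initial_energy_le[OF mixed V sol[OF \<epsilon>(1)] _ terminal[OF \<epsilon>(1)]])
      fix t assume t: "t \<in> {0..1/\<epsilon>}"
      then have t0: "0 \<le> t" by simp
      have s: "\<epsilon> * t \<in> {0..1}"
        using t \<epsilon> by (auto simp: field_simps)
      note mem = co(5)[OF t0] co(6)[OF t0]
      show "reversal_source \<alpha> u ut \<epsilon> t \<in> L2 \<Omega>"
        by (rule reversal_source_coefficient(1)[of u t ut, OF mem])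
      have "\<bar>unit_deriv 1 \<alpha> (\<epsilon> * t)\<bar> * L2.nrm (ut t) \<le> A1 * grad.nrm f"
        using A(1)[OF s] energy(1)[OF t0] A0 L2.nrm_nonneg[OF mem(2)] by (intro mult_mono) auto
      moreover have "\<epsilon> * (\<bar>unit_deriv 2 \<alpha> (\<epsilon> * t)\<bar> * L2.nrm (u t)) \<le> 1 * (A2 * L2.nrm f)"
        using A(2)[OF s] energy(2)[OF t0] A0 E0 \<epsilon> L2.nrm_nonneg[OF mem(1)] by (intro mult_mono) auto
      ultimately have "2 * \<bar>unit_deriv 1 \<alpha> (\<epsilon> * t)\<bar> * L2.nrm (ut t) + \<bar>\<epsilon>\<bar> * \<bar>unit_deriv 2 \<alpha> (\<epsilon> * t)\<bar> * L2.nrm (u t) \<le> C"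
        using \<epsilon> by (simp add: C_def mult.assoc)
      then have "\<bar>\<epsilon>\<bar> * (2 * \<bar>unit_deriv 1 \<alpha> (\<epsilon> * t)\<bar> * L2.nrm (ut t) + \<bar>\<epsilon>\<bar> * \<bar>unit_deriv 2 \<alpha> (\<epsilon> * t)\<bar> * L2.nrm (u t)) \<le> \<epsilon> * C"
        using \<epsilon> by (simp add: mult_left_mono)
      with reversal_source_coefficient(3)[of u t ut, OF mem, of \<alpha> \<epsilon>]
      show "L2.nrm (reversal_source \<alpha> u ut \<epsilon> t) \<le> \<epsilon> * C"
        by (rule order_trans)
    qed (use \<epsilon> in simp)
    then show ?thesis using \<epsilon> by simp
  qed
  then show thesis by (rule that)
qed

text \<open>The smallest frequency \<open>\<nu> 0\<close> is positive, so the gradient controls the \<open>L\<^sup>2\<close> norm. Hence the family is bounded in \<open>L\<^sup>2\<close>, and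
  convergence needs to be tested on finite combinations of eigenfunctions only.\<close>

lemma weak_null_of_coefficients:
  assumes basis: "eigenbasis \<Omega> c V \<nu> \<psi>" and V: "V \<subseteq> H1 \<Omega>" and \<nu>: "\<And>k. 0 < \<nu> k"
    and R: "\<forall>\<^sub>F i in F. R i \<in> V" and bd: "\<forall>\<^sub>F i in F. grad.nrm (R i) \<le> C"
    and coeff: "\<And>k. ((\<lambda>i. winner \<Omega> c (R i) (\<psi> k)) \<longlongrightarrow> 0) F"
    and h: "h \<in> L2 \<Omega>"
  shows "((\<lambda>i. winner \<Omega> c (R i) h) \<longlongrightarrow> 0) F"
proof -
  have \<psi>: "\<psi> k \<in> L2 \<Omega>" "winner \<Omega> c (\<psi> m) (\<psi> k) = (if m = k then 1 else 0)" for m k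
    using basis by (auto simp: eigenbasis_def orthonormal_basis_L2_def)
  have complete: "(\<lambda>N. L2.nrm (\<lambda>x. g x - (\<Sum>k<N. winner \<Omega> c g (\<psi> k) * \<psi> k x))) \<longlonglongrightarrow> 0" if "g \<in> L2 \<Omega>" for g
    using basis that by (simp add: eigenbasis_def orthonormal_basis_L2_def nrm_eq_wnorm)
  have mono: "\<nu> 0 \<le> \<nu> k" for k
    using basis by (simp add: eigenbasis_def monoD)
  have poincare: "L2.nrm g \<le> grad.nrm g / \<nu> 0" if g: "g \<in> V" for g
  proof -
    have gL: "g \<in> L2 \<Omega>" and gH: "g \<in> H1 \<Omega>"
      using g V H1_L2 by auto
    show ?thesis
    proof (rule L2.nrm_le_of_coefficients[OF \<psi> gL complete[OF gL]])
      fix N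
      have "(\<nu> 0)\<^sup>2 * (\<Sum>k<N. (cmod (winner \<Omega> c g (\<psi> k)))\<^sup>2) \<le> (\<Sum>k<N. (\<nu> k)\<^sup>2 * (cmod (winner \<Omega> c g (\<psi> k)))\<^sup>2)"
        unfolding sum_distrib_left using mono \<nu>[of 0]
        by (intro sum_mono mult_right_mono power_mono) (auto intro: less_imp_le)
      also have "\<dots> \<le> (grad.nrm g)\<^sup>2"
        by (rule eigenbasis_grad_bessel[OF V basis g])
      finally show "(\<Sum>k<N. (cmod (winner \<Omega> c g (\<psi> k)))\<^sup>2) \<le> (grad.nrm g / \<nu> 0)\<^sup>2"
        using \<nu>[of 0] by (simp add: power_divide pos_le_divide_eq mult.commute)
    qed (use grad.nrm_nonneg[OF gH] \<nu>[of 0] in simp)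
  qed
  show ?thesis
  proof (rule L2.weak_limit_closed[OF _ _ h _ complete[OF h]])
    show "\<forall>\<^sub>F i in F. R i \<in> L2 \<Omega>"
      using R by eventually_elim (use V H1_L2 in auto)
    show "\<forall>\<^sub>F i in F. L2.nrm (R i) \<le> C / \<nu> 0"
      using R bd
    proof eventually_elim
      case (elim i)
      have "grad.nrm (R i) / \<nu> 0 \<le> C / \<nu> 0"
        using elim(2) \<nu>[of 0] by (intro divide_right_mono) auto
      with poincare[OF elim(1)] show ?case by (rule order_trans)
    qed
    fix N
    show "(\<lambda>x. \<Sum>k<N. winner \<Omega> c h (\<psi> k) * \<psi> k x) \<in> L2 \<Omega>"
      by (intro L2.sum_mem \<psi>)
    have "((\<lambda>i. \<Sum>k<N. cnj (winner \<Omega> c h (\<psi> k)) * winner \<Omega> c (R i) (\<psi> k)) \<longlongrightarrow> (\<Sum>k<N. 0)) F"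
      by (intro tendsto_sum tendsto_mult_right_zero coeff)
    moreover have "\<forall>\<^sub>F i in F. (\<Sum>k<N. cnj (winner \<Omega> c h (\<psi> k)) * winner \<Omega> c (R i) (\<psi> k))
        = winner \<Omega> c (R i) (\<lambda>x. \<Sum>k<N. winner \<Omega> c h (\<psi> k) * \<psi> k x)"
      using R
    proof eventually_elim
      case (elim i)
      then have "R i \<in> L2 \<Omega>" using V H1_L2 by auto
      then show ?case by (rule L2.sum_right[OF \<psi>(1), symmetric])
    qed
    ultimately show "((\<lambda>i. winner \<Omega> c (R i) (\<lambda>x. \<Sum>k<N. winner \<Omega> c h (\<psi> k) * \<psi> k x)) \<longlongrightarrow> 0) F"
      using Lim_transform_eventually by force
  qed
qed

end

theorem theorem1:
  fixes \<Omega> \<Sigma>\<^sub>1 :: "(real^'d) set"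
    and c :: "real^'d \<Rightarrow> real" and c_min c_max :: real
    and \<alpha> :: "real \<Rightarrow> real"
    and f :: "real^'d \<Rightarrow> complex"
    and lam \<nu> :: "nat \<Rightarrow> real" and \<phi> \<psi> :: "nat \<Rightarrow> real^'d \<Rightarrow> complex"
    and u ut :: "real \<Rightarrow> real^'d \<Rightarrow> complex"
    and v :: "real \<Rightarrow> real \<Rightarrow> real^'d \<Rightarrow> complex"
  assumes "bounded_pws_domain \<Omega>"
    and "\<Sigma>\<^sub>1 \<subseteq> frontier \<Omega>" and "\<Sigma>\<^sub>1 \<in> sets borel" and "0 < emeasure surface_measure \<Sigma>\<^sub>1"
    and "twice_differentiable_on c \<Omega>"
    and "0 < c_min" and "\<And>x. x \<in> closure \<Omega> \<Longrightarrow> c_min \<le> c x \<and> c x \<le> c_max"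
    and "cutoff \<alpha>"
    and "f \<in> H1 \<Omega>" and "compactly_supported_in \<Omega> f"
    and "neumann_eigenbasis \<Omega> c lam \<phi>" and "mixed_eigenbasis \<Omega> \<Sigma>\<^sub>1 c \<nu> \<psi>"
    and "\<And>n k. lam n \<noteq> \<nu> k"
    and "forward_solution \<Omega> c f u ut"
    and "\<And>\<epsilon>. 0 < \<epsilon> \<Longrightarrow> gradual_time_reversal \<Omega> \<Sigma>\<^sub>1 c \<alpha> u ut \<epsilon> (v \<epsilon>)"
  shows "weakly_converges_H1 \<Omega> c (\<lambda>\<epsilon>. v \<epsilon> 0) f (at_right 0)"
proof -
  let ?V = "H1_vanishing_on \<Omega> \<Sigma>\<^sub>1"
  interpret bounded_open_domain \<Omega>
    using assms(1) by unfold_locales (auto simp: bounded_pws_domain_def)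
  interpret weighted_domain \<Omega> c c_min c_max
  proof
    have "continuous_on \<Omega> c"
      using assms(5) by (auto simp: twice_differentiable_on_def intro: differentiable_imp_continuous_on)
    then show "c \<in> borel_measurable M"
      using domain_sets by (rule continuous_imp_measurable_on_sets_lebesgue)
    show "c_min \<le> c x \<and> c x \<le> c_max" if "x \<in> \<Omega>" for x
      using assms(7) that closure_subset by blast
  qed (rule assms(6))
  have neumann: "eigenbasis \<Omega> c (H1 \<Omega>) lam \<phi>" "\<And>n. 0 \<le> lam n"
    using assms(11) by (auto simp: neumann_eigenbasis_def)
  have mixed: "eigenbasis \<Omega> c ?V \<nu> \<psi>" "\<And>k. 0 < \<nu> k"
    using assms(12) by (auto simp: mixed_eigenbasis_def)
  have V: "?V \<subseteq> H1 \<Omega>"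
    by (auto simp: H1_vanishing_on_def)
  define correction where "correction \<epsilon> w wt \<longleftrightarrow>
      weak_wave_solution \<Omega> c ?V {0..1/\<epsilon>} (reversal_source \<alpha> u ut \<epsilon>) w wt \<and>
      (AE x in M. w (1/\<epsilon>) x = 0) \<and> (AE x in M. wt (1/\<epsilon>) x = 0) \<and>
      (\<forall>t\<in>{0..1/\<epsilon>}. AE x in M. v \<epsilon> t x = u t x * complex_of_real (\<alpha> (\<epsilon> * t)) + w t x)" for \<epsilon> w wt
  have "\<exists>w wt. correction \<epsilon> w wt" if "0 < \<epsilon>" for \<epsilon>
    using assms(15)[OF that] unfolding gradual_time_reversal_def correction_def .
  then obtain w wt where "\<And>\<epsilon>. 0 < \<epsilon> \<Longrightarrow> correction \<epsilon> (w \<epsilon>) (wt \<epsilon>)"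
    by metis
  then have w: "\<And>\<epsilon>. 0 < \<epsilon> \<Longrightarrow> weak_wave_solution \<Omega> c ?V {0..1/\<epsilon>} (reversal_source \<alpha> u ut \<epsilon>) (w \<epsilon>) (wt \<epsilon>)"
      "\<And>\<epsilon>. 0 < \<epsilon> \<Longrightarrow> AE x in M. w \<epsilon> (1/\<epsilon>) x = 0" "\<And>\<epsilon>. 0 < \<epsilon> \<Longrightarrow> AE x in M. wt \<epsilon> (1/\<epsilon>) x = 0"
      "\<And>\<epsilon> t. 0 < \<epsilon> \<Longrightarrow> t \<in> {0..1/\<epsilon>} \<Longrightarrow> AE x in M. v \<epsilon> t x = u t x * complex_of_real (\<alpha> (\<epsilon> * t)) + w \<epsilon> t x"
    unfolding correction_def by blast+
  have w0: "w \<epsilon> 0 \<in> ?V" if "0 < \<epsilon>" for \<epsilon>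
    using w(1)[OF that] that by (simp add: weak_wave_solution_def)
  have v0: "AE x in M. f x + w \<epsilon> 0 x = v \<epsilon> 0 x" if \<epsilon>: "0 < \<epsilon>" for \<epsilon>
  proof -
    have "AE x in M. u 0 x = f x"
      using assms(14) by (simp add: forward_solution_def)
    moreover have "AE x in M. v \<epsilon> 0 x = u 0 x * complex_of_real (\<alpha> (\<epsilon> * 0)) + w \<epsilon> 0 x"
      using \<epsilon> by (intro w(4)) auto
    ultimately show ?thesis
      by eventually_elim (simp add: cutoff_derivatives(3)[OF assms(8)])
  qed
  have sum_H1: "(\<lambda>x. f x + w \<epsilon> 0 x) \<in> H1 \<Omega>" if "0 < \<epsilon>" for \<epsilon>
    using w0[OF that] V assms(9) by (intro grad.add_mem) auto
  have pos: "\<forall>\<^sub>F \<epsilon> in at_right (0::real). 0 < \<epsilon>"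
    by (rule eventually_at_right_less)
  have wV: "\<forall>\<^sub>F \<epsilon> in at_right 0. w \<epsilon> 0 \<in> ?V"
    using pos by eventually_elim (rule w0)
  obtain C where C: "\<And>\<epsilon>. 0 < \<epsilon> \<Longrightarrow> \<epsilon> < 1 \<Longrightarrow> grad.nrm (w \<epsilon> 0) \<le> C"
    using reversal_energy_bounded[OF neumann(1) assms(14,9,8) V mixed(1) w(1,2,3)] by blast
  have "\<forall>\<^sub>F \<epsilon> in at_right (0::real). \<epsilon> < 1"
    by (rule order_tendstoD(2)[OF tendsto_ident_at]) simp
  with pos have bd: "\<forall>\<^sub>F \<epsilon> in at_right 0. grad.nrm (w \<epsilon> 0) \<le> C"
    by eventually_elim (rule C)
  have ne: "(\<nu> k)\<^sup>2 \<noteq> (lam n)\<^sup>2" for n k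
    using assms(13)[of n k] neumann(2)[of n] mixed(2)[of k] by (simp add: power2_eq_iff_nonneg less_imp_le)
  have coeff: "((\<lambda>\<epsilon>. winner \<Omega> c (w \<epsilon> 0) (\<psi> k)) \<longlongrightarrow> 0) (at_right 0)" for k
  proof (rule reversal_coefficient_tendsto_0[OF neumann(1) assms(14,9,8) V _ mixed(2) ne w(1,2,3)])
    show "weak_eigenfunction \<Omega> c ?V (\<nu> k) (\<psi> k)"
      using mixed(1) by (simp add: eigenbasis_def)
  qed
  have weak: "((\<lambda>\<epsilon>. winner \<Omega> c (w \<epsilon> 0) h) \<longlongrightarrow> 0) (at_right 0)" if "h \<in> L2 \<Omega>" for h
    by (rule weak_null_of_coefficients[OF mixed(1) V mixed(2) wV bd coeff that])
  show ?thesis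
    unfolding weakly_converges_H1_def
  proof (intro conjI ballI)
    show "\<forall>\<^sub>F \<epsilon> in at_right 0. v \<epsilon> 0 \<in> H1 \<Omega>"
      using pos by eventually_elim (rule H1_cong_AE(1)[OF sum_H1 v0])
    show "f \<in> H1 \<Omega>" by fact
    fix \<zeta> assume \<zeta>: "\<zeta> \<in> H1 \<Omega>"
    have "((\<lambda>\<epsilon>. grad_inner \<Omega> (w \<epsilon> 0) \<zeta>) \<longlongrightarrow> 0) (at_right 0)"
    proof (rule grad_weak_null[OF _ bd weak \<zeta>])
      show "\<forall>\<^sub>F \<epsilon> in at_right 0. w \<epsilon> 0 \<in> H1 \<Omega>"
        using wV by eventually_elim (use V in auto)
    qed
    with weak[OF H1_L2[OF \<zeta>]]
    have "((\<lambda>\<epsilon>. H1_inner \<Omega> c f \<zeta> + (winner \<Omega> c (w \<epsilon> 0) \<zeta> + grad_inner \<Omega> (w \<epsilon> 0) \<zeta>)) \<longlongrightarrow> H1_inner \<Omega> c f \<zeta> + (0 + 0)) (at_right 0)"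
      by (intro tendsto_add tendsto_const)
    moreover have "\<forall>\<^sub>F \<epsilon> in at_right 0. H1_inner \<Omega> c f \<zeta> + (winner \<Omega> c (w \<epsilon> 0) \<zeta> + grad_inner \<Omega> (w \<epsilon> 0) \<zeta>) = H1_inner \<Omega> c (v \<epsilon> 0) \<zeta>"
      using pos
    proof eventually_elim
      case (elim \<epsilon>)
      have H: "w \<epsilon> 0 \<in> H1 \<Omega>" using w0[OF elim] V by auto
      have "H1_inner \<Omega> c (\<lambda>x. f x + w \<epsilon> 0 x) \<zeta> = H1_inner \<Omega> c (v \<epsilon> 0) \<zeta>"
        by (rule H1_cong_AE(2)[OF sum_H1[OF elim] v0[OF elim] \<zeta>])
      then show ?case
        unfolding H1_inner_def grad.add_left[OF assms(9) H \<zeta>] L2.add_left[OF H1_L2[OF assms(9)] H1_L2[OF H] H1_L2[OF \<zeta>]]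
        by (simp add: algebra_simps)
    qed
    ultimately have "((\<lambda>\<epsilon>. H1_inner \<Omega> c (v \<epsilon> 0) \<zeta>) \<longlongrightarrow> H1_inner \<Omega> c f \<zeta> + (0 + 0)) (at_right 0)"
      by (rule Lim_transform_eventually)
    then show "((\<lambda>\<epsilon>. H1_inner \<Omega> c (v \<epsilon> 0) \<zeta>) \<longlongrightarrow> H1_inner \<Omega> c f \<zeta>) (at_right 0)"
      by simp
  qed
qed

end
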